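(* Let $(V,c)$ be a braided vector space over a field $K$. Assume that the Nichols algebra $\mathcal B(V,c)$ is a quadratic algebra. Then $\mathrm{sdeg}(V,c)\le1$.
   Context: $K$ is a field, vector spaces are over $K$, $\otimes=\otimes_K$, and the name of an object also denotes its identity map. A braided vector space $(V,c)$ is a vector space $V$ with a $K$-linear map $c:V\otimes V\to V\otimes V$ such that $(c\otimes V)(V\otimes c)(c\otimes V)=(V\otimes c)(c\otimes V)(V\otimes c)$. A quadratic algebra is an associative graded $K$-algebra $A=\bigoplus_{n\in\mathbb N}A^n$ with $A^0=K$, generated by $A^1$, such that the kernel of the natural surjection $\pi:T_K(A^1)\to A$ is generated as a two-sided ideal by $\ker(\pi)\cap(A^1\otimes A^1)$. A braided algebra $(A,m,u,c)$ is an associative unital algebra with a braided vector space $(A,c)$ such that $c(m\otimes A)=(A\otimes m)(c\otimes A)(A\otimes c)$, $c(A\otimes m)=(m\otimes A)(A\otimes c)(c\otimes A)$, $c(u\otimes A)=A\otimes u$, $c(A\otimes u)=u\otimes A$; braided coalgebras are defined dually. A braided bialgebra is both a braided algebra and a braided coalgebra with $\Delta m=(m\otimes m)(B\otimes c\otimes B)(\Delta\otimes\Delta)$, with $\Delta,\varepsilon$ unital and $\varepsilon$ multiplicative. It is graded if $B=\bigoplus_{n\in\mathbb N}B^n$ with $m,\Delta$ graded, $c(B^a\otimes B^b)\subseteq B^b\otimes B^a$ and $\varepsilon|_{B^n}=0$ for $n>0$; $\Delta_B^{a,b}:B^{a+b}\to B^a\otimes B^b$ are the components of $\Delta$. For a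 graded braided bialgebra $B$, put $E_n(B)=\bigcap_{a,b\ge1,\ a+b=n}\ker(\Delta_B^{a,b})$ for $n\ge2$ and $E(B)=\bigoplus_{n\ge2}E_n(B)$. $S(B)=B/(E(B))$ (quotient by the generated two-sided ideal) is again a graded braided bialgebra via the projection. Put $S^{[0]}(B)=B$, $S^{[n]}(B)=S(S^{[n-1]}(B))$. The strongness degree $\mathrm{sdeg}(B)$ is the least $t\in\mathbb N$ such that the projection $S^{[t]}(B)\to S^{[t+1]}(B)$ is an isomorphism ($\infty$ if none exists). $T=T(V,c)$ is the tensor algebra with its unique braided bialgebra structure such that the braiding extends $c$ and elements of $V$ are primitive; it is graded by $T^n=V^{\otimes n}$. Put $\mathrm{sdeg}(V,c)=\mathrm{sdeg}(T(V,c))$. The Nichols algebra is the graded braided bialgebra $\mathcal B(V,c)=\bigoplus_n V^{\otimes n}/\ker(\Gamma_n)$, a quotient of $T(V,c)$, where $\Gamma_0=\mathrm{Id}_K$ and $\Gamma_n=(\Gamma_{n-1}\otimes V)\Delta_T^{n-1,1}:V^{\otimes n}\to V^{\otimes n}$ for $n\ge1$ (with $V^{\otimes(n-1)}\otimes V=V^{\otimes n}$). *)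

theory Defs
  imports
    "HOL-Algebra.Module"
    "HOL-Algebra.Ideal"
    "HOL-Algebra.Subrings"
    "HOL-Library.Extended_Nat"
begin

section \<open>Linear algebra over a field\<close>

definition linear_map ::
    "('k,'r) ring_scheme \<Rightarrow> ('k,'a,'m) module_scheme \<Rightarrow> ('k,'b,'n) module_scheme \<Rightarrow> ('a \<Rightarrow> 'b) \<Rightarrow> bool" where
  "linear_map K M N f \<longleftrightarrow>
     f \<in> carrier M \<rightarrow> carrier N \<and>
     (\<forall>x\<in>carrier M. \<forall>y\<in>carrier M. f (x \<oplus>\<^bsub>M\<^esub> y) = f x \<oplus>\<^bsub>N\<^esub> f y) \<and>
     (\<forall>k\<in>carrier K. \<forall>x\<in>carrier M. f (k \<odot>\<^bsub>M\<^esub> x) = k \<odot>\<^bsub>N\<^esub> f x)"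

definition mspan ::
    "('k,'r) ring_scheme \<Rightarrow> ('k,'a,'m) module_scheme \<Rightarrow> 'a set \<Rightarrow> 'a set" where
  "mspan K M S = \<Inter>{N. submodule N K M \<and> S \<subseteq> N}"

text \<open>
  A quotient is carried by a set of chosen representatives, one for each coset, rather than by the
  cosets themselves. The element type is then unchanged, so that a quotient construction can be
  iterated an indefinite number of times. The map \<open>coset_rep M I\<close> is the canonical
  projection. The multiplicative part of the quotient is meaningful when \<open>I\<close> is a
  two-sided ideal.
\<close>

definition coset_rep :: "('k,'a,'m) module_scheme \<Rightarrow> 'a set \<Rightarrow> 'a \<Rightarrow> 'a" where
  "coset_rep M I x = (SOME y. y \<in> I +>\<^bsub>M\<^esub> x)"

definition quot :: "('k,'a,'m) module_scheme \<Rightarrow> 'a set \<Rightarrow> ('k,'a) module" where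
  "quot M I =
     \<lparr>carrier = coset_rep M I ` carrier M,
      mult = (\<lambda>x y. coset_rep M I (x \<otimes>\<^bsub>M\<^esub> y)),
      one = coset_rep M I \<one>\<^bsub>M\<^esub>,
      zero = coset_rep M I \<zero>\<^bsub>M\<^esub>,
      add = (\<lambda>x y. coset_rep M I (x \<oplus>\<^bsub>M\<^esub> y)),
      smult = (\<lambda>k x. coset_rep M I (k \<odot>\<^bsub>M\<^esub> x))\<rparr>"

definition delta :: "('k,'r) ring_scheme \<Rightarrow> 'x \<Rightarrow> 'x \<Rightarrow> 'k" where
  "delta K x = (\<lambda>y. if y = x then \<one>\<^bsub>K\<^esub> else \<zero>\<^bsub>K\<^esub>)"

definition free_module :: "('k,'r) ring_scheme \<Rightarrow> 'x set \<Rightarrow> ('k, 'x \<Rightarrow> 'k) module" where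
  "free_module K X =
     \<lparr>carrier = {f. (\<forall>x. f x \<in> carrier K) \<and> (\<forall>x. x \<notin> X \<longrightarrow> f x = \<zero>\<^bsub>K\<^esub>) \<and> finite {x. f x \<noteq> \<zero>\<^bsub>K\<^esub>}},
      mult = undefined, one = undefined,
      zero = (\<lambda>x. \<zero>\<^bsub>K\<^esub>),
      add = (\<lambda>f g x. f x \<oplus>\<^bsub>K\<^esub> g x),
      smult = (\<lambda>k f x. k \<otimes>\<^bsub>K\<^esub> f x)\<rparr>"


section \<open>Tensor products\<close>

definition bilinear_relations ::
    "('k,'r) ring_scheme \<Rightarrow> ('k,'a,'m) module_scheme \<Rightarrow> ('k,'b,'n) module_scheme \<Rightarrow> ('a \<times> 'b \<Rightarrow> 'k) set" where
  "bilinear_relations K A B =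
     (let F = free_module K (carrier A \<times> carrier B); d = (\<lambda>a b. delta K (a, b)) in
       {d (a \<oplus>\<^bsub>A\<^esub> a') b \<ominus>\<^bsub>F\<^esub> (d a b \<oplus>\<^bsub>F\<^esub> d a' b) | a a' b.
          a \<in> carrier A \<and> a' \<in> carrier A \<and> b \<in> carrier B} \<union>
       {d a (b \<oplus>\<^bsub>B\<^esub> b') \<ominus>\<^bsub>F\<^esub> (d a b \<oplus>\<^bsub>F\<^esub> d a b') | a b b'.
          a \<in> carrier A \<and> b \<in> carrier B \<and> b' \<in> carrier B} \<union>
       {d (k \<odot>\<^bsub>A\<^esub> a) b \<ominus>\<^bsub>F\<^esub> k \<odot>\<^bsub>F\<^esub> d a b | k a b.
          k \<in> carrier K \<and> a \<in> carrier A \<and> b \<in> carrier B} \<union>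
       {d a (k \<odot>\<^bsub>B\<^esub> b) \<ominus>\<^bsub>F\<^esub> k \<odot>\<^bsub>F\<^esub> d a b | k a b.
          k \<in> carrier K \<and> a \<in> carrier A \<and> b \<in> carrier B})"

definition tensor_null ::
    "('k,'r) ring_scheme \<Rightarrow> ('k,'a,'m) module_scheme \<Rightarrow> ('k,'b,'n) module_scheme \<Rightarrow> ('a \<times> 'b \<Rightarrow> 'k) set" where
  "tensor_null K A B =
     mspan K (free_module K (carrier A \<times> carrier B)) (bilinear_relations K A B)"

definition tensor ::
    "('k,'r) ring_scheme \<Rightarrow> ('k,'a,'m) module_scheme \<Rightarrow> ('k,'b,'n) module_scheme \<Rightarrow> ('k, 'a \<times> 'b \<Rightarrow> 'k) module" where
  "tensor K A B = quot (free_module K (carrier A \<times> carrier B)) (tensor_null K A B)"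

definition pure ::
    "('k,'r) ring_scheme \<Rightarrow> ('k,'a,'m) module_scheme \<Rightarrow> ('k,'b,'n) module_scheme \<Rightarrow> 'a \<Rightarrow> 'b \<Rightarrow> ('a \<times> 'b \<Rightarrow> 'k)" where
  "pure K A B a b =
     coset_rep (free_module K (carrier A \<times> carrier B)) (tensor_null K A B) (delta K (a, b))"

text \<open>
  \<open>tlift K P \<beta>\<close> is the linear map to \<open>P\<close> induced by the bilinear map
  \<open>\<beta>\<close>: an element of a tensor product is itself a formal sum of pairs, on which
  \<open>\<beta>\<close> is evaluated. \<open>tmap K C D f g\<close> is \<open>f \<otimes> g\<close>, with values in
  \<open>C \<otimes> D\<close>.
\<close>

definition tlift ::
    "('k,'r) ring_scheme \<Rightarrow> ('k,'p,'m) module_scheme \<Rightarrow> ('a \<Rightarrow> 'b \<Rightarrow> 'p) \<Rightarrow> ('a \<times> 'b \<Rightarrow> 'k) \<Rightarrow> 'p" where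
  "tlift K P \<beta> t = (\<Oplus>\<^bsub>P\<^esub>p\<in>{p. t p \<noteq> \<zero>\<^bsub>K\<^esub>}. t p \<odot>\<^bsub>P\<^esub> \<beta> (fst p) (snd p))"

definition tmap ::
    "('k,'r) ring_scheme \<Rightarrow> ('k,'c,'m) module_scheme \<Rightarrow> ('k,'d,'n) module_scheme \<Rightarrow>
     ('a \<Rightarrow> 'c) \<Rightarrow> ('b \<Rightarrow> 'd) \<Rightarrow> ('a \<times> 'b \<Rightarrow> 'k) \<Rightarrow> ('c \<times> 'd \<Rightarrow> 'k)" where
  "tmap K C D f g = tlift K (tensor K C D) (\<lambda>a b. pure K C D (f a) (g b))"

text \<open>The associator \<open>(A \<otimes> B) \<otimes> C \<rightarrow> A \<otimes> (B \<otimes> C)\<close> and its inverse.\<close>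

definition assoc_r ::
    "('k,'r) ring_scheme \<Rightarrow> ('k,'a,'m) module_scheme \<Rightarrow> ('k,'b,'n) module_scheme \<Rightarrow> ('k,'c,'l) module_scheme \<Rightarrow>
     (('a \<times> 'b \<Rightarrow> 'k) \<times> 'c \<Rightarrow> 'k) \<Rightarrow> ('a \<times> ('b \<times> 'c \<Rightarrow> 'k) \<Rightarrow> 'k)" where
  "assoc_r K A B C =
     (let P = tensor K A (tensor K B C) in
      tlift K P (\<lambda>s c. tlift K P (\<lambda>a b. pure K A (tensor K B C) a (pure K B C b c)) s))"

definition assoc_l ::
    "('k,'r) ring_scheme \<Rightarrow> ('k,'a,'m) module_scheme \<Rightarrow> ('k,'b,'n) module_scheme \<Rightarrow> ('k,'c,'l) module_scheme \<Rightarrow>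
     ('a \<times> ('b \<times> 'c \<Rightarrow> 'k) \<Rightarrow> 'k) \<Rightarrow> (('a \<times> 'b \<Rightarrow> 'k) \<times> 'c \<Rightarrow> 'k)" where
  "assoc_l K A B C =
     (let P = tensor K (tensor K A B) C in
      tlift K P (\<lambda>a s. tlift K P (\<lambda>b c. pure K (tensor K A B) C (pure K A B a b) c) s))"


section \<open>Braided vector spaces\<close>

text \<open>
  Both \<open>c \<otimes> V\<close> and \<open>V \<otimes> c\<close> act on \<open>(V \<otimes> V) \<otimes> V\<close>.
\<close>

definition braid12 ::
    "('k,'r) ring_scheme \<Rightarrow> ('k,'v,'m) module_scheme \<Rightarrow> (('v \<times> 'v \<Rightarrow> 'k) \<Rightarrow> ('v \<times> 'v \<Rightarrow> 'k)) \<Rightarrow>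
     (('v \<times> 'v \<Rightarrow> 'k) \<times> 'v \<Rightarrow> 'k) \<Rightarrow> (('v \<times> 'v \<Rightarrow> 'k) \<times> 'v \<Rightarrow> 'k)" where
  "braid12 K V c = tmap K (tensor K V V) V c id"

definition braid23 ::
    "('k,'r) ring_scheme \<Rightarrow> ('k,'v,'m) module_scheme \<Rightarrow> (('v \<times> 'v \<Rightarrow> 'k) \<Rightarrow> ('v \<times> 'v \<Rightarrow> 'k)) \<Rightarrow>
     (('v \<times> 'v \<Rightarrow> 'k) \<times> 'v \<Rightarrow> 'k) \<Rightarrow> (('v \<times> 'v \<Rightarrow> 'k) \<times> 'v \<Rightarrow> 'k)" where
  "braid23 K V c = assoc_l K V V V \<circ> tmap K V (tensor K V V) id c \<circ> assoc_r K V V V"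

definition braided_vector_space ::
    "('k,'r) ring_scheme \<Rightarrow> ('k,'v,'m) module_scheme \<Rightarrow> (('v \<times> 'v \<Rightarrow> 'k) \<Rightarrow> ('v \<times> 'v \<Rightarrow> 'k)) \<Rightarrow> bool" where
  "braided_vector_space K V c \<longleftrightarrow>
     module K V \<and>
     linear_map K (tensor K V V) (tensor K V V) c \<and>
     (\<forall>t\<in>carrier (tensor K (tensor K V V) V).
        braid12 K V c (braid23 K V c (braid12 K V c t)) =
        braid23 K V c (braid12 K V c (braid23 K V c t)))"


section \<open>Graded algebras and quadratic algebras\<close>

definition assoc_algebra :: "('k,'r) ring_scheme \<Rightarrow> ('k,'a,'m) module_scheme \<Rightarrow> bool" where
  "assoc_algebra K A \<longleftrightarrow>
     module K A \<and> ring A \<and>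
     (\<forall>k\<in>carrier K. \<forall>x\<in>carrier A. \<forall>y\<in>carrier A.
        (k \<odot>\<^bsub>A\<^esub> x) \<otimes>\<^bsub>A\<^esub> y = k \<odot>\<^bsub>A\<^esub> (x \<otimes>\<^bsub>A\<^esub> y) \<and>
        x \<otimes>\<^bsub>A\<^esub> (k \<odot>\<^bsub>A\<^esub> y) = k \<odot>\<^bsub>A\<^esub> (x \<otimes>\<^bsub>A\<^esub> y))"

definition graded_decomp ::
    "('k,'a,'m) module_scheme \<Rightarrow> (nat \<Rightarrow> 'a set) \<Rightarrow> 'a \<Rightarrow> (nat \<Rightarrow> 'a) \<Rightarrow> bool" where
  "graded_decomp M G x f \<longleftrightarrow>
     (\<forall>n. f n \<in> G n) \<and> finite {n. f n \<noteq> \<zero>\<^bsub>M\<^esub>} \<and> x = (\<Oplus>\<^bsub>M\<^esub>n\<in>{n. f n \<noteq> \<zero>\<^bsub>M\<^esub>}. f n)"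

definition graded_module ::
    "('k,'r) ring_scheme \<Rightarrow> ('k,'a,'m) module_scheme \<Rightarrow> (nat \<Rightarrow> 'a set) \<Rightarrow> bool" where
  "graded_module K M G \<longleftrightarrow>
     module K M \<and> (\<forall>n. submodule (G n) K M) \<and>
     (\<forall>x\<in>carrier M. \<exists>!f. graded_decomp M G x f)"

definition component :: "('k,'a,'m) module_scheme \<Rightarrow> (nat \<Rightarrow> 'a set) \<Rightarrow> nat \<Rightarrow> 'a \<Rightarrow> 'a" where
  "component M G n x = (THE f. graded_decomp M G x f) n"

definition graded_algebra ::
    "('k,'r) ring_scheme \<Rightarrow> ('k,'a,'m) module_scheme \<Rightarrow> (nat \<Rightarrow> 'a set) \<Rightarrow> bool" where
  "graded_algebra K A G \<longleftrightarrow>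
     assoc_algebra K A \<and> graded_module K A G \<and> \<one>\<^bsub>A\<^esub> \<in> G 0 \<and>
     (\<forall>a b. \<forall>x\<in>G a. \<forall>y\<in>G b. x \<otimes>\<^bsub>A\<^esub> y \<in> G (a + b))"

text \<open>
  The tensor algebra of \<open>M\<close> is the free associative algebra on the set
  \<open>carrier M\<close>, whose elements are formal sums of words with concatenation as product,
  modulo the ideal which makes the inclusion of the letters linear.
\<close>

definition free_algebra :: "('k,'r) ring_scheme \<Rightarrow> 'x set \<Rightarrow> ('k, 'x list \<Rightarrow> 'k) module" where
  "free_algebra K X = (free_module K (lists X))
     \<lparr>mult := (\<lambda>f g w. \<Oplus>\<^bsub>K\<^esub>i\<in>{..length w}. f (take i w) \<otimes>\<^bsub>K\<^esub> g (drop i w)),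
      one := delta K []\<rparr>"

definition linear_relations ::
    "('k,'r) ring_scheme \<Rightarrow> ('k,'a,'m) module_scheme \<Rightarrow> ('a list \<Rightarrow> 'k) set" where
  "linear_relations K M =
     (let F = free_algebra K (carrier M); d = (\<lambda>a. delta K [a]) in
       {d (a \<oplus>\<^bsub>M\<^esub> b) \<ominus>\<^bsub>F\<^esub> (d a \<oplus>\<^bsub>F\<^esub> d b) | a b. a \<in> carrier M \<and> b \<in> carrier M} \<union>
       {d (k \<odot>\<^bsub>M\<^esub> a) \<ominus>\<^bsub>F\<^esub> k \<odot>\<^bsub>F\<^esub> d a | k a. k \<in> carrier K \<and> a \<in> carrier M})"

definition tensor_alg_proj ::
    "('k,'r) ring_scheme \<Rightarrow> ('k,'a,'m) module_scheme \<Rightarrow> ('a list \<Rightarrow> 'k) \<Rightarrow> ('a list \<Rightarrow> 'k)" where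
  "tensor_alg_proj K M =
     (let F = free_algebra K (carrier M) in coset_rep F (Idl\<^bsub>F\<^esub> (linear_relations K M)))"

definition tensor_alg ::
    "('k,'r) ring_scheme \<Rightarrow> ('k,'a,'m) module_scheme \<Rightarrow> ('k, 'a list \<Rightarrow> 'k) module" where
  "tensor_alg K M =
     (let F = free_algebra K (carrier M) in quot F (Idl\<^bsub>F\<^esub> (linear_relations K M)))"

text \<open>The \<open>n\<close>-th tensor power, as the image of the formal sums of words of length \<open>n\<close>.\<close>

definition tensor_power ::
    "('k,'r) ring_scheme \<Rightarrow> ('k,'a,'m) module_scheme \<Rightarrow> nat \<Rightarrow> ('a list \<Rightarrow> 'k) set" where
  "tensor_power K M n =
     tensor_alg_proj K M `
       {f \<in> carrier (free_algebra K (carrier M)). \<forall>w. f w \<noteq> \<zero>\<^bsub>K\<^esub> \<longrightarrow> length w = n}"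

definition tensor_alg_incl ::
    "('k,'r) ring_scheme \<Rightarrow> ('k,'a,'m) module_scheme \<Rightarrow> 'a \<Rightarrow> ('a list \<Rightarrow> 'k)" where
  "tensor_alg_incl K M v = tensor_alg_proj K M (delta K [v])"

text \<open>
  The algebra map from the tensor algebra of a subspace of \<open>A\<close> to \<open>A\<close>
  extending the inclusion: a word is sent to the product of its letters.
\<close>

definition tensor_alg_eval ::
    "('k,'r) ring_scheme \<Rightarrow> ('k,'a,'m) module_scheme \<Rightarrow> ('a list \<Rightarrow> 'k) \<Rightarrow> 'a" where
  "tensor_alg_eval K A t =
     (\<Oplus>\<^bsub>A\<^esub>w\<in>{w. t w \<noteq> \<zero>\<^bsub>K\<^esub>}. t w \<odot>\<^bsub>A\<^esub> foldr (mult A) w \<one>\<^bsub>A\<^esub>)"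

text \<open>
  The condition \<open>A\<^sup>0 = K\<close> means that the unit map \<open>K \<rightarrow> A\<^sup>0\<close> is bijective.
\<close>

definition quadratic_algebra ::
    "('k,'r) ring_scheme \<Rightarrow> ('k,'a,'m) module_scheme \<Rightarrow> (nat \<Rightarrow> 'a set) \<Rightarrow> bool" where
  "quadratic_algebra K A G \<longleftrightarrow>
     graded_algebra K A G \<and>
     bij_betw (\<lambda>k. k \<odot>\<^bsub>A\<^esub> \<one>\<^bsub>A\<^esub>) (carrier K) (G 0) \<and>
     (\<forall>D. subring D A \<and> submodule D K A \<and> G 1 \<subseteq> D \<longrightarrow> D = carrier A) \<and>
     (let A1 = A\<lparr>carrier := G 1\<rparr>; T = tensor_alg K A1;
          R = a_kernel T A (tensor_alg_eval K A)
      in R = Idl\<^bsub>T\<^esub> (R \<inter> tensor_power K A1 2))"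


section \<open>Graded braided bialgebras\<close>

record ('k,'b) braided_bialg = "('k,'b) module" +
  comult :: "'b \<Rightarrow> ('b \<times> 'b \<Rightarrow> 'k)"
  counit :: "'b \<Rightarrow> 'k"
  braiding :: "('b \<times> 'b \<Rightarrow> 'k) \<Rightarrow> ('b \<times> 'b \<Rightarrow> 'k)"
  grading :: "nat \<Rightarrow> 'b set"

definition mult_map ::
    "('k,'r) ring_scheme \<Rightarrow> ('k,'b,'m) module_scheme \<Rightarrow> ('b \<times> 'b \<Rightarrow> 'k) \<Rightarrow> 'b" where
  "mult_map K A = tlift K A (mult A)"

text \<open>
  The two unit axioms are written with the identifications
  \<open>K \<otimes> A = A = A \<otimes> K\<close>; the counit axioms below likewise.
\<close>

definition braided_algebra ::
    "('k,'r) ring_scheme \<Rightarrow> ('k,'b,'m) braided_bialg_scheme \<Rightarrow> bool" where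
  "braided_algebra K A \<longleftrightarrow>
     (let AA = tensor K A A; c = braiding A; m = mult_map K A;
          c12 = braid12 K A c; c23 = braid23 K A c in
      assoc_algebra K A \<and> braided_vector_space K A c \<and>
      (\<forall>t\<in>carrier (tensor K AA A).
         c (tmap K A A m id t) = tmap K A A id m (assoc_r K A A A (c12 (c23 t))) \<and>
         c (tmap K A A id m (assoc_r K A A A t)) = tmap K A A m id (c23 (c12 t))) \<and>
      (\<forall>x\<in>carrier A.
         c (pure K A A \<one>\<^bsub>A\<^esub> x) = pure K A A x \<one>\<^bsub>A\<^esub> \<and>
         c (pure K A A x \<one>\<^bsub>A\<^esub>) = pure K A A \<one>\<^bsub>A\<^esub> x))"

definition counit_left ::
    "('k,'r) ring_scheme \<Rightarrow> ('k,'b,'m) braided_bialg_scheme \<Rightarrow> ('b \<times> 'b \<Rightarrow> 'k) \<Rightarrow> 'b" where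
  "counit_left K C = tlift K C (\<lambda>x y. counit C x \<odot>\<^bsub>C\<^esub> y)"

definition counit_right ::
    "('k,'r) ring_scheme \<Rightarrow> ('k,'b,'m) braided_bialg_scheme \<Rightarrow> ('b \<times> 'b \<Rightarrow> 'k) \<Rightarrow> 'b" where
  "counit_right K C = tlift K C (\<lambda>x y. counit C y \<odot>\<^bsub>C\<^esub> x)"

definition braided_coalgebra ::
    "('k,'r) ring_scheme \<Rightarrow> ('k,'b,'m) braided_bialg_scheme \<Rightarrow> bool" where
  "braided_coalgebra K C \<longleftrightarrow>
     (let CC = tensor K C C; c = braiding C; D = comult C; e = counit C;
          c12 = braid12 K C c; c23 = braid23 K C c in
      braided_vector_space K C c \<and>
      linear_map K C CC D \<and>
      e \<in> carrier C \<rightarrow> carrier K \<and>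
      (\<forall>x\<in>carrier C. \<forall>y\<in>carrier C. e (x \<oplus>\<^bsub>C\<^esub> y) = e x \<oplus>\<^bsub>K\<^esub> e y) \<and>
      (\<forall>k\<in>carrier K. \<forall>x\<in>carrier C. e (k \<odot>\<^bsub>C\<^esub> x) = k \<otimes>\<^bsub>K\<^esub> e x) \<and>
      (\<forall>x\<in>carrier C.
         assoc_r K C C C (tmap K CC C D id (D x)) = tmap K C CC id D (D x) \<and>
         counit_left K C (D x) = x \<and> counit_right K C (D x) = x) \<and>
      (\<forall>t\<in>carrier CC.
         tmap K CC C D id (c t) = c23 (c12 (assoc_l K C C C (tmap K C CC id D t))) \<and>
         assoc_l K C C C (tmap K C CC id D (c t)) = c12 (c23 (tmap K CC C D id t)) \<and>
         counit_left K C (c t) = counit_right K C t \<and>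
         counit_right K C (c t) = counit_left K C t))"

text \<open>\<open>B \<otimes> c \<otimes> B\<close> as an endomorphism of \<open>(B \<otimes> B) \<otimes> (B \<otimes> B)\<close>.\<close>

definition middle_braid ::
    "('k,'r) ring_scheme \<Rightarrow> ('k,'b,'m) module_scheme \<Rightarrow> (('b \<times> 'b \<Rightarrow> 'k) \<Rightarrow> ('b \<times> 'b \<Rightarrow> 'k)) \<Rightarrow>
     (('b \<times> 'b \<Rightarrow> 'k) \<times> ('b \<times> 'b \<Rightarrow> 'k) \<Rightarrow> 'k) \<Rightarrow> (('b \<times> 'b \<Rightarrow> 'k) \<times> ('b \<times> 'b \<Rightarrow> 'k) \<Rightarrow> 'k)" where
  "middle_braid K B c =
     (let BB = tensor K B B in
      assoc_r K BB B B \<circ> tmap K (tensor K BB B) B (braid23 K B c) id \<circ> assoc_l K BB B B)"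

definition braided_bialgebra ::
    "('k,'r) ring_scheme \<Rightarrow> ('k,'b,'m) braided_bialg_scheme \<Rightarrow> bool" where
  "braided_bialgebra K B \<longleftrightarrow>
     (let BB = tensor K B B; c = braiding B; m = mult_map K B; D = comult B; e = counit B in
      braided_algebra K B \<and> braided_coalgebra K B \<and>
      (\<forall>t\<in>carrier BB.
         D (m t) = tmap K B B m m (middle_braid K B c (tmap K BB BB D D t))) \<and>
      D \<one>\<^bsub>B\<^esub> = pure K B B \<one>\<^bsub>B\<^esub> \<one>\<^bsub>B\<^esub> \<and>
      e \<one>\<^bsub>B\<^esub> = \<one>\<^bsub>K\<^esub> \<and>
      (\<forall>x\<in>carrier B. \<forall>y\<in>carrier B. e (x \<otimes>\<^bsub>B\<^esub> y) = e x \<otimes>\<^bsub>K\<^esub> e y))"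

definition graded_braided_bialgebra ::
    "('k,'r) ring_scheme \<Rightarrow> ('k,'b,'m) braided_bialg_scheme \<Rightarrow> bool" where
  "graded_braided_bialgebra K B \<longleftrightarrow>
     (let G = grading B; BB = tensor K B B;
          tens = (\<lambda>a b. {pure K B B x y | x y. x \<in> G a \<and> y \<in> G b}) in
      braided_bialgebra K B \<and> graded_algebra K B G \<and>
      (\<forall>n. \<forall>x\<in>G n. comult B x \<in> mspan K BB (\<Union>{tens a b | a b. a + b = n})) \<and>
      (\<forall>a b. braiding B ` mspan K BB (tens a b) \<subseteq> mspan K BB (tens b a)) \<and>
      (\<forall>n>0. \<forall>x\<in>G n. counit B x = \<zero>\<^bsub>K\<^esub>))"

text \<open>
  The component \<open>\<Delta>\<^sup>a\<^sup>,\<^sup>b\<close>, extended by zero to the homogeneous parts of degree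
  other than \<open>a + b\<close>, and with \<open>B\<^sup>a \<otimes> B\<^sup>b\<close> regarded inside
  \<open>B \<otimes> B\<close>.
\<close>

definition comult_comp ::
    "('k,'r) ring_scheme \<Rightarrow> ('k,'b,'m) braided_bialg_scheme \<Rightarrow> nat \<Rightarrow> nat \<Rightarrow> 'b \<Rightarrow> ('b \<times> 'b \<Rightarrow> 'k)" where
  "comult_comp K B a b x =
     tmap K B B (component B (grading B) a) (component B (grading B) b) (comult B x)"

text \<open>
  The structure maps of \<open>B/I\<close> are induced by those of \<open>B\<close>; elements of
  \<open>B/I\<close> are representatives in \<open>B\<close>, to which the maps of \<open>B\<close> can be
  applied directly. The result is a graded braided bialgebra when the structure maps of
  \<open>B\<close> descend to the quotient.
\<close>

definition quot_bialg ::
    "('k,'r) ring_scheme \<Rightarrow> ('k,'b,'m) braided_bialg_scheme \<Rightarrow> 'b set \<Rightarrow> ('k,'b) braided_bialg" where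
  "quot_bialg K B I =
     (let Q = quot B I; p = coset_rep B I in
      module.extend Q (braided_bialg.fields
        (\<lambda>x. tmap K Q Q p p (comult B x))
        (counit B)
        (tlift K (tensor K Q Q) (\<lambda>x y. tmap K Q Q p p (braiding B (pure K B B x y))))
        (\<lambda>n. p ` grading B n)))"


section \<open>Strongness degree\<close>

definition E_deg ::
    "('k,'r) ring_scheme \<Rightarrow> ('k,'b,'m) braided_bialg_scheme \<Rightarrow> nat \<Rightarrow> 'b set" where
  "E_deg K B n =
     {x \<in> grading B n. \<forall>a b. 1 \<le> a \<and> 1 \<le> b \<and> a + b = n \<longrightarrow>
        comult_comp K B a b x = \<zero>\<^bsub>tensor K B B\<^esub>}"

definition E_space ::
    "('k,'r) ring_scheme \<Rightarrow> ('k,'b,'m) braided_bialg_scheme \<Rightarrow> 'b set" where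
  "E_space K B = mspan K B (\<Union>n\<in>{2..}. E_deg K B n)"

definition E_ideal ::
    "('k,'r) ring_scheme \<Rightarrow> ('k,'b,'m) braided_bialg_scheme \<Rightarrow> 'b set" where
  "E_ideal K B = Idl\<^bsub>B\<^esub> (E_space K B)"

definition S_bialg ::
    "('k,'r) ring_scheme \<Rightarrow> ('k,'b) braided_bialg \<Rightarrow> ('k,'b) braided_bialg" where
  "S_bialg K B = quot_bialg K B (E_ideal K B)"

definition S_iter ::
    "('k,'r) ring_scheme \<Rightarrow> ('k,'b) braided_bialg \<Rightarrow> nat \<Rightarrow> ('k,'b) braided_bialg" where
  "S_iter K B n = (S_bialg K ^^ n) B"

text \<open>
  The projection is a morphism of graded braided bialgebras, hence an isomorphism if and only if
  it is bijective. In \<open>enat\<close> the infimum of the empty set is \<open>\<infinity>\<close>.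
\<close>

definition sdeg :: "('k,'r) ring_scheme \<Rightarrow> ('k,'b) braided_bialg \<Rightarrow> enat" where
  "sdeg K B = Inf {enat t | t.
     bij_betw (coset_rep (S_iter K B t) (E_ideal K (S_iter K B t)))
       (carrier (S_iter K B t)) (carrier (S_iter K B (Suc t)))}"


section \<open>The braided tensor algebra and the Nichols algebra\<close>

text \<open>
  \<open>T\<close> is the tensor algebra \<open>T(V,c)\<close> with its unique graded braided bialgebra
  structure; \<open>V\<close> is embedded as \<open>V\<^sup>\<otimes>\<^sup>1\<close> by \<open>tensor_alg_incl\<close>.
\<close>

definition braided_tensor_algebra ::
    "('k,'r) ring_scheme \<Rightarrow> ('k,'v,'m) module_scheme \<Rightarrow> (('v \<times> 'v \<Rightarrow> 'k) \<Rightarrow> ('v \<times> 'v \<Rightarrow> 'k)) \<Rightarrow>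
     ('k, 'v list \<Rightarrow> 'k) braided_bialg \<Rightarrow> bool" where
  "braided_tensor_algebra K V c T \<longleftrightarrow>
     (let i = tensor_alg_incl K V in
      module.truncate T = tensor_alg K V \<and>
      grading T = tensor_power K V \<and>
      graded_braided_bialgebra K T \<and>
      (\<forall>t\<in>carrier (tensor K V V). braiding T (tmap K T T i i t) = tmap K T T i i (c t)) \<and>
      (\<forall>v\<in>carrier V.
         comult T (i v) = pure K T T (i v) \<one>\<^bsub>T\<^esub> \<oplus>\<^bsub>tensor K T T\<^esub> pure K T T \<one>\<^bsub>T\<^esub> (i v)))"

text \<open>
  The identification \<open>T\<^sup>n \<otimes> T\<^sup>1 = T\<^sup>n\<^sup>+\<^sup>1\<close> is the multiplication of
  \<open>T\<close>. The map \<open>\<Gamma>\<^sub>n\<close> is defined on all of \<open>T\<close>; only its restriction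
  to degree \<open>n\<close> is relevant.
\<close>

primrec Gamma ::
    "('k,'r) ring_scheme \<Rightarrow> ('k,'b,'m) braided_bialg_scheme \<Rightarrow> nat \<Rightarrow> 'b \<Rightarrow> 'b" where
  "Gamma K T 0 = id"
| "Gamma K T (Suc n) =
     (\<lambda>x. mult_map K T (tmap K T T (Gamma K T n) id (comult_comp K T n 1 x)))"

definition Nichols_ideal ::
    "('k,'r) ring_scheme \<Rightarrow> ('k,'b,'m) braided_bialg_scheme \<Rightarrow> 'b set" where
  "Nichols_ideal K T = mspan K T (\<Union>n. {x \<in> grading T n. Gamma K T n x = \<zero>\<^bsub>T\<^esub>})"

definition Nichols ::
    "('k,'r) ring_scheme \<Rightarrow> ('k,'b,'m) braided_bialg_scheme \<Rightarrow> ('k,'b) braided_bialg" where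
  "Nichols K T = quot_bialg K T (Nichols_ideal K T)"

end

theory Submission
  imports Defs
begin

text \<open>
  Write \<open>N\<^sup>n = ker \<Gamma>\<^sub>n\<close>, a subspace of \<open>T\<^sup>n\<close>, and \<open>N\<close> for the sum of the
  \<open>N\<^sup>n\<close>, so that the Nichols algebra is \<open>T/N\<close>. The theorem follows from two statements: the
  ideal generated by \<open>E(T)\<close> is \<open>N\<close>, so that \<open>S(T)\<close> is the Nichols algebra
  (\<open>S_bialg_T\<close>), and \<open>E\<close> of the Nichols algebra vanishes (\<open>E_deg_B\<close>), so that
  dividing by \<open>E\<close> a second time changes nothing.

  Both rest on the description of \<open>N\<^sup>n\<^sup>+\<^sup>1\<close> as the set of all \<open>x\<close> of degree
  \<open>n + 1\<close> with \<open>\<Delta>\<^sup>n\<^sup>,\<^sup>1(x) \<in> N\<^sup>n \<otimes> V\<close> (\<open>N_SucI\<close> and \<open>\<Delta>_N\<close>).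
  This uses that \<open>T\<^sup>n \<otimes> V \<rightarrow> T\<^sup>n\<^sup>+\<^sup>1\<close> is injective and that, over a field, the kernel
  of \<open>f \<otimes> V\<close> is \<open>ker f \<otimes> V\<close>. Elements of \<open>E\<^sub>n(T)\<close> have
  \<open>\<Delta>\<^sup>n\<^sup>-\<^sup>1\<^sup>,\<^sup>1(x) = 0\<close>, hence lie in \<open>N\<close>. That \<open>N\<close> is an ideal
  (\<open>ideal_I\<close>) is proved by expanding \<open>\<Delta>(xv)\<close> and \<open>\<Delta>(vx)\<close> for \<open>v\<close> of degree 1;
  the expansion of \<open>\<Delta>(vx)\<close> contains \<open>c(v \<otimes> x)\<close>, which for \<open>x \<in> N\<^sup>n\<close> is in \<open>N\<^sup>n \<otimes> V\<close> because
  the braiding is compatible with \<open>\<Delta>\<close> (\<open>braiding_N\<close>).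

  The inclusion of \<open>N\<close> in the ideal generated by \<open>E(T)\<close> is where quadraticity is used: it says
  that \<open>N\<close> is generated by \<open>N\<^sup>2\<close>, and \<open>N\<^sup>2 = ker \<Delta>\<^sup>1\<^sup>,\<^sup>1 = E\<^sub>2(T)\<close>. Finally,
  if \<open>x\<close> of degree \<open>n\<close> represents an element of \<open>E\<^sub>n(T/N)\<close>, then
  \<open>\<Delta>\<^sup>n\<^sup>-\<^sup>1\<^sup>,\<^sup>1(x)\<close> vanishes in \<open>T/N \<otimes> T/N\<close>; as \<open>\<Gamma>\<^sub>n\<^sub>-\<^sub>1\<close> factors
  through \<open>T/N\<close>, it follows that \<open>\<Gamma>\<^sub>n(x) = 0\<close>, so \<open>x\<close> represents zero.

  Tensor products and the tensor algebra are used through their universal properties: a linear map on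
  them is given by a bilinear, respectively multilinear, map, and is determined by its values on pure
  tensors, respectively words.
\<close>

section \<open>Linear maps, spans and quotients\<close>

lemma linear_mapI:
  assumes "\<And>x. x \<in> carrier M \<Longrightarrow> f x \<in> carrier N"
    and "\<And>x y. x \<in> carrier M \<Longrightarrow> y \<in> carrier M \<Longrightarrow> f (x \<oplus>\<^bsub>M\<^esub> y) = f x \<oplus>\<^bsub>N\<^esub> f y"
    and "\<And>k x. k \<in> carrier K \<Longrightarrow> x \<in> carrier M \<Longrightarrow> f (k \<odot>\<^bsub>M\<^esub> x) = k \<odot>\<^bsub>N\<^esub> f x"
  shows "linear_map K M N f"
  using assms unfolding linear_map_def by auto

lemma linear_map_closed: "linear_map K M N f \<Longrightarrow> x \<in> carrier M \<Longrightarrow> f x \<in> carrier N"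
  unfolding linear_map_def by auto

lemma linear_map_add:
  "linear_map K M N f \<Longrightarrow> x \<in> carrier M \<Longrightarrow> y \<in> carrier M \<Longrightarrow> f (x \<oplus>\<^bsub>M\<^esub> y) = f x \<oplus>\<^bsub>N\<^esub> f y"
  unfolding linear_map_def by auto

lemma linear_map_smult:
  "linear_map K M N f \<Longrightarrow> k \<in> carrier K \<Longrightarrow> x \<in> carrier M \<Longrightarrow> f (k \<odot>\<^bsub>M\<^esub> x) = k \<odot>\<^bsub>N\<^esub> f x"
  unfolding linear_map_def by auto

lemma linear_map_cong:
  assumes "module K M" "linear_map K M N f" "\<And>x. x \<in> carrier M \<Longrightarrow> f x = g x"
  shows "linear_map K M N g"
proof -
  interpret module K M by fact
  show ?thesis
    by (rule linear_mapI)
      (auto simp flip: assms(3)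
        intro: linear_map_closed[OF assms(2)] linear_map_add[OF assms(2)] linear_map_smult[OF assms(2)])
qed

lemma linear_map_id: "linear_map K M M id"
  by (rule linear_mapI) auto

lemma linear_map_comp:
  assumes "linear_map K M N f" "linear_map K N P g"
  shows "linear_map K M P (\<lambda>x. g (f x))"
  by (rule linear_mapI)
    (auto simp: linear_map_closed[OF assms(1)] linear_map_closed[OF assms(2)] linear_map_add[OF assms(1)]
      linear_map_add[OF assms(2)] linear_map_smult[OF assms(1)] linear_map_smult[OF assms(2)])

lemma linear_map_zero:
  assumes "module K M" "module K N" "linear_map K M N f"
  shows "f \<zero>\<^bsub>M\<^esub> = \<zero>\<^bsub>N\<^esub>"
proof -
  interpret M: module K M by fact
  interpret N: module K N by fact
  have "f (\<zero>\<^bsub>K\<^esub> \<odot>\<^bsub>M\<^esub> \<zero>\<^bsub>M\<^esub>) = \<zero>\<^bsub>K\<^esub> \<odot>\<^bsub>N\<^esub> f \<zero>\<^bsub>M\<^esub>"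
    by (rule linear_map_smult[OF assms(3)]) auto
  then show ?thesis
    using linear_map_closed[OF assms(3)] by simp
qed

lemma linear_map_minus:
  assumes "module K M" "module K N" "linear_map K M N f" "x \<in> carrier M" "y \<in> carrier M"
  shows "f (x \<ominus>\<^bsub>M\<^esub> y) = f x \<ominus>\<^bsub>N\<^esub> f y"
proof -
  interpret M: module K M by fact
  interpret N: module K N by fact
  have fx: "f x \<in> carrier N" "f y \<in> carrier N"
    using assms linear_map_closed by metis+
  have "f x = f ((x \<ominus>\<^bsub>M\<^esub> y) \<oplus>\<^bsub>M\<^esub> y)"
    using assms(4,5) by (simp add: M.minus_eq M.a_assoc M.l_neg)
  also have "\<dots> = f (x \<ominus>\<^bsub>M\<^esub> y) \<oplus>\<^bsub>N\<^esub> f y"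
    using assms by (intro linear_map_add[OF assms(3)]) auto
  finally show ?thesis
    using fx linear_map_closed[OF assms(3), of "x \<ominus>\<^bsub>M\<^esub> y"] assms
    by (simp add: N.minus_eq N.a_assoc N.r_neg)
qed

lemma linear_map_const_zero:
  assumes "module K N"
  shows "linear_map K M N (\<lambda>_. \<zero>\<^bsub>N\<^esub>)"
proof -
  interpret N: module K N by fact
  show ?thesis by (rule linear_mapI) auto
qed

lemma linear_map_sum:
  assumes "module K M" "module K N" "linear_map K M N f" "linear_map K M N g"
  shows "linear_map K M N (\<lambda>x. f x \<oplus>\<^bsub>N\<^esub> g x)"
proof -
  interpret M: module K M by fact
  interpret N: module K N by fact
  note cl = linear_map_closed[OF assms(3)] linear_map_closed[OF assms(4)]
  show ?thesis
    by (rule linear_mapI)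
      (auto simp: cl linear_map_add[OF assms(3)] linear_map_add[OF assms(4)] linear_map_smult[OF assms(3)]
        linear_map_smult[OF assms(4)] N.smult_r_distr N.a_ac)
qed

lemma linear_map_diff:
  assumes "module K M" "module K N" "linear_map K M N f" "linear_map K M N g"
  shows "linear_map K M N (\<lambda>x. f x \<ominus>\<^bsub>N\<^esub> g x)"
proof -
  interpret M: module K M by fact
  interpret N: module K N by fact
  note cl = linear_map_closed[OF assms(3)] linear_map_closed[OF assms(4)]
  show ?thesis
    by (rule linear_mapI)
      (auto simp: cl linear_map_add[OF assms(3)] linear_map_add[OF assms(4)] linear_map_smult[OF assms(3)]
        linear_map_smult[OF assms(4)] N.smult_r_distr N.a_ac N.minus_eq N.minus_add N.smult_r_minus)
qed

lemma linear_map_smult_left: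
  assumes "module K M" "module K N" "linear_map K M N f" "k \<in> carrier K"
  shows "linear_map K M N (\<lambda>x. k \<odot>\<^bsub>N\<^esub> f x)"
proof -
  interpret M: module K M by fact
  interpret N: module K N by fact
  note cl = linear_map_closed[OF assms(3)]
  show ?thesis
  proof (rule linear_mapI)
    fix l x assume a: "l \<in> carrier K" "x \<in> carrier M"
    have "k \<odot>\<^bsub>N\<^esub> f (l \<odot>\<^bsub>M\<^esub> x) = (k \<otimes>\<^bsub>K\<^esub> l) \<odot>\<^bsub>N\<^esub> f x"
      using a assms(4) by (simp add: cl linear_map_smult[OF assms(3)] N.smult_assoc1)
    also have "\<dots> = l \<odot>\<^bsub>N\<^esub> (k \<odot>\<^bsub>N\<^esub> f x)"
      using a assms(4) by (simp add: cl M.m_comm[of k l] N.smult_assoc1)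
    finally show "k \<odot>\<^bsub>N\<^esub> f (l \<odot>\<^bsub>M\<^esub> x) = l \<odot>\<^bsub>N\<^esub> (k \<odot>\<^bsub>N\<^esub> f x)" .
  qed (use assms(4) in \<open>auto simp: cl linear_map_add[OF assms(3)] N.smult_r_distr\<close>)
qed

lemma linear_map_finsum:
  assumes "module K M" "module K N" "linear_map K M N h" "finite A" "f \<in> A \<rightarrow> carrier M"
  shows "h (\<Oplus>\<^bsub>M\<^esub>i\<in>A. f i) = (\<Oplus>\<^bsub>N\<^esub>i\<in>A. h (f i))"
proof -
  interpret M: module K M by fact
  interpret N: module K N by fact
  show ?thesis
    using assms(4,5)
  proof (induction A)
    case empty
    then show ?case by (simp add: linear_map_zero[OF assms(1-3)])
  next
    case (insert a A)
    moreover have "(\<lambda>i. h (f i)) \<in> A \<rightarrow> carrier N" "h (f a) \<in> carrier N"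
      using insert linear_map_closed[OF assms(3)] by auto
    ultimately show ?case
      by (simp add: linear_map_add[OF assms(3)])
  qed
qed

lemma (in module) submodule_closed:
  assumes "submodule H R M"
  shows submodule_subset: "H \<subseteq> carrier M"
    and submodule_carrier: "x \<in> H \<Longrightarrow> x \<in> carrier M"
    and submodule_zero: "\<zero>\<^bsub>M\<^esub> \<in> H"
    and submodule_add: "x \<in> H \<Longrightarrow> y \<in> H \<Longrightarrow> x \<oplus>\<^bsub>M\<^esub> y \<in> H"
    and submodule_neg: "x \<in> H \<Longrightarrow> \<ominus>\<^bsub>M\<^esub> x \<in> H"
    and submodule_minus: "x \<in> H \<Longrightarrow> y \<in> H \<Longrightarrow> x \<ominus>\<^bsub>M\<^esub> y \<in> H"
    and submodule_smult: "k \<in> carrier R \<Longrightarrow> x \<in> H \<Longrightarrow> k \<odot>\<^bsub>M\<^esub> x \<in> H"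
proof -
  note E = submoduleE[OF assms]
  show "H \<subseteq> carrier M" "x \<in> H \<Longrightarrow> x \<in> carrier M" using E(1) by auto
  show "x \<in> H \<Longrightarrow> y \<in> H \<Longrightarrow> x \<oplus>\<^bsub>M\<^esub> y \<in> H"
    "x \<in> H \<Longrightarrow> \<ominus>\<^bsub>M\<^esub> x \<in> H" "k \<in> carrier R \<Longrightarrow> x \<in> H \<Longrightarrow> k \<odot>\<^bsub>M\<^esub> x \<in> H" using E by auto
  show "x \<in> H \<Longrightarrow> y \<in> H \<Longrightarrow> x \<ominus>\<^bsub>M\<^esub> y \<in> H"
    using E by (simp add: M.minus_eq)
  obtain z where "z \<in> H" using E(2) by auto
  then have "\<zero> \<odot>\<^bsub>M\<^esub> z \<in> H" using E(4) by auto
  then show "\<zero>\<^bsub>M\<^esub> \<in> H" using E(1) \<open>z \<in> H\<close> by (metis smult_l_null subsetD)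
qed

lemma (in module) submoduleI':
  assumes "H \<subseteq> carrier M" "\<zero>\<^bsub>M\<^esub> \<in> H"
    and "\<And>a b. a \<in> H \<Longrightarrow> b \<in> H \<Longrightarrow> a \<oplus>\<^bsub>M\<^esub> b \<in> H"
    and "\<And>a x. a \<in> carrier R \<Longrightarrow> x \<in> H \<Longrightarrow> a \<odot>\<^bsub>M\<^esub> x \<in> H"
  shows "submodule H R M"
proof (rule submoduleI)
  fix a assume "a \<in> H"
  moreover from this have "(\<ominus> \<one>) \<odot>\<^bsub>M\<^esub> a \<in> H" using assms by auto
  ultimately show "\<ominus>\<^bsub>M\<^esub> a \<in> H" using assms(1)
    by (metis R.one_closed smult_l_minus smult_one subsetD)
qed (use assms in auto)

lemma submodule_vimage:
  assumes "module K M" "module K N" "linear_map K M N f" "submodule H K N"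
  shows "submodule {x \<in> carrier M. f x \<in> H} K M"
proof -
  interpret M: module K M by fact
  interpret N: module K N by fact
  show ?thesis
    by (rule M.submoduleI')
      (auto simp: linear_map_zero[OF assms(1-3)] N.submodule_zero[OF assms(4)] linear_map_add[OF assms(3)]
        linear_map_smult[OF assms(3)] N.submodule_add[OF assms(4)] N.submodule_smult[OF assms(4)])
qed

lemma (in module) zero_submodule: "submodule {\<zero>\<^bsub>M\<^esub>} R M"
  by (rule submoduleI') auto

lemma submodule_kernel:
  assumes "module K M" "module K N" "linear_map K M N f"
  shows "submodule {x \<in> carrier M. f x = \<zero>\<^bsub>N\<^esub>} K M"
  using submodule_vimage[OF assms module.zero_submodule[OF assms(2)]] by simp

lemma submodule_equalizer:
  assumes "module K M" "module K N" "linear_map K M N f" "linear_map K M N g"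
  shows "submodule {x \<in> carrier M. f x = g x} K M"
proof -
  interpret M: module K M by fact
  show ?thesis
    by (rule M.submoduleI')
      (auto simp: linear_map_zero[OF assms(1-3)] linear_map_zero[OF assms(1,2,4)] linear_map_add[OF assms(3)]
        linear_map_smult[OF assms(3)] linear_map_add[OF assms(4)] linear_map_smult[OF assms(4)])
qed

lemma submodule_image:
  assumes "module K M" "module K N" "linear_map K M N f" "submodule H K M"
  shows "submodule (f ` H) K N"
proof -
  interpret M: module K M by fact
  interpret N: module K N by fact
  note H = M.submodule_closed[OF assms(4)]
  show ?thesis
  proof (rule N.submoduleI')
    show "f ` H \<subseteq> carrier N" using H(1) linear_map_closed[OF assms(3)] by auto
    show "\<zero>\<^bsub>N\<^esub> \<in> f ` H" using H(3) linear_map_zero[OF assms(1-3)] by force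
    show "a \<oplus>\<^bsub>N\<^esub> b \<in> f ` H" if "a \<in> f ` H" "b \<in> f ` H" for a b
      using that linear_map_add[OF assms(3)] H by (smt (verit) image_iff)
    show "a \<odot>\<^bsub>N\<^esub> x \<in> f ` H" if "a \<in> carrier K" "x \<in> f ` H" for a x
      using that linear_map_smult[OF assms(3)] H by (smt (verit) image_iff)
  qed
qed

lemma (in module) mspan_submodule:
  assumes "S \<subseteq> carrier M"
  shows "submodule (mspan R M S) R M"
  unfolding mspan_def
proof (rule submoduleI')
  show "\<Inter> {N. submodule N R M \<and> S \<subseteq> N} \<subseteq> carrier M"
    using carrier_is_submodule assms by blast
qed (auto simp: submodule_zero submodule_add submodule_smult)

lemma mspan_superset: "x \<in> S \<Longrightarrow> x \<in> mspan K M S"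
  unfolding mspan_def by auto

lemma mspan_minimal: "submodule N K M \<Longrightarrow> S \<subseteq> N \<Longrightarrow> mspan K M S \<subseteq> N"
  unfolding mspan_def by auto

lemma (in module) mspan_carrier: "S \<subseteq> carrier M \<Longrightarrow> mspan R M S \<subseteq> carrier M"
  by (rule mspan_minimal[OF carrier_is_submodule])

lemma linear_map_mspan:
  assumes "module K M" "module K N" "linear_map K M N f" "submodule H K N"
    and "S \<subseteq> carrier M" "\<And>x. x \<in> S \<Longrightarrow> f x \<in> H" "x \<in> mspan K M S"
  shows "f x \<in> H"
  using mspan_minimal[OF submodule_vimage[OF assms(1-4)], of S] assms(5-7) by blast

lemma linear_map_eq_on_mspan:
  assumes "module K M" "module K N" "linear_map K M N f" "linear_map K M N g"
    and "S \<subseteq> carrier M" "\<And>x. x \<in> S \<Longrightarrow> f x = g x" "x \<in> mspan K M S"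
  shows "f x = g x"
  using mspan_minimal[OF submodule_equalizer[OF assms(1-4)], of S] assms(5-7) by blast

lemma (in module) submodule_abelian_subgroup:
  assumes "submodule I R M"
  shows "abelian_subgroup I M"
  by (intro abelian_subgroupI3 additive_subgroup.intro submodule.axioms(1)[OF assms] M.abelian_group_axioms)

lemma (in module) coset_rep_in_coset:
  assumes "submodule I R M" "x \<in> carrier M"
  shows "coset_rep M I x \<in> I +>\<^bsub>M\<^esub> x"
  unfolding coset_rep_def
  by (rule someI, rule abelian_subgroup.a_rcos_self[OF submodule_abelian_subgroup[OF assms(1)] assms(2)])

lemma (in module) coset_rep_witness:
  assumes "submodule I R M" "x \<in> carrier M"
  obtains h where "h \<in> I" "coset_rep M I x = h \<oplus>\<^bsub>M\<^esub> x"
  using coset_rep_in_coset[OF assms] by (auto simp: a_r_coset_def')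

lemma (in module) coset_rep_closed:
  assumes "submodule I R M" "x \<in> carrier M"
  shows "coset_rep M I x \<in> carrier M"
  by (rule coset_rep_witness[OF assms]) (use assms submodule_carrier in auto)

lemma (in module) mem_coset_iff:
  assumes "submodule I R M" "x \<in> carrier M" "y \<in> carrier M"
  shows "y \<in> I +>\<^bsub>M\<^esub> x \<longleftrightarrow> y \<ominus>\<^bsub>M\<^esub> x \<in> I"
  using abelian_subgroup.a_rcos_module[OF submodule_abelian_subgroup[OF assms(1)] assms(2,3)]
  by (simp add: M.minus_eq)

lemma (in module) coset_rep_diff:
  assumes "submodule I R M" "x \<in> carrier M"
  shows "coset_rep M I x \<ominus>\<^bsub>M\<^esub> x \<in> I"
  using coset_rep_in_coset[OF assms] mem_coset_iff[OF assms coset_rep_closed[OF assms]] by simp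

lemma (in module) coset_rep_eq_iff:
  assumes I: "submodule I R M" and x: "x \<in> carrier M" and y: "y \<in> carrier M"
  shows "coset_rep M I x = coset_rep M I y \<longleftrightarrow> x \<ominus>\<^bsub>M\<^esub> y \<in> I"
proof -
  have indep: "I +>\<^bsub>M\<^esub> a = I +>\<^bsub>M\<^esub> b" if "b \<in> I +>\<^bsub>M\<^esub> a" "a \<in> carrier M" for a b
    by (rule abelian_subgroup.a_repr_independence'[OF submodule_abelian_subgroup[OF I] that])
  have "coset_rep M I x = coset_rep M I y \<longleftrightarrow> I +>\<^bsub>M\<^esub> y = I +>\<^bsub>M\<^esub> x"
    using indep coset_rep_in_coset[OF I] x y unfolding coset_rep_def by metis
  also have "\<dots> \<longleftrightarrow> x \<in> I +>\<^bsub>M\<^esub> y"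
    using indep y abelian_subgroup.a_rcos_self[OF submodule_abelian_subgroup[OF I] x] by metis
  finally show ?thesis using mem_coset_iff[OF I y x] by simp
qed

lemma (in module) coset_rep_idem:
  assumes "submodule I R M" "x \<in> carrier M"
  shows "coset_rep M I (coset_rep M I x) = coset_rep M I x"
  using coset_rep_eq_iff[OF assms(1) coset_rep_closed[OF assms] assms(2)] coset_rep_diff[OF assms] by auto

lemma quot_simps:
  "carrier (quot M I) = coset_rep M I ` carrier M"
  "x \<oplus>\<^bsub>quot M I\<^esub> y = coset_rep M I (x \<oplus>\<^bsub>M\<^esub> y)"
  "k \<odot>\<^bsub>quot M I\<^esub> x = coset_rep M I (k \<odot>\<^bsub>M\<^esub> x)"
  "x \<otimes>\<^bsub>quot M I\<^esub> y = coset_rep M I (x \<otimes>\<^bsub>M\<^esub> y)"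
  "\<zero>\<^bsub>quot M I\<^esub> = coset_rep M I \<zero>\<^bsub>M\<^esub>"
  "\<one>\<^bsub>quot M I\<^esub> = coset_rep M I \<one>\<^bsub>M\<^esub>"
  by (simp_all add: quot_def)

lemma (in module) coset_rep_add:
  assumes I: "submodule I R M" and x: "x \<in> carrier M" and y: "y \<in> carrier M"
  shows "coset_rep M I (coset_rep M I x \<oplus>\<^bsub>M\<^esub> coset_rep M I y) = coset_rep M I (x \<oplus>\<^bsub>M\<^esub> y)"
proof -
  define p where "p = coset_rep M I"
  have pc: "p x \<in> carrier M" "p y \<in> carrier M"
    using coset_rep_closed[OF I] x y unfolding p_def by auto
  have "(p x \<oplus>\<^bsub>M\<^esub> p y) \<ominus>\<^bsub>M\<^esub> (x \<oplus>\<^bsub>M\<^esub> y) = (p x \<ominus>\<^bsub>M\<^esub> x) \<oplus>\<^bsub>M\<^esub> (p y \<ominus>\<^bsub>M\<^esub> y)"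
    using pc x y by (simp add: M.minus_eq M.minus_add M.a_ac)
  also have "\<dots> \<in> I"
    using coset_rep_diff[OF I x] coset_rep_diff[OF I y] submodule_add[OF I] unfolding p_def by auto
  finally show ?thesis
    using coset_rep_eq_iff[OF I, of "p x \<oplus>\<^bsub>M\<^esub> p y" "x \<oplus>\<^bsub>M\<^esub> y"] pc x y unfolding p_def by auto
qed

lemma (in module) coset_rep_smult:
  assumes I: "submodule I R M" and x: "x \<in> carrier M" and k: "k \<in> carrier R"
  shows "coset_rep M I (k \<odot>\<^bsub>M\<^esub> coset_rep M I x) = coset_rep M I (k \<odot>\<^bsub>M\<^esub> x)"
proof -
  define p where "p = coset_rep M I"
  have pc: "p x \<in> carrier M"
    using coset_rep_closed[OF I] x unfolding p_def by auto
  have "(k \<odot>\<^bsub>M\<^esub> p x) \<ominus>\<^bsub>M\<^esub> (k \<odot>\<^bsub>M\<^esub> x) = k \<odot>\<^bsub>M\<^esub> (p x \<ominus>\<^bsub>M\<^esub> x)"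
    using pc x k by (simp add: M.minus_eq smult_r_distr smult_r_minus)
  also have "\<dots> \<in> I"
    using coset_rep_diff[OF I x] submodule_smult[OF I k] unfolding p_def by auto
  finally show ?thesis
    using coset_rep_eq_iff[OF I, of "k \<odot>\<^bsub>M\<^esub> p x" "k \<odot>\<^bsub>M\<^esub> x"] pc x k unfolding p_def by auto
qed

lemma (in module) quot_module:
  assumes I: "submodule I R M"
  shows "module R (quot M I)"
proof -
  note add = coset_rep_add[OF I] and sm = coset_rep_smult[OF I] and cl = coset_rep_closed[OF I]
    and idem = coset_rep_idem[OF I]
  have addl: "coset_rep M I (coset_rep M I x \<oplus>\<^bsub>M\<^esub> y) = coset_rep M I (x \<oplus>\<^bsub>M\<^esub> y)"
    if "x \<in> carrier M" "y \<in> carrier M" for x y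
    using add[of "coset_rep M I x" y] add[of x y] that cl idem by simp
  have addr: "coset_rep M I (x \<oplus>\<^bsub>M\<^esub> coset_rep M I y) = coset_rep M I (x \<oplus>\<^bsub>M\<^esub> y)"
    if "x \<in> carrier M" "y \<in> carrier M" for x y
    using add[of x "coset_rep M I y"] add[of x y] that cl idem by simp
  have distr: "coset_rep M I (a \<odot>\<^bsub>M\<^esub> coset_rep M I x \<oplus>\<^bsub>M\<^esub> b \<odot>\<^bsub>M\<^esub> coset_rep M I x)
      = coset_rep M I (a \<odot>\<^bsub>M\<^esub> x \<oplus>\<^bsub>M\<^esub> b \<odot>\<^bsub>M\<^esub> x)"
    if "a \<in> carrier R" "b \<in> carrier R" "x \<in> carrier M" for a b x
    using that sm[of x "a \<oplus> b"] cl[of x] by (simp add: smult_l_distr)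
  have assoc: "coset_rep M I (a \<odot>\<^bsub>M\<^esub> (b \<odot>\<^bsub>M\<^esub> coset_rep M I x)) = coset_rep M I (a \<odot>\<^bsub>M\<^esub> (b \<odot>\<^bsub>M\<^esub> x))"
    if "a \<in> carrier R" "b \<in> carrier R" "x \<in> carrier M" for a b x
    using that sm[of x "a \<otimes> b"] cl[of x] by (simp add: smult_assoc1)
  show ?thesis
  proof (rule moduleI[OF R.is_cring])
    show "abelian_group (quot M I)"
    proof (rule abelian_groupI)
      fix x assume "x \<in> carrier (quot M I)"
      then obtain a where a: "a \<in> carrier M" "x = coset_rep M I a" by (auto simp: quot_simps)
      have "coset_rep M I (\<ominus>\<^bsub>M\<^esub> a) \<in> carrier (quot M I)"
        "coset_rep M I (\<ominus>\<^bsub>M\<^esub> a) \<oplus>\<^bsub>quot M I\<^esub> x = \<zero>\<^bsub>quot M I\<^esub>"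
        using a by (auto simp: quot_simps add M.l_neg)
      then show "\<exists>y\<in>carrier (quot M I). y \<oplus>\<^bsub>quot M I\<^esub> x = \<zero>\<^bsub>quot M I\<^esub>" by blast
    qed (auto simp: quot_simps add addl addr M.a_ac)
  qed (auto simp: quot_simps add addl addr sm cl idem distr assoc
      smult_l_distr smult_r_distr smult_assoc1)
qed

lemma (in module) coset_rep_linear:
  assumes "submodule I R M"
  shows "linear_map R M (quot M I) (coset_rep M I)"
  by (rule linear_mapI) (auto simp: quot_simps coset_rep_add[OF assms] coset_rep_smult[OF assms])

lemma (in module) coset_rep_eq_zero_iff:
  assumes "submodule I R M" "x \<in> carrier M"
  shows "coset_rep M I x = \<zero>\<^bsub>quot M I\<^esub> \<longleftrightarrow> x \<in> I"
proof -
  have "\<ominus>\<^bsub>M\<^esub> \<zero>\<^bsub>M\<^esub> = \<zero>\<^bsub>M\<^esub>"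
    by (metis M.r_neg M.l_zero M.zero_closed M.a_inv_closed)
  then have "x \<ominus>\<^bsub>M\<^esub> \<zero>\<^bsub>M\<^esub> = x"
    using assms(2) unfolding M.minus_eq by (metis M.r_zero)
  then show ?thesis
    using coset_rep_eq_iff[OF assms(1,2) M.zero_closed] unfolding quot_simps by metis
qed

text \<open>Elements of a quotient are representatives, so a map which kills the submodule need not be
  changed in order to be defined on the quotient.\<close>

lemma linear_map_quot:
  assumes "module K M" "module K N" "linear_map K M N f" "submodule I K M"
    and "\<And>x. x \<in> I \<Longrightarrow> f x = \<zero>\<^bsub>N\<^esub>"
  shows linear_map_coset_rep: "x \<in> carrier M \<Longrightarrow> f (coset_rep M I x) = f x"
    and linear_map_from_quot: "linear_map K (quot M I) N f"
proof -
  interpret M: module K M by fact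
  interpret N: module K N by fact
  show eq: "f (coset_rep M I x) = f x" if x: "x \<in> carrier M" for x
  proof -
    obtain h where h: "h \<in> I" "coset_rep M I x = h \<oplus>\<^bsub>M\<^esub> x"
      using M.coset_rep_witness[OF assms(4) x] .
    then show ?thesis
      using linear_map_add[OF assms(3), of h x] assms(5) x M.submodule_carrier[OF assms(4)]
        linear_map_closed[OF assms(3) x] by simp
  qed
  note cl = linear_map_closed[OF assms(3)]
  show "linear_map K (quot M I) N f"
    by (rule linear_mapI)
      (auto simp: quot_simps cl eq M.coset_rep_closed[OF assms(4)] linear_map_add[OF assms(3)]
        linear_map_smult[OF assms(3)])
qed


section \<open>Free modules and tensor products\<close>

text \<open>
  The linear map on formal sums determined by its values on the basis. Both \<open>tlift\<close> and
  \<open>tensor_alg_eval\<close> have this form.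
\<close>
definition lin_ext ::
    "('k,'r) ring_scheme \<Rightarrow> ('k,'p,'m) module_scheme \<Rightarrow> ('x \<Rightarrow> 'p) \<Rightarrow> ('x \<Rightarrow> 'k) \<Rightarrow> 'p" where
  "lin_ext K P \<beta> f = (\<Oplus>\<^bsub>P\<^esub>x\<in>{x. f x \<noteq> \<zero>\<^bsub>K\<^esub>}. f x \<odot>\<^bsub>P\<^esub> \<beta> x)"

lemma free_module_simps:
  "f \<in> carrier (free_module K X) \<longleftrightarrow>
     (\<forall>x. f x \<in> carrier K) \<and> (\<forall>x. x \<notin> X \<longrightarrow> f x = \<zero>\<^bsub>K\<^esub>) \<and> finite {x. f x \<noteq> \<zero>\<^bsub>K\<^esub>}"
  "\<zero>\<^bsub>free_module K X\<^esub> = (\<lambda>x. \<zero>\<^bsub>K\<^esub>)"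
  "f \<oplus>\<^bsub>free_module K X\<^esub> g = (\<lambda>x. f x \<oplus>\<^bsub>K\<^esub> g x)"
  "k \<odot>\<^bsub>free_module K X\<^esub> f = (\<lambda>x. k \<otimes>\<^bsub>K\<^esub> f x)"
  by (auto simp: free_module_def)

lemma free_module_module:
  assumes "cring K"
  shows "module K (free_module K X)"
proof -
  interpret cring K by fact
  have fin: "finite {x. f x \<oplus>\<^bsub>K\<^esub> g x \<noteq> \<zero>\<^bsub>K\<^esub>}"
    if "finite {x. f x \<noteq> \<zero>\<^bsub>K\<^esub>}" "finite {x. g x \<noteq> \<zero>\<^bsub>K\<^esub>}" for f g :: "'c \<Rightarrow> 'a"
    by (rule finite_subset[OF _ finite_UnI[OF that]]) auto
  have fin': "finite {x. k \<otimes>\<^bsub>K\<^esub> f x \<noteq> \<zero>\<^bsub>K\<^esub>}"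
    if "finite {x. f x \<noteq> \<zero>\<^bsub>K\<^esub>}" "k \<in> carrier K" for f :: "'c \<Rightarrow> 'a" and k
    by (rule finite_subset[OF _ that(1)]) (use that in auto)
  show ?thesis
  proof (rule moduleI[OF assms])
    show "abelian_group (free_module K X)"
    proof (rule abelian_groupI)
      fix f assume f: "f \<in> carrier (free_module K X)"
      have "finite {x. \<ominus>\<^bsub>K\<^esub> f x \<noteq> \<zero>\<^bsub>K\<^esub>}"
        by (rule finite_subset[of _ "{x. f x \<noteq> \<zero>\<^bsub>K\<^esub>}"]) (use f in \<open>auto simp: free_module_simps\<close>)
      then have "(\<lambda>x. \<ominus>\<^bsub>K\<^esub> f x) \<in> carrier (free_module K X)"
        "(\<lambda>x. \<ominus>\<^bsub>K\<^esub> f x) \<oplus>\<^bsub>free_module K X\<^esub> f = \<zero>\<^bsub>free_module K X\<^esub>"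
        using f by (auto simp: free_module_simps l_neg)
      then show "\<exists>g\<in>carrier (free_module K X). g \<oplus>\<^bsub>free_module K X\<^esub> f = \<zero>\<^bsub>free_module K X\<^esub>" by blast
    qed (auto simp: free_module_simps fin a_ac)
  qed (auto simp: free_module_simps fin fin' l_distr r_distr m_assoc)
qed

lemma delta_carrier:
  assumes "cring K" "x \<in> X"
  shows "delta K x \<in> carrier (free_module K X)"
proof -
  interpret cring K by fact
  have "finite {y. delta K x y \<noteq> \<zero>\<^bsub>K\<^esub>}"
    by (rule finite_subset[of _ "{x}"]) (auto simp: delta_def)
  then show ?thesis using assms(2) by (auto simp: free_module_simps delta_def)
qed

lemma lin_ext_superset:
  assumes "module K P" "finite S" "{x. f x \<noteq> \<zero>\<^bsub>K\<^esub>} \<subseteq> S"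
    and "\<And>x. x \<in> S \<Longrightarrow> f x \<in> carrier K" "\<And>x. x \<in> S \<Longrightarrow> \<beta> x \<in> carrier P"
  shows "lin_ext K P \<beta> f = (\<Oplus>\<^bsub>P\<^esub>x\<in>S. f x \<odot>\<^bsub>P\<^esub> \<beta> x)"
proof -
  interpret module K P by fact
  show ?thesis unfolding lin_ext_def
    by (rule M.add.finprod_mono_neutral_cong_left) (use assms in auto)
qed

lemma lin_ext_linear:
  assumes "module K P" "\<And>x. x \<in> X \<Longrightarrow> \<beta> x \<in> carrier P"
  shows "linear_map K (free_module K X) P (lin_ext K P \<beta>)"
proof -
  interpret module K P by fact
  let ?s = "\<lambda>f. {x. f x \<noteq> \<zero>\<^bsub>K\<^esub>}"
  have sub: "?s f \<subseteq> X" if "f \<in> carrier (free_module K X)" for f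
    using that by (auto simp: free_module_simps)
  show ?thesis
  proof (rule linear_mapI)
    fix f assume f: "f \<in> carrier (free_module K X)"
    show "lin_ext K P \<beta> f \<in> carrier P"
      unfolding lin_ext_def using sub[OF f] f assms(2)
      by (intro M.finsum_closed) (auto simp: free_module_simps)
  next
    fix f g assume f: "f \<in> carrier (free_module K X)" and g: "g \<in> carrier (free_module K X)"
    let ?S = "?s f \<union> ?s g"
    have fg: "f \<oplus>\<^bsub>free_module K X\<^esub> g \<in> carrier (free_module K X)"
      using f g free_module_module[OF R.is_cring] by (meson module.axioms(2) abelian_group.axioms(1) abelian_monoid.a_closed)
    have fin: "finite ?S" using f g by (auto simp: free_module_simps)
    have bc: "\<beta> x \<in> carrier P" if "x \<in> ?S" for x using that sub[OF f] sub[OF g] assms(2) by auto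
    have fc: "f x \<in> carrier K" "g x \<in> carrier K" for x using f g by (auto simp: free_module_simps)
    have "lin_ext K P \<beta> (f \<oplus>\<^bsub>free_module K X\<^esub> g) = (\<Oplus>\<^bsub>P\<^esub>x\<in>?S. (f x \<oplus>\<^bsub>K\<^esub> g x) \<odot>\<^bsub>P\<^esub> \<beta> x)"
      using lin_ext_superset[OF assms(1) fin, of "f \<oplus>\<^bsub>free_module K X\<^esub> g" \<beta>] bc fc
      by (force simp: free_module_simps)
    also have "\<dots> = (\<Oplus>\<^bsub>P\<^esub>x\<in>?S. f x \<odot>\<^bsub>P\<^esub> \<beta> x \<oplus>\<^bsub>P\<^esub> g x \<odot>\<^bsub>P\<^esub> \<beta> x)"
      by (rule M.finsum_cong') (auto simp: smult_l_distr fc bc)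
    also have "\<dots> = (\<Oplus>\<^bsub>P\<^esub>x\<in>?S. f x \<odot>\<^bsub>P\<^esub> \<beta> x) \<oplus>\<^bsub>P\<^esub> (\<Oplus>\<^bsub>P\<^esub>x\<in>?S. g x \<odot>\<^bsub>P\<^esub> \<beta> x)"
      by (rule M.finsum_addf) (auto simp: fc bc)
    also have "\<dots> = lin_ext K P \<beta> f \<oplus>\<^bsub>P\<^esub> lin_ext K P \<beta> g"
      using lin_ext_superset[OF assms(1) fin, of f \<beta>] lin_ext_superset[OF assms(1) fin, of g \<beta>] bc fc by auto
    finally show "lin_ext K P \<beta> (f \<oplus>\<^bsub>free_module K X\<^esub> g) = lin_ext K P \<beta> f \<oplus>\<^bsub>P\<^esub> lin_ext K P \<beta> g" .
  next
    fix k f assume k: "k \<in> carrier K" and f: "f \<in> carrier (free_module K X)"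
    let ?S = "?s f"
    have fin: "finite ?S" using f by (auto simp: free_module_simps)
    have bc: "\<beta> x \<in> carrier P" if "x \<in> ?S" for x using that sub[OF f] assms(2) by auto
    have fc: "f x \<in> carrier K" for x using f by (auto simp: free_module_simps)
    have "lin_ext K P \<beta> (k \<odot>\<^bsub>free_module K X\<^esub> f) = (\<Oplus>\<^bsub>P\<^esub>x\<in>?S. (k \<otimes>\<^bsub>K\<^esub> f x) \<odot>\<^bsub>P\<^esub> \<beta> x)"
      using lin_ext_superset[OF assms(1) fin, of "k \<odot>\<^bsub>free_module K X\<^esub> f" \<beta>] bc fc k
      by (force simp: free_module_simps)
    also have "\<dots> = (\<Oplus>\<^bsub>P\<^esub>x\<in>?S. k \<odot>\<^bsub>P\<^esub> (f x \<odot>\<^bsub>P\<^esub> \<beta> x))"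
      by (rule M.finsum_cong') (auto simp: smult_assoc1 fc bc k)
    also have "\<dots> = k \<odot>\<^bsub>P\<^esub> lin_ext K P \<beta> f"
      unfolding lin_ext_def using fin fc bc k by (intro finsum_smult_ldistr[symmetric]) auto
    finally show "lin_ext K P \<beta> (k \<odot>\<^bsub>free_module K X\<^esub> f) = k \<odot>\<^bsub>P\<^esub> lin_ext K P \<beta> f" .
  qed
qed

lemma lin_ext_delta:
  assumes "module K P" "\<beta> x \<in> carrier P"
  shows "lin_ext K P \<beta> (delta K x) = \<beta> x"
proof -
  interpret module K P by fact
  have "lin_ext K P \<beta> (delta K x) = (\<Oplus>\<^bsub>P\<^esub>y\<in>{x}. delta K x y \<odot>\<^bsub>P\<^esub> \<beta> y)"
    by (rule lin_ext_superset[OF assms(1)]) (use assms in \<open>auto simp: delta_def\<close>)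
  then show ?thesis using assms by (simp add: delta_def)
qed

lemma free_module_span:
  assumes "cring K"
  shows "mspan K (free_module K X) (delta K ` X) = carrier (free_module K X)"
proof
  interpret F: module K "free_module K X" by (rule free_module_module[OF assms])
  have dc: "delta K ` X \<subseteq> carrier (free_module K X)" using delta_carrier[OF assms] by auto
  show "mspan K (free_module K X) (delta K ` X) \<subseteq> carrier (free_module K X)"
    by (rule F.mspan_carrier[OF dc])
  note sub = F.submodule_closed[OF F.mspan_submodule[OF dc]]
  show "carrier (free_module K X) \<subseteq> mspan K (free_module K X) (delta K ` X)"
  proof
    fix f assume "f \<in> carrier (free_module K X)"
    moreover have "\<forall>f. f \<in> carrier (free_module K X) \<and> {x. f x \<noteq> \<zero>\<^bsub>K\<^esub>} = S
        \<longrightarrow> f \<in> mspan K (free_module K X) (delta K ` X)" if "finite S" for S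
      using that
    proof (induction S)
      case empty
      show ?case
      proof (intro allI impI)
        fix f assume "f \<in> carrier (free_module K X) \<and> {x. f x \<noteq> \<zero>\<^bsub>K\<^esub>} = {}"
        then have "f = \<zero>\<^bsub>free_module K X\<^esub>" by (auto simp: free_module_simps)
        then show "f \<in> mspan K (free_module K X) (delta K ` X)" using sub(3) by simp
      qed
    next
      case (insert x S)
      show ?case
      proof (intro allI impI)
        fix f assume f: "f \<in> carrier (free_module K X) \<and> {x. f x \<noteq> \<zero>\<^bsub>K\<^esub>} = insert x S"
        let ?g = "f(x := \<zero>\<^bsub>K\<^esub>)"
        have supp: "{x. ?g x \<noteq> \<zero>\<^bsub>K\<^esub>} = S" using f insert.hyps by auto
        have g: "?g \<in> carrier (free_module K X)"
          using f insert.hyps unfolding free_module_simps supp by auto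
        have x: "x \<in> X" "f x \<in> carrier K" using f by (auto simp: free_module_simps)
        have "f = ?g \<oplus>\<^bsub>free_module K X\<^esub> f x \<odot>\<^bsub>free_module K X\<^esub> delta K x"
          using f by (auto simp: free_module_simps delta_def fun_eq_iff)
        moreover have "f x \<odot>\<^bsub>free_module K X\<^esub> delta K x \<in> mspan K (free_module K X) (delta K ` X)"
          using x by (intro sub(7) mspan_superset) auto
        ultimately show "f \<in> mspan K (free_module K X) (delta K ` X)"
          using insert.IH g supp sub(4) by metis
      qed
    qed
    ultimately show "f \<in> mspan K (free_module K X) (delta K ` X)"
      by (auto simp: free_module_simps)
  qed
qed

text \<open>
  Identities between multilinear expressions are checked on generators by this lemma and its analogues
  \<open>tensor_linear_eq\<close> and \<open>tensor_alg_linear_eq\<close>.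
\<close>
lemma linear_map_eq_free_module:
  assumes "cring K" "module K P" "linear_map K (free_module K X) P f" "linear_map K (free_module K X) P g"
    and "\<And>x. x \<in> X \<Longrightarrow> f (delta K x) = g (delta K x)" "t \<in> carrier (free_module K X)"
  shows "f t = g t"
  by (rule linear_map_eq_on_mspan[OF free_module_module[OF assms(1)] assms(2-4), of "delta K ` X"])
    (use assms free_module_span[OF assms(1)] delta_carrier[OF assms(1)] in auto)

definition bilinear_map ::
    "('k,'r) ring_scheme \<Rightarrow> ('k,'a,'m) module_scheme \<Rightarrow> ('k,'b,'n) module_scheme \<Rightarrow>
     ('k,'p,'l) module_scheme \<Rightarrow> ('a \<Rightarrow> 'b \<Rightarrow> 'p) \<Rightarrow> bool" where
  "bilinear_map K A B P \<beta> \<longleftrightarrow>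
     (\<forall>a\<in>carrier A. linear_map K B P (\<beta> a)) \<and> (\<forall>b\<in>carrier B. linear_map K A P (\<lambda>a. \<beta> a b))"

lemma bilinear_mapI:
  assumes "\<And>a. a \<in> carrier A \<Longrightarrow> linear_map K B P (\<beta> a)"
    and "\<And>b. b \<in> carrier B \<Longrightarrow> linear_map K A P (\<lambda>a. \<beta> a b)"
  shows "bilinear_map K A B P \<beta>"
  using assms unfolding bilinear_map_def by auto

lemma bilinear_map_right: "bilinear_map K A B P \<beta> \<Longrightarrow> a \<in> carrier A \<Longrightarrow> linear_map K B P (\<beta> a)"
  and bilinear_map_left: "bilinear_map K A B P \<beta> \<Longrightarrow> b \<in> carrier B \<Longrightarrow> linear_map K A P (\<lambda>a. \<beta> a b)"
  unfolding bilinear_map_def by auto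

lemma bilinear_map_closed:
  "bilinear_map K A B P \<beta> \<Longrightarrow> a \<in> carrier A \<Longrightarrow> b \<in> carrier B \<Longrightarrow> \<beta> a b \<in> carrier P"
  using bilinear_map_right linear_map_closed by metis

lemma bilinear_map_comp:
  assumes "bilinear_map K A B P \<beta>" "linear_map K A' A f" "linear_map K B' B g"
  shows "bilinear_map K A' B' P (\<lambda>a b. \<beta> (f a) (g b))"
  by (rule bilinear_mapI)
    (use linear_map_comp[OF assms(2) bilinear_map_left[OF assms(1)]]
      linear_map_comp[OF assms(3) bilinear_map_right[OF assms(1)]]
      linear_map_closed[OF assms(2)] linear_map_closed[OF assms(3)] in auto)

lemma bilinear_map_post:
  assumes "bilinear_map K A B P \<beta>" "linear_map K P Q f"
  shows "bilinear_map K A B Q (\<lambda>a b. f (\<beta> a b))"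
  by (rule bilinear_mapI)
    (use linear_map_comp[OF bilinear_map_left[OF assms(1)] assms(2)]
      linear_map_comp[OF bilinear_map_right[OF assms(1)] assms(2)] in auto)

lemma bilinear_relations_sub:
  assumes A: "module K A" and B: "module K B"
  shows "bilinear_relations K A B \<subseteq> carrier (free_module K (carrier A \<times> carrier B))"
proof -
  interpret A: module K A by fact
  interpret B: module K B by fact
  interpret F: module K "free_module K (carrier A \<times> carrier B)" by (rule free_module_module[OF A.is_cring])
  have d: "delta K (a, b) \<in> carrier (free_module K (carrier A \<times> carrier B))"
    if "a \<in> carrier A" "b \<in> carrier B" for a b
    using that by (intro delta_carrier A.is_cring) auto
  show ?thesis unfolding bilinear_relations_def Let_def by (auto intro!: F.minus_closed F.a_closed F.smult_closed d)
qed

lemma tensor_null_submodule: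
  assumes "module K A" "module K B"
  shows "submodule (tensor_null K A B) K (free_module K (carrier A \<times> carrier B))"
  unfolding tensor_null_def
  by (rule module.mspan_submodule[OF free_module_module bilinear_relations_sub])
    (use assms module.axioms in auto)

lemma tensor_module:
  assumes "module K A" "module K B"
  shows "module K (tensor K A B)"
  unfolding tensor_def
  by (rule module.quot_module[OF free_module_module tensor_null_submodule])
    (use assms module.axioms in auto)

lemma pure_bilinear:
  assumes A: "module K A" and B: "module K B"
  shows "bilinear_map K A B (tensor K A B) (pure K A B)"
proof -
  interpret A: module K A by fact
  interpret B: module K B by fact
  let ?F = "free_module K (carrier A \<times> carrier B)"
  let ?d = "\<lambda>a b. delta K (a, b)"
  interpret F: module K ?F by (rule free_module_module[OF A.is_cring])
  have d: "?d a b \<in> carrier ?F" if "a \<in> carrier A" "b \<in> carrier B" for a b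
    using that by (intro delta_carrier A.is_cring) auto
  define p where "p = coset_rep ?F (tensor_null K A B)"
  have pu: "pure K A B = (\<lambda>a b. p (?d a b))" by (intro ext) (simp add: pure_def p_def)
  note I = tensor_null_submodule[OF A B]
  have lin: "linear_map K ?F (tensor K A B) p"
    unfolding p_def tensor_def by (rule F.coset_rep_linear[OF I])
  have eq: "p x = p y" if "x \<ominus>\<^bsub>?F\<^esub> y \<in> bilinear_relations K A B" "x \<in> carrier ?F" "y \<in> carrier ?F" for x y
    unfolding p_def F.coset_rep_eq_iff[OF I that(2,3)]
    using that(1) unfolding tensor_null_def by (rule mspan_superset)
  note lin_rules = linear_map_add[OF lin] linear_map_smult[OF lin] linear_map_closed[OF lin]
  show ?thesis unfolding pu
  proof (intro bilinear_mapI linear_mapI)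
    fix a b b' assume *: "a \<in> carrier A" "b \<in> carrier B" "b' \<in> carrier B"
    have "p (?d a (b \<oplus>\<^bsub>B\<^esub> b')) = p (?d a b \<oplus>\<^bsub>?F\<^esub> ?d a b')"
      by (rule eq) (use * in \<open>auto simp: bilinear_relations_def Let_def intro!: d F.a_closed\<close>)
    then show "p (?d a (b \<oplus>\<^bsub>B\<^esub> b')) = p (?d a b) \<oplus>\<^bsub>tensor K A B\<^esub> p (?d a b')"
      using * by (simp add: lin_rules d)
  next
    fix a k b assume *: "a \<in> carrier A" "b \<in> carrier B" "k \<in> carrier K"
    have "p (?d a (k \<odot>\<^bsub>B\<^esub> b)) = p (k \<odot>\<^bsub>?F\<^esub> ?d a b)"
      by (rule eq) (use * in \<open>auto simp: bilinear_relations_def Let_def intro!: d F.smult_closed\<close>)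
    then show "p (?d a (k \<odot>\<^bsub>B\<^esub> b)) = k \<odot>\<^bsub>tensor K A B\<^esub> p (?d a b)"
      using * by (simp add: lin_rules d)
  next
    fix a a' b assume *: "b \<in> carrier B" "a \<in> carrier A" "a' \<in> carrier A"
    have "p (?d (a \<oplus>\<^bsub>A\<^esub> a') b) = p (?d a b \<oplus>\<^bsub>?F\<^esub> ?d a' b)"
      by (rule eq) (use * in \<open>auto simp: bilinear_relations_def Let_def intro!: d F.a_closed\<close>)
    then show "p (?d (a \<oplus>\<^bsub>A\<^esub> a') b) = p (?d a b) \<oplus>\<^bsub>tensor K A B\<^esub> p (?d a' b)"
      using * by (simp add: lin_rules d)
  next
    fix a k b assume *: "b \<in> carrier B" "k \<in> carrier K" "a \<in> carrier A"
    have "p (?d (k \<odot>\<^bsub>A\<^esub> a) b) = p (k \<odot>\<^bsub>?F\<^esub> ?d a b)"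
      by (rule eq) (use * in \<open>auto simp: bilinear_relations_def Let_def intro!: d F.smult_closed\<close>)
    then show "p (?d (k \<odot>\<^bsub>A\<^esub> a) b) = k \<odot>\<^bsub>tensor K A B\<^esub> p (?d a b)"
      using * by (simp add: lin_rules d)
  qed (auto simp: lin_rules d)
qed

lemmas pure_closed = bilinear_map_closed[OF pure_bilinear]

lemma tlift_lin_ext: "tlift K P \<beta> = lin_ext K P (\<lambda>p. \<beta> (fst p) (snd p))"
  by (auto simp: tlift_def lin_ext_def)

text \<open>
  Evaluating a bilinear map on formal sums of pairs kills the bilinear relations, so the value does not
  depend on the chosen representatives.
\<close>
lemma tensor_universal:
  assumes A: "module K A" and B: "module K B" and P: "module K P" and b: "bilinear_map K A B P \<beta>"
  shows tlift_linear: "linear_map K (tensor K A B) P (tlift K P \<beta>)"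
    and tlift_pure: "a \<in> carrier A \<Longrightarrow> b \<in> carrier B \<Longrightarrow> tlift K P \<beta> (pure K A B a b) = \<beta> a b"
proof -
  interpret A: module K A by fact
  interpret B: module K B by fact
  interpret P: module K P by fact
  let ?F = "free_module K (carrier A \<times> carrier B)"
  interpret F: module K ?F by (rule free_module_module[OF A.is_cring])
  let ?h = "tlift K P \<beta>"
  have lin: "linear_map K ?F P ?h"
    unfolding tlift_lin_ext by (rule lin_ext_linear[OF P]) (auto intro: bilinear_map_closed[OF b])
  have d: "delta K (a, b) \<in> carrier ?F" if "a \<in> carrier A" "b \<in> carrier B" for a b
    using that by (intro delta_carrier A.is_cring) auto
  have hd: "?h (delta K (a, b)) = \<beta> a b" if "a \<in> carrier A" "b \<in> carrier B" for a b
    unfolding tlift_lin_ext using lin_ext_delta[OF P, of "\<lambda>p. \<beta> (fst p) (snd p)" "(a, b)"]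
      bilinear_map_closed[OF b] that by auto
  note bl = linear_map_add[OF bilinear_map_left[OF b]] linear_map_smult[OF bilinear_map_left[OF b]]
    linear_map_add[OF bilinear_map_right[OF b]] linear_map_smult[OF bilinear_map_right[OF b]]
    bilinear_map_closed[OF b]
  have "?h x = \<zero>\<^bsub>P\<^esub>" if "x \<in> bilinear_relations K A B" for x
    using that unfolding bilinear_relations_def Let_def
    by (auto simp: linear_map_minus[OF F.module_axioms P lin] linear_map_add[OF lin] linear_map_smult[OF lin]
        d hd bl P.minus_eq P.r_neg)
  then have "tensor_null K A B \<subseteq> {x \<in> carrier ?F. ?h x = \<zero>\<^bsub>P\<^esub>}"
    unfolding tensor_null_def
    by (intro mspan_minimal submodule_kernel[OF F.module_axioms P lin])
      (use bilinear_relations_sub[OF A B] in auto)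
  then have null: "?h x = \<zero>\<^bsub>P\<^esub>" if "x \<in> tensor_null K A B" for x
    using that by auto
  note q = linear_map_quot[OF F.module_axioms P lin tensor_null_submodule[OF A B] null]
  show "linear_map K (tensor K A B) P ?h" unfolding tensor_def by (rule q(2))
  show "a \<in> carrier A \<Longrightarrow> b \<in> carrier B \<Longrightarrow> ?h (pure K A B a b) = \<beta> a b"
    unfolding pure_def by (simp add: q(1) d hd)
qed

lemma tensor_span:
  assumes A: "module K A" and B: "module K B"
  shows "mspan K (tensor K A B) {pure K A B a b | a b. a \<in> carrier A \<and> b \<in> carrier B} = carrier (tensor K A B)"
    (is "mspan K _ ?S = _")
proof
  interpret A: module K A by fact
  let ?F = "free_module K (carrier A \<times> carrier B)"
  interpret F: module K ?F by (rule free_module_module[OF A.is_cring])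
  interpret T: module K "tensor K A B" by (rule tensor_module[OF A B])
  have S: "?S \<subseteq> carrier (tensor K A B)" using pure_closed[OF A B] by auto
  show "mspan K (tensor K A B) ?S \<subseteq> carrier (tensor K A B)" by (rule T.mspan_carrier[OF S])
  have lin: "linear_map K ?F (tensor K A B) (coset_rep ?F (tensor_null K A B))"
    unfolding tensor_def by (rule F.coset_rep_linear[OF tensor_null_submodule[OF A B]])
  show "carrier (tensor K A B) \<subseteq> mspan K (tensor K A B) ?S"
  proof
    fix t assume "t \<in> carrier (tensor K A B)"
    then obtain f where f: "f \<in> carrier ?F" "t = coset_rep ?F (tensor_null K A B) f"
      by (auto simp: tensor_def quot_simps)
    show "t \<in> mspan K (tensor K A B) ?S" unfolding f(2)
    proof (rule linear_map_mspan[OF F.module_axioms T.module_axioms lin T.mspan_submodule[OF S],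
          of "delta K ` (carrier A \<times> carrier B)"])
      show "f \<in> mspan K ?F (delta K ` (carrier A \<times> carrier B))"
        using f free_module_span[OF A.is_cring] by auto
      fix x assume "x \<in> delta K ` (carrier A \<times> carrier B)"
      then show "coset_rep ?F (tensor_null K A B) x \<in> mspan K (tensor K A B) ?S"
        by (intro mspan_superset) (auto simp: pure_def)
    qed (auto intro!: delta_carrier A.is_cring)
  qed
qed

lemma tensor_linear_eq:
  assumes "module K A" "module K B" "module K P"
    and "linear_map K (tensor K A B) P f" "linear_map K (tensor K A B) P g"
    and "\<And>a b. a \<in> carrier A \<Longrightarrow> b \<in> carrier B \<Longrightarrow> f (pure K A B a b) = g (pure K A B a b)"
    and "t \<in> carrier (tensor K A B)"
  shows "f t = g t"
  by (rule linear_map_eq_on_mspan[OF tensor_module[OF assms(1,2)] assms(3-5),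
        of "{pure K A B a b | a b. a \<in> carrier A \<and> b \<in> carrier B}"])
    (use assms tensor_span[OF assms(1,2)] pure_closed[OF assms(1,2)] in auto)

lemma tmap_bilinear:
  assumes "module K C" "module K D" "linear_map K A C f" "linear_map K B D g"
  shows "bilinear_map K A B (tensor K C D) (\<lambda>a b. pure K C D (f a) (g b))"
  by (rule bilinear_map_comp[OF pure_bilinear[OF assms(1,2)] assms(3,4)])

lemma tmap_linear:
  assumes "module K A" "module K B" "module K C" "module K D" "linear_map K A C f" "linear_map K B D g"
  shows "linear_map K (tensor K A B) (tensor K C D) (tmap K C D f g)"
  unfolding tmap_def
  by (rule tlift_linear[OF assms(1,2) tensor_module[OF assms(3,4)] tmap_bilinear[OF assms(3-6)]])

lemma tmap_pure:
  assumes "module K A" "module K B" "module K C" "module K D" "linear_map K A C f" "linear_map K B D g"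
    and "a \<in> carrier A" "b \<in> carrier B"
  shows "tmap K C D f g (pure K A B a b) = pure K C D (f a) (g b)"
  unfolding tmap_def
  by (rule tlift_pure[OF assms(1,2) tensor_module[OF assms(3,4)] tmap_bilinear[OF assms(3-6)] assms(7,8)])

lemma tmap_comp:
  assumes "module K A" "module K B" "module K C" "module K D" "module K E" "module K F"
    and "linear_map K A C f" "linear_map K B D g" "linear_map K C E f'" "linear_map K D F g'"
    and "t \<in> carrier (tensor K A B)"
  shows "tmap K E F f' g' (tmap K C D f g t) = tmap K E F (\<lambda>x. f' (f x)) (\<lambda>x. g' (g x)) t"
  by (rule tensor_linear_eq[OF assms(1,2) tensor_module[OF assms(5,6)] _ _ _ assms(11)])
    (simp_all add: tmap_linear linear_map_comp[OF tmap_linear tmap_linear] linear_map_comp[OF assms(7,9)]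
      linear_map_comp[OF assms(8,10)] tmap_pure assms
      linear_map_closed[OF assms(7)] linear_map_closed[OF assms(8)]
      linear_map_comp[OF tmap_linear[OF assms(1-4,7,8)] tmap_linear[OF assms(3-6,9,10)]]
      tmap_pure[OF assms(1-4,7,8)] tmap_pure[OF assms(3-6,9,10)]
      tmap_pure[OF assms(1,2,5,6) linear_map_comp[OF assms(7,9)] linear_map_comp[OF assms(8,10)]])

lemma tmap_cong:
  assumes "module K A" "module K B" "module K C" "module K D" "linear_map K A C f" "linear_map K B D g"
    and "\<And>a. a \<in> carrier A \<Longrightarrow> f a = f' a" "\<And>b. b \<in> carrier B \<Longrightarrow> g b = g' b"
    and "t \<in> carrier (tensor K A B)"
  shows "tmap K C D f g t = tmap K C D f' g' t"
proof -
  have l: "linear_map K A C f'" "linear_map K B D g'"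
    using linear_map_cong[OF assms(1,5,7)] linear_map_cong[OF assms(2,6,8)] by auto
  show ?thesis
    by (rule tensor_linear_eq[OF assms(1,2) tensor_module[OF assms(3,4)] tmap_linear[OF assms(1-6)]
          tmap_linear[OF assms(1-4) l] _ assms(9)])
      (simp add: tmap_pure[OF assms(1-6)] tmap_pure[OF assms(1-4) l] assms(7,8))
qed

text \<open>
  The associators are double lifts. For the outer one to exist, the inner one has to be linear in the
  tensor factor which it leaves out; as an identity between linear maps this is checked on pure tensors.
\<close>
lemma tlift_parameter_linear:
  assumes A: "module K A" and B: "module K B" and P: "module K P" and X: "module K X"
    and b: "\<And>x. x \<in> carrier X \<Longrightarrow> bilinear_map K A B P (\<beta> x)"
    and l: "\<And>a b. a \<in> carrier A \<Longrightarrow> b \<in> carrier B \<Longrightarrow> linear_map K X P (\<lambda>x. \<beta> x a b)"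
    and s: "s \<in> carrier (tensor K A B)"
  shows "linear_map K X P (\<lambda>x. tlift K P (\<beta> x) s)"
proof -
  interpret X: module K X by fact
  note il = tlift_linear[OF A B P b] and ip = tlift_pure[OF A B P b]
  note AB = tensor_module[OF A B]
  show ?thesis
  proof (rule linear_mapI)
    show "tlift K P (\<beta> x) s \<in> carrier P" if "x \<in> carrier X" for x
      using linear_map_closed[OF il[OF that] s] .
    show "tlift K P (\<beta> (x \<oplus>\<^bsub>X\<^esub> y)) s = tlift K P (\<beta> x) s \<oplus>\<^bsub>P\<^esub> tlift K P (\<beta> y) s"
      if "x \<in> carrier X" "y \<in> carrier X" for x y
      by (rule tensor_linear_eq[OF A B P _ _ _ s])
        (use that in \<open>auto intro!: il linear_map_sum[OF AB P] simp: ip linear_map_add[OF l]\<close>)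
    show "tlift K P (\<beta> (k \<odot>\<^bsub>X\<^esub> x)) s = k \<odot>\<^bsub>P\<^esub> tlift K P (\<beta> x) s"
      if "k \<in> carrier K" "x \<in> carrier X" for k x
      by (rule tensor_linear_eq[OF A B P _ _ _ s])
        (use that in \<open>auto intro!: il linear_map_smult_left[OF AB P] simp: ip linear_map_smult[OF l]\<close>)
  qed
qed
lemma assoc_r:
  assumes A: "module K A" and B: "module K B" and C: "module K C"
  shows assoc_r_linear:
      "linear_map K (tensor K (tensor K A B) C) (tensor K A (tensor K B C)) (assoc_r K A B C)"
    and assoc_r_pure: "a \<in> carrier A \<Longrightarrow> b \<in> carrier B \<Longrightarrow> c \<in> carrier C \<Longrightarrow>
      assoc_r K A B C (pure K (tensor K A B) C (pure K A B a b) c) = pure K A (tensor K B C) a (pure K B C b c)"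
proof -
  let ?P = "tensor K A (tensor K B C)"
  note AB = tensor_module[OF A B] and BC = tensor_module[OF B C]
  have P: "module K ?P" by (rule tensor_module[OF A BC])
  let ?\<beta> = "\<lambda>c a b. pure K A (tensor K B C) a (pure K B C b c)"
  have inner: "bilinear_map K A B ?P (?\<beta> c)" if "c \<in> carrier C" for c
    by (rule bilinear_map_comp[OF pure_bilinear[OF A BC] linear_map_id[unfolded id_def]
          bilinear_map_left[OF pure_bilinear[OF B C] that], simplified])
  note il = tlift_linear[OF A B P inner] and ip = tlift_pure[OF A B P inner]
  have \<beta>c: "linear_map K C ?P (\<lambda>c. ?\<beta> c a b)" if "a \<in> carrier A" "b \<in> carrier B" for a b
    using linear_map_comp[OF bilinear_map_right[OF pure_bilinear[OF B C] that(2)]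
        bilinear_map_right[OF pure_bilinear[OF A BC] that(1)]] .
  have outer: "bilinear_map K (tensor K A B) C ?P (\<lambda>s c. tlift K ?P (?\<beta> c) s)"
    by (rule bilinear_mapI) (auto intro: il tlift_parameter_linear[OF A B P C inner \<beta>c])
  show "linear_map K (tensor K (tensor K A B) C) ?P (assoc_r K A B C)"
    unfolding assoc_r_def Let_def by (rule tlift_linear[OF AB C P outer])
  show "a \<in> carrier A \<Longrightarrow> b \<in> carrier B \<Longrightarrow> c \<in> carrier C \<Longrightarrow>
      assoc_r K A B C (pure K (tensor K A B) C (pure K A B a b) c) = pure K A (tensor K B C) a (pure K B C b c)"
    unfolding assoc_r_def Let_def by (simp add: tlift_pure[OF AB C P outer] pure_closed[OF A B] ip)
qed

lemma assoc_l:
  assumes A: "module K A" and B: "module K B" and C: "module K C"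
  shows assoc_l_linear:
      "linear_map K (tensor K A (tensor K B C)) (tensor K (tensor K A B) C) (assoc_l K A B C)"
    and assoc_l_pure: "a \<in> carrier A \<Longrightarrow> b \<in> carrier B \<Longrightarrow> c \<in> carrier C \<Longrightarrow>
      assoc_l K A B C (pure K A (tensor K B C) a (pure K B C b c)) = pure K (tensor K A B) C (pure K A B a b) c"
proof -
  let ?P = "tensor K (tensor K A B) C"
  note AB = tensor_module[OF A B] and BC = tensor_module[OF B C]
  have P: "module K ?P" by (rule tensor_module[OF AB C])
  let ?\<beta> = "\<lambda>a b c. pure K (tensor K A B) C (pure K A B a b) c"
  have inner: "bilinear_map K B C ?P (?\<beta> a)" if "a \<in> carrier A" for a
    by (rule bilinear_map_comp[OF pure_bilinear[OF AB C] bilinear_map_right[OF pure_bilinear[OF A B] that]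
          linear_map_id[unfolded id_def], simplified])
  note il = tlift_linear[OF B C P inner] and ip = tlift_pure[OF B C P inner]
  have \<beta>a: "linear_map K A ?P (\<lambda>a. ?\<beta> a b c)" if "b \<in> carrier B" "c \<in> carrier C" for b c
    using linear_map_comp[OF bilinear_map_left[OF pure_bilinear[OF A B] that(1)]
        bilinear_map_left[OF pure_bilinear[OF AB C] that(2)]] .
  have outer: "bilinear_map K A (tensor K B C) ?P (\<lambda>a s. tlift K ?P (?\<beta> a) s)"
    by (rule bilinear_mapI) (auto intro: il tlift_parameter_linear[OF B C P A inner \<beta>a])
  show "linear_map K (tensor K A (tensor K B C)) ?P (assoc_l K A B C)"
    unfolding assoc_l_def Let_def by (rule tlift_linear[OF A BC P outer])
  show "a \<in> carrier A \<Longrightarrow> b \<in> carrier B \<Longrightarrow> c \<in> carrier C \<Longrightarrow>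
      assoc_l K A B C (pure K A (tensor K B C) a (pure K B C b c)) = pure K (tensor K A B) C (pure K A B a b) c"
    unfolding assoc_l_def Let_def by (simp add: tlift_pure[OF A BC P outer] pure_closed[OF B C] ip)
qed


section \<open>Algebras and their ideals\<close>

lemma linear_map_cong_carrier:
  assumes "carrier M' = carrier M" "add M' = add M" "smult M' = smult M"
  shows "linear_map K M' N f = linear_map K M N f"
  unfolding linear_map_def assms by auto

lemma linear_map_subset:
  assumes "linear_map K M N f" "carrier M' \<subseteq> carrier M" "add M' = add M" "smult M' = smult M"
  shows "linear_map K M' N f"
  by (rule linear_mapI)
    (use assms(2) linear_map_closed[OF assms(1)] linear_map_add[OF assms(1)] linear_map_smult[OF assms(1)] in
      \<open>auto simp: assms(3,4) subset_iff\<close>)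

lemma module_cong_carrier:
  assumes "module K M" "carrier M' = carrier M" "add M' = add M" "zero M' = zero M" "smult M' = smult M"
  shows "module K M'"
proof -
  interpret M: module K M by fact
  show ?thesis
  proof (rule moduleI[OF M.R.is_cring])
    show "abelian_group M'"
      by (rule abelian_groupI) (use assms in \<open>auto simp: M.a_ac intro: M.l_neg M.a_inv_closed\<close>)
  qed (use assms in \<open>auto simp: M.smult_l_distr M.smult_r_distr M.smult_assoc1\<close>)
qed

lemma assoc_algebra_module: "assoc_algebra K A \<Longrightarrow> module K A"
  and assoc_algebra_ring: "assoc_algebra K A \<Longrightarrow> ring A"
  unfolding assoc_algebra_def by auto

lemma assoc_algebra_mult_bilinear:
  assumes "assoc_algebra K A"
  shows "bilinear_map K A A A (mult A)"
proof -
  interpret A: ring A using assms assoc_algebra_ring by auto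
  show ?thesis
    by (intro bilinear_mapI linear_mapI) (use assms in \<open>auto simp: A.l_distr A.r_distr assoc_algebra_def\<close>)
qed

lemma ideal_submodule:
  assumes A: "assoc_algebra K A" and I: "ideal I A"
  shows "submodule I K A"
proof -
  interpret M: module K A using assoc_algebra_module[OF A] .
  interpret A: ring A using A assoc_algebra_ring by auto
  interpret I: ideal I A by fact
  show ?thesis
  proof (rule M.submoduleI')
    fix k x assume k: "k \<in> carrier K" and x: "x \<in> I"
    have xc: "x \<in> carrier A" using x I.a_subset by auto
    have "(k \<odot>\<^bsub>A\<^esub> \<one>\<^bsub>A\<^esub>) \<otimes>\<^bsub>A\<^esub> x \<in> I"
      using I.I_l_closed[OF x] k by auto
    moreover have "(k \<odot>\<^bsub>A\<^esub> \<one>\<^bsub>A\<^esub>) \<otimes>\<^bsub>A\<^esub> x = k \<odot>\<^bsub>A\<^esub> (\<one>\<^bsub>A\<^esub> \<otimes>\<^bsub>A\<^esub> x)"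
      using A k xc unfolding assoc_algebra_def by auto
    ultimately show "k \<odot>\<^bsub>A\<^esub> x \<in> I" using xc by simp
  qed (use I.a_subset in auto)
qed

lemma submodule_ideal:
  assumes A: "assoc_algebra K A" and I: "submodule I K A"
    and "\<And>x a. x \<in> carrier A \<Longrightarrow> a \<in> I \<Longrightarrow> x \<otimes>\<^bsub>A\<^esub> a \<in> I"
    and "\<And>x a. x \<in> carrier A \<Longrightarrow> a \<in> I \<Longrightarrow> a \<otimes>\<^bsub>A\<^esub> x \<in> I"
  shows "ideal I A"
  by (rule idealI) (use assoc_algebra_ring[OF A] submodule.axioms(1)[OF I] assms in auto)

lemma coset_rep_mult:
  assumes A: "assoc_algebra K A" and I: "ideal I A" and x: "x \<in> carrier A" and y: "y \<in> carrier A"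
  shows "coset_rep A I (coset_rep A I x \<otimes>\<^bsub>A\<^esub> coset_rep A I y) = coset_rep A I (x \<otimes>\<^bsub>A\<^esub> y)"
proof -
  interpret M: module K A using assoc_algebra_module[OF A] .
  interpret A: ring A using A assoc_algebra_ring by auto
  interpret I: ideal I A by fact
  note S = ideal_submodule[OF A I]
  define p where "p = coset_rep A I"
  have pc: "p x \<in> carrier A" "p y \<in> carrier A"
    using M.coset_rep_closed[OF S] x y unfolding p_def by auto
  have d: "p x \<ominus>\<^bsub>A\<^esub> x \<in> I" "p y \<ominus>\<^bsub>A\<^esub> y \<in> I"
    using M.coset_rep_diff[OF S] x y unfolding p_def by auto
  have "p x \<otimes>\<^bsub>A\<^esub> p y \<ominus>\<^bsub>A\<^esub> x \<otimes>\<^bsub>A\<^esub> y = (p x \<ominus>\<^bsub>A\<^esub> x) \<otimes>\<^bsub>A\<^esub> p y \<oplus>\<^bsub>A\<^esub> x \<otimes>\<^bsub>A\<^esub> (p y \<ominus>\<^bsub>A\<^esub> y)"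
    using pc x y by algebra
  also have "\<dots> \<in> I"
    using d pc x I.I_l_closed I.I_r_closed I.a_closed by auto
  finally show ?thesis
    using M.coset_rep_eq_iff[OF S, of "p x \<otimes>\<^bsub>A\<^esub> p y" "x \<otimes>\<^bsub>A\<^esub> y"] pc x y unfolding p_def by auto
qed

text \<open>
  Products may be computed on arbitrary representatives, since
  \<open>x' y' - x y = (x' - x) y' + x (y' - y)\<close> (\<open>coset_rep_mult\<close>).
\<close>
lemma quot_algebra:
  assumes A: "assoc_algebra K A" and I: "ideal I A"
  shows "assoc_algebra K (quot A I)"
proof -
  interpret M: module K A using assoc_algebra_module[OF A] .
  interpret A: ring A using A assoc_algebra_ring by auto
  note S = ideal_submodule[OF A I]
  interpret Q: module K "quot A I" by (rule M.quot_module[OF S])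
  note mm = coset_rep_mult[OF A I] and cl = M.coset_rep_closed[OF S] and idem = M.coset_rep_idem[OF S]
    and sm = M.coset_rep_smult[OF S]
  have ml: "coset_rep A I (coset_rep A I x \<otimes>\<^bsub>A\<^esub> y) = coset_rep A I (x \<otimes>\<^bsub>A\<^esub> y)"
    if "x \<in> carrier A" "y \<in> carrier A" for x y
    using mm[of "coset_rep A I x" y] mm[of x y] that cl idem by simp
  have mr: "coset_rep A I (x \<otimes>\<^bsub>A\<^esub> coset_rep A I y) = coset_rep A I (x \<otimes>\<^bsub>A\<^esub> y)"
    if "x \<in> carrier A" "y \<in> carrier A" for x y
    using mm[of x "coset_rep A I y"] mm[of x y] that cl idem by simp
  have "ring (quot A I)"
  proof (rule ringI)
    show "abelian_group (quot A I)" by (rule Q.abelian_group_axioms)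
    show "monoid (quot A I)"
      by (rule monoidI) (auto simp: quot_simps ml mr cl idem A.m_assoc)
    fix x y z assume "x \<in> carrier (quot A I)" "y \<in> carrier (quot A I)" "z \<in> carrier (quot A I)"
    then obtain a b c where abc: "a \<in> carrier A" "b \<in> carrier A" "c \<in> carrier A"
      "x = coset_rep A I a" "y = coset_rep A I b" "z = coset_rep A I c"
      by (auto simp: quot_simps)
    show "(x \<oplus>\<^bsub>quot A I\<^esub> y) \<otimes>\<^bsub>quot A I\<^esub> z = x \<otimes>\<^bsub>quot A I\<^esub> z \<oplus>\<^bsub>quot A I\<^esub> y \<otimes>\<^bsub>quot A I\<^esub> z"
      "z \<otimes>\<^bsub>quot A I\<^esub> (x \<oplus>\<^bsub>quot A I\<^esub> y) = z \<otimes>\<^bsub>quot A I\<^esub> x \<oplus>\<^bsub>quot A I\<^esub> z \<otimes>\<^bsub>quot A I\<^esub> y"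
      unfolding quot_simps using abc cl[OF abc(1)] cl[OF abc(2)] cl[OF abc(3)]
      by (simp_all add: mm M.coset_rep_add[OF S], simp_all add: A.l_distr A.r_distr)
  qed
  moreover have "coset_rep A I (coset_rep A I (k \<odot>\<^bsub>A\<^esub> x) \<otimes>\<^bsub>A\<^esub> y) = coset_rep A I (k \<odot>\<^bsub>A\<^esub> coset_rep A I (x \<otimes>\<^bsub>A\<^esub> y))"
    "coset_rep A I (x \<otimes>\<^bsub>A\<^esub> coset_rep A I (k \<odot>\<^bsub>A\<^esub> y)) = coset_rep A I (k \<odot>\<^bsub>A\<^esub> coset_rep A I (x \<otimes>\<^bsub>A\<^esub> y))"
    if "k \<in> carrier K" "x \<in> carrier A" "y \<in> carrier A" for k x y
    using that A by (simp_all add: ml mr sm assoc_algebra_def)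
  ultimately show ?thesis
    unfolding assoc_algebra_def using Q.module_axioms cl by (auto simp: quot_simps)
qed

definition word_prod :: "('a,'m) monoid_scheme \<Rightarrow> 'a list \<Rightarrow> 'a" where
  "word_prod A w = foldr (mult A) w \<one>\<^bsub>A\<^esub>"

lemma word_prod_simps: "word_prod A [] = \<one>\<^bsub>A\<^esub>" "word_prod A (a # w) = a \<otimes>\<^bsub>A\<^esub> word_prod A w"
  by (auto simp: word_prod_def)

lemma word_prod_closed:
  assumes "monoid A" "set w \<subseteq> carrier A"
  shows "word_prod A w \<in> carrier A"
proof -
  interpret monoid A by fact
  show ?thesis using assms(2) by (induction w) (auto simp: word_prod_simps)
qed

lemma word_prod_append:
  assumes "monoid A" "set u \<subseteq> carrier A" "set v \<subseteq> carrier A"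
  shows "word_prod A (u @ v) = word_prod A u \<otimes>\<^bsub>A\<^esub> word_prod A v"
proof -
  interpret monoid A by fact
  show ?thesis using assms(2)
    by (induction u) (auto simp: word_prod_simps word_prod_closed[OF assms(1)] assms(3) m_assoc)
qed


section \<open>The tensor algebra\<close>

lemma free_algebra_simps:
  "carrier (free_algebra K X) = carrier (free_module K (lists X))"
  "add (free_algebra K X) = add (free_module K (lists X))"
  "zero (free_algebra K X) = zero (free_module K (lists X))"
  "smult (free_algebra K X) = smult (free_module K (lists X))"
  "\<one>\<^bsub>free_algebra K X\<^esub> = delta K []"
  by (auto simp: free_algebra_def)

lemma free_algebra_mult:
  "f \<otimes>\<^bsub>free_algebra K X\<^esub> g = (\<lambda>w. \<Oplus>\<^bsub>K\<^esub>i\<in>{..length w}. f (take i w) \<otimes>\<^bsub>K\<^esub> g (drop i w))"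
  by (auto simp: free_algebra_def)

lemma free_algebra_mult_closed:
  assumes "cring K" and f: "f \<in> carrier (free_algebra K X)" and g: "g \<in> carrier (free_algebra K X)"
  shows "f \<otimes>\<^bsub>free_algebra K X\<^esub> g \<in> carrier (free_algebra K X)"
proof -
  interpret cring K by fact
  note fg = f[unfolded free_algebra_simps free_module_simps] g[unfolded free_algebra_simps free_module_simps]
  let ?h = "f \<otimes>\<^bsub>free_algebra K X\<^esub> g"
  have nz: "\<exists>u v. w = u @ v \<and> f u \<noteq> \<zero>\<^bsub>K\<^esub> \<and> g v \<noteq> \<zero>\<^bsub>K\<^esub>" if "?h w \<noteq> \<zero>\<^bsub>K\<^esub>" for w
  proof (rule ccontr)
    assume *: "\<nexists>u v. w = u @ v \<and> f u \<noteq> \<zero>\<^bsub>K\<^esub> \<and> g v \<noteq> \<zero>\<^bsub>K\<^esub>"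
    have "f (take i w) \<otimes>\<^bsub>K\<^esub> g (drop i w) = \<zero>\<^bsub>K\<^esub>" for i
      using * fg append_take_drop_id[of i w] by (metis l_null r_null)
    then show False using that by (simp add: free_algebra_mult)
  qed
  have "{w. ?h w \<noteq> \<zero>\<^bsub>K\<^esub>} \<subseteq> (\<lambda>(u, v). u @ v) ` ({u. f u \<noteq> \<zero>\<^bsub>K\<^esub>} \<times> {v. g v \<noteq> \<zero>\<^bsub>K\<^esub>})"
    using nz by fastforce
  then have "finite {w. ?h w \<noteq> \<zero>\<^bsub>K\<^esub>}"
    by (rule finite_subset) (use fg in auto)
  moreover have "?h w = \<zero>\<^bsub>K\<^esub>" if "w \<notin> lists X" for w
    using nz[of w] fg that by (metis append_in_lists_conv)
  moreover have "?h w \<in> carrier K" for w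
    using fg by (auto simp: free_algebra_mult)
  ultimately show ?thesis unfolding free_algebra_simps free_module_simps by auto
qed

lemma free_algebra_mult_delta:
  assumes "cring K"
  shows "delta K u \<otimes>\<^bsub>free_algebra K X\<^esub> delta K v = delta K (u @ v)"
proof (rule ext)
  interpret cring K by fact
  fix w
  let ?t = "\<lambda>i. delta K u (take i w) \<otimes>\<^bsub>K\<^esub> delta K v (drop i w)"
  have c: "delta K x y \<in> carrier K" for x y :: 'c by (auto simp: delta_def)
  have z: "?t i = \<zero>\<^bsub>K\<^esub>" if "\<not> (take i w = u \<and> drop i w = v)" for i
    using that by (auto simp: delta_def)
  show "(delta K u \<otimes>\<^bsub>free_algebra K X\<^esub> delta K v) w = delta K (u @ v) w"
  proof (cases "w = u @ v")
    case True
    have "(\<Oplus>\<^bsub>K\<^esub>i\<in>{..length w}. ?t i) = (\<Oplus>\<^bsub>K\<^esub>i\<in>{..length w}. if length u = i then \<one>\<^bsub>K\<^esub> else \<zero>\<^bsub>K\<^esub>)"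
    proof (rule finsum_cong')
      fix i assume "i \<in> {..length w}"
      then have "length u = i" if "take i w = u"
        using that by auto
      then show "?t i = (if length u = i then \<one>\<^bsub>K\<^esub> else \<zero>\<^bsub>K\<^esub>)"
        using z[of i] True by (auto simp: delta_def)
    qed auto
    also have "\<dots> = \<one>\<^bsub>K\<^esub>"
      by (rule finsum_singleton) (use True in auto)
    finally show ?thesis using True by (simp add: free_algebra_mult delta_def)
  next
    case False
    then have "?t i = \<zero>\<^bsub>K\<^esub>" for i
      by (intro z) (metis append_take_drop_id)
    then show ?thesis using False by (simp add: free_algebra_mult delta_def)
  qed
qed

lemma free_algebra_module:
  assumes "cring K"
  shows "module K (free_algebra K X)"
  by (rule module_cong_carrier[OF free_module_module[OF assms, of "lists X"]]) (simp_all add: free_algebra_simps)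

lemma free_algebra_mult_bilinear:
  assumes "cring K"
  shows "bilinear_map K (free_algebra K X) (free_algebra K X) (free_algebra K X) (mult (free_algebra K X))"
proof -
  interpret cring K by fact
  show ?thesis
  proof (intro bilinear_mapI linear_mapI)
    fix f g h assume a: "f \<in> carrier (free_algebra K X)" "g \<in> carrier (free_algebra K X)" "h \<in> carrier (free_algebra K X)"
    note fgh = a[unfolded free_algebra_simps free_module_simps]
    show "f \<otimes>\<^bsub>free_algebra K X\<^esub> (g \<oplus>\<^bsub>free_algebra K X\<^esub> h) =
      f \<otimes>\<^bsub>free_algebra K X\<^esub> g \<oplus>\<^bsub>free_algebra K X\<^esub> f \<otimes>\<^bsub>free_algebra K X\<^esub> h"
      unfolding free_algebra_mult free_algebra_simps free_module_simps
      by (rule ext, subst finsum_addf[symmetric]) (use fgh in \<open>auto simp: r_distr\<close>)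
  next
    fix k f g assume a: "f \<in> carrier (free_algebra K X)" "g \<in> carrier (free_algebra K X)" and k: "k \<in> carrier K"
    note fgh = a[unfolded free_algebra_simps free_module_simps]
    show "f \<otimes>\<^bsub>free_algebra K X\<^esub> (k \<odot>\<^bsub>free_algebra K X\<^esub> g) = k \<odot>\<^bsub>free_algebra K X\<^esub> (f \<otimes>\<^bsub>free_algebra K X\<^esub> g)"
      unfolding free_algebra_mult free_algebra_simps free_module_simps
      by (rule ext, subst finsum_rdistr) (use fgh k in \<open>auto simp: m_lcomm\<close>)
  next
    fix f g h assume a: "f \<in> carrier (free_algebra K X)" "g \<in> carrier (free_algebra K X)" "h \<in> carrier (free_algebra K X)"
    note fgh = a[unfolded free_algebra_simps free_module_simps]
    show "(g \<oplus>\<^bsub>free_algebra K X\<^esub> h) \<otimes>\<^bsub>free_algebra K X\<^esub> f =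
      g \<otimes>\<^bsub>free_algebra K X\<^esub> f \<oplus>\<^bsub>free_algebra K X\<^esub> h \<otimes>\<^bsub>free_algebra K X\<^esub> f"
      unfolding free_algebra_mult free_algebra_simps free_module_simps
      by (rule ext, subst finsum_addf[symmetric]) (use fgh in \<open>auto simp: l_distr\<close>)
  next
    fix k f g assume a: "f \<in> carrier (free_algebra K X)" "g \<in> carrier (free_algebra K X)" and k: "k \<in> carrier K"
    note fgh = a[unfolded free_algebra_simps free_module_simps]
    show "(k \<odot>\<^bsub>free_algebra K X\<^esub> g) \<otimes>\<^bsub>free_algebra K X\<^esub> f = k \<odot>\<^bsub>free_algebra K X\<^esub> (g \<otimes>\<^bsub>free_algebra K X\<^esub> f)"
      unfolding free_algebra_mult free_algebra_simps free_module_simps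
      by (rule ext, subst finsum_rdistr) (use fgh k in \<open>auto simp: m_assoc\<close>)
  qed (auto intro: free_algebra_mult_closed[OF assms])
qed

lemma linear_map_eq_free_algebra:
  assumes "cring K" "module K P" "linear_map K (free_algebra K X) P f" "linear_map K (free_algebra K X) P g"
    and "\<And>w. w \<in> lists X \<Longrightarrow> f (delta K w) = g (delta K w)" "t \<in> carrier (free_algebra K X)"
  shows "f t = g t"
  by (rule linear_map_eq_free_module[OF assms(1,2), of "lists X"])
    (use assms in \<open>simp_all add: linear_map_cong_carrier[OF free_algebra_simps(1,2,4)] free_algebra_simps\<close>)

text \<open>
  Both bracketings of a triple product are trilinear, so associativity reduces to concatenation of words,
  one factor at a time.
\<close>
lemma free_algebra_assoc_algebra:
  assumes "cring K"
  shows "assoc_algebra K (free_algebra K X)"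
proof -
  interpret cring K by fact
  let ?F = "free_algebra K X"
  interpret F: module K ?F by (rule free_algebra_module[OF assms])
  note bil = free_algebra_mult_bilinear[OF assms, of X]
  note L = bilinear_map_left[OF bil] and R = bilinear_map_right[OF bil]
  note ext = linear_map_eq_free_algebra[OF assms F.module_axioms]
  note mc = free_algebra_mult_closed[OF assms]
  have d: "delta K w \<in> carrier ?F" if "w \<in> lists X" for w
    unfolding free_algebra_simps by (rule delta_carrier[OF assms that])
  note dm = free_algebra_mult_delta[OF assms, where X = X]
  have assoc3: "(delta K u \<otimes>\<^bsub>?F\<^esub> delta K v) \<otimes>\<^bsub>?F\<^esub> h = delta K u \<otimes>\<^bsub>?F\<^esub> (delta K v \<otimes>\<^bsub>?F\<^esub> h)"
    if "u \<in> lists X" "v \<in> lists X" "h \<in> carrier ?F" for u v h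
    by (rule ext[OF _ _ _ that(3)])
      (use that in \<open>auto intro!: R linear_map_comp[OF R R] mc d simp: dm\<close>)
  have assoc2: "(delta K u \<otimes>\<^bsub>?F\<^esub> g) \<otimes>\<^bsub>?F\<^esub> h = delta K u \<otimes>\<^bsub>?F\<^esub> (g \<otimes>\<^bsub>?F\<^esub> h)"
    if "u \<in> lists X" "g \<in> carrier ?F" "h \<in> carrier ?F" for u g h
    by (rule ext[OF linear_map_comp[OF R L] linear_map_comp[OF L R] _ that(2)])
      (use that in \<open>auto intro!: assoc3 mc d\<close>)
  have assoc: "(f \<otimes>\<^bsub>?F\<^esub> g) \<otimes>\<^bsub>?F\<^esub> h = f \<otimes>\<^bsub>?F\<^esub> (g \<otimes>\<^bsub>?F\<^esub> h)"
    if "f \<in> carrier ?F" "g \<in> carrier ?F" "h \<in> carrier ?F" for f g h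
    by (rule ext[OF linear_map_comp[OF L L] L _ that(1)])
      (use that in \<open>auto intro!: assoc2 mc d\<close>)
  have "ring ?F"
  proof (rule ringI)
    show "monoid ?F"
    proof (rule monoidI)
      show one: "\<one>\<^bsub>?F\<^esub> \<in> carrier ?F" using d[of "[]"] by (simp add: free_algebra_simps)
      show "\<one>\<^bsub>?F\<^esub> \<otimes>\<^bsub>?F\<^esub> f = f" if "f \<in> carrier ?F" for f
        by (rule ext[OF R[OF one] linear_map_id[unfolded id_def] _ that]) (simp add: free_algebra_simps(5) dm)
      show "f \<otimes>\<^bsub>?F\<^esub> \<one>\<^bsub>?F\<^esub> = f" if "f \<in> carrier ?F" for f
        by (rule ext[OF L[OF one] linear_map_id[unfolded id_def] _ that]) (simp add: free_algebra_simps(5) dm)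
    qed (use assoc mc in auto)
  qed (use F.abelian_group_axioms linear_map_add[OF L] linear_map_add[OF R] in auto)
  then show ?thesis
    unfolding assoc_algebra_def using F.module_axioms linear_map_smult[OF L] linear_map_smult[OF R] by auto
qed

definition multilinear ::
    "('k,'r) ring_scheme \<Rightarrow> ('k,'a,'m) module_scheme \<Rightarrow> ('k,'p,'n) module_scheme \<Rightarrow> ('a list \<Rightarrow> 'p) \<Rightarrow> bool" where
  "multilinear K M P \<beta> \<longleftrightarrow>
     (\<forall>w\<in>lists (carrier M). \<beta> w \<in> carrier P) \<and>
     (\<forall>u\<in>lists (carrier M). \<forall>v\<in>lists (carrier M). linear_map K M P (\<lambda>a. \<beta> (u @ a # v)))"

lemma multilinear_closed: "multilinear K M P \<beta> \<Longrightarrow> w \<in> lists (carrier M) \<Longrightarrow> \<beta> w \<in> carrier P"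
  and multilinear_linear: "multilinear K M P \<beta> \<Longrightarrow> u \<in> lists (carrier M) \<Longrightarrow> v \<in> lists (carrier M) \<Longrightarrow>
    linear_map K M P (\<lambda>a. \<beta> (u @ a # v))"
  unfolding multilinear_def by auto

lemma linear_relations_closed:
  assumes "module K M"
  shows "linear_relations K M \<subseteq> carrier (free_algebra K (carrier M))"
proof -
  interpret M: module K M by fact
  interpret F: module K "free_algebra K (carrier M)" by (rule free_algebra_module[OF M.is_cring])
  have d: "delta K [a] \<in> carrier (free_algebra K (carrier M))" if "a \<in> carrier M" for a
    unfolding free_algebra_simps by (rule delta_carrier[OF M.is_cring]) (use that in auto)
  show ?thesis
    unfolding linear_relations_def Let_def by (auto intro!: F.minus_closed F.a_closed F.smult_closed d)
qed

lemma linear_relations_ideal: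
  assumes "module K M"
  shows "ideal (Idl\<^bsub>free_algebra K (carrier M)\<^esub> (linear_relations K M)) (free_algebra K (carrier M))"
  by (rule ring.genideal_ideal[OF assoc_algebra_ring[OF free_algebra_assoc_algebra] linear_relations_closed])
    (use assms module.axioms in auto)

text \<open>
  The universal property of the tensor algebra. The kernel of the extension of \<open>\<beta>\<close> need not be an
  ideal, but the set of all \<open>f\<close> such that \<open>u f v\<close> is killed for all words \<open>u\<close> and
  \<open>v\<close> is one, and multilinearity says that it contains the linear relations.
\<close>
lemma lin_ext_linear_relations:
  assumes M: "module K M" and P: "module K P" and b: "multilinear K M P \<beta>"
    and x: "x \<in> Idl\<^bsub>free_algebra K (carrier M)\<^esub> (linear_relations K M)"
  shows "lin_ext K P \<beta> x = \<zero>\<^bsub>P\<^esub>"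
proof -
  interpret M: module K M by fact
  interpret P: module K P by fact
  let ?F = "free_algebra K (carrier M)" and ?L = "lists (carrier M)"
  note FA = free_algebra_assoc_algebra[OF M.is_cring, of "carrier M"]
  interpret F: module K ?F by (rule assoc_algebra_module[OF FA])
  interpret FR: ring ?F by (rule assoc_algebra_ring[OF FA])
  note bil = free_algebra_mult_bilinear[OF M.is_cring, of "carrier M"]
  note L = bilinear_map_left[OF bil] and R = bilinear_map_right[OF bil]
  note dm = free_algebra_mult_delta[OF M.is_cring, where X = "carrier M"]
  have d: "delta K w \<in> carrier ?F" if "w \<in> ?L" for w
    unfolding free_algebra_simps by (rule delta_carrier[OF M.is_cring that])
  have h: "linear_map K ?F P (lin_ext K P \<beta>)"
    using lin_ext_linear[OF P, of ?L \<beta>] multilinear_closed[OF b]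
    by (simp add: linear_map_cong_carrier[OF free_algebra_simps(1,2,4)])
  have hd: "lin_ext K P \<beta> (delta K w) = \<beta> w" if "w \<in> ?L" for w
    using lin_ext_delta[OF P, of \<beta> w] multilinear_closed[OF b that] by auto
  let ?s = "\<lambda>u v f. lin_ext K P \<beta> (delta K u \<otimes>\<^bsub>?F\<^esub> (f \<otimes>\<^bsub>?F\<^esub> delta K v))"
  have sl: "linear_map K ?F P (?s u v)" if "u \<in> ?L" "v \<in> ?L" for u v
    using linear_map_comp[OF linear_map_comp[OF L R] h] d that by auto
  define J where "J = {f \<in> carrier ?F. \<forall>u\<in>?L. \<forall>v\<in>?L. ?s u v f = \<zero>\<^bsub>P\<^esub>}"
  have J: "submodule J K ?F"
    by (rule F.submoduleI')
      (auto simp: J_def linear_map_zero[OF F.module_axioms P sl] linear_map_add[OF sl] linear_map_smult[OF sl])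
  have "ideal J ?F"
  proof (rule submodule_ideal[OF FA J])
    fix g f assume g: "g \<in> carrier ?F" and f: "f \<in> J"
    have fc: "f \<in> carrier ?F" using f by (auto simp: J_def)
    have "?s u v (g \<otimes>\<^bsub>?F\<^esub> f) = \<zero>\<^bsub>P\<^esub>" if uv: "u \<in> ?L" "v \<in> ?L" for u v
    proof (rule linear_map_eq_free_algebra[OF M.is_cring P linear_map_comp[OF L sl] linear_map_const_zero[OF P] _ g])
      fix w assume w: "w \<in> ?L"
      have "delta K u \<otimes>\<^bsub>?F\<^esub> ((delta K w \<otimes>\<^bsub>?F\<^esub> f) \<otimes>\<^bsub>?F\<^esub> delta K v)
        = (delta K u \<otimes>\<^bsub>?F\<^esub> delta K w) \<otimes>\<^bsub>?F\<^esub> (f \<otimes>\<^bsub>?F\<^esub> delta K v)"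
        using uv w fc d by (simp add: FR.m_assoc)
      then show "?s u v (delta K w \<otimes>\<^bsub>?F\<^esub> f) = \<zero>\<^bsub>P\<^esub>"
        using f uv w by (auto simp: dm J_def)
    qed (use fc uv in auto)
    then show "g \<otimes>\<^bsub>?F\<^esub> f \<in> J" using g fc by (auto simp: J_def)
    have "?s u v (f \<otimes>\<^bsub>?F\<^esub> g) = \<zero>\<^bsub>P\<^esub>" if uv: "u \<in> ?L" "v \<in> ?L" for u v
    proof (rule linear_map_eq_free_algebra[OF M.is_cring P linear_map_comp[OF R sl] linear_map_const_zero[OF P] _ g])
      fix w assume w: "w \<in> ?L"
      have "(f \<otimes>\<^bsub>?F\<^esub> delta K w) \<otimes>\<^bsub>?F\<^esub> delta K v = f \<otimes>\<^bsub>?F\<^esub> (delta K w \<otimes>\<^bsub>?F\<^esub> delta K v)"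
        using uv w fc d by (simp add: FR.m_assoc)
      then show "?s u v (f \<otimes>\<^bsub>?F\<^esub> delta K w) = \<zero>\<^bsub>P\<^esub>"
        using f uv w by (auto simp: dm J_def)
    qed (use fc uv in auto)
    then show "f \<otimes>\<^bsub>?F\<^esub> g \<in> J" using g fc by (auto simp: J_def)
  qed
  moreover have "linear_relations K M \<subseteq> J"
  proof
    have sd: "?s u v (delta K [a]) = \<beta> (u @ a # v)" if "u \<in> ?L" "v \<in> ?L" "a \<in> carrier M" for u v a
      using that by (simp add: dm hd)
    note bl = linear_map_add[OF multilinear_linear[OF b]] linear_map_smult[OF multilinear_linear[OF b]]
      linear_map_closed[OF multilinear_linear[OF b]]
    fix r assume r: "r \<in> linear_relations K M"
    have "?s u v r = \<zero>\<^bsub>P\<^esub>" if uv: "u \<in> ?L" "v \<in> ?L" for u v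
    proof -
      note suv = sl[OF uv] and sduv = sd[OF uv] and bluv = multilinear_linear[OF b uv]
      have d1: "delta K [a] \<in> carrier ?F" if "a \<in> carrier M" for a using that d by auto
      consider (add) a a' where "a \<in> carrier M" "a' \<in> carrier M"
          "r = delta K [a \<oplus>\<^bsub>M\<^esub> a'] \<ominus>\<^bsub>?F\<^esub> (delta K [a] \<oplus>\<^bsub>?F\<^esub> delta K [a'])"
        | (smult) k a where "k \<in> carrier K" "a \<in> carrier M"
          "r = delta K [k \<odot>\<^bsub>M\<^esub> a] \<ominus>\<^bsub>?F\<^esub> k \<odot>\<^bsub>?F\<^esub> delta K [a]"
        using r unfolding linear_relations_def Let_def by blast
      then show ?thesis
      proof cases
        case add
        have "?s u v r = \<beta> (u @ (a \<oplus>\<^bsub>M\<^esub> a') # v) \<ominus>\<^bsub>P\<^esub> (\<beta> (u @ a # v) \<oplus>\<^bsub>P\<^esub> \<beta> (u @ a' # v))"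
          using add(1,2) d1 unfolding add(3)
          by (simp only: linear_map_minus[OF F.module_axioms P suv] linear_map_add[OF suv] sduv
              F.a_closed M.a_closed)
        then show ?thesis
          using linear_map_add[OF bluv add(1,2)] linear_map_closed[OF bluv] add(1,2)
          by (simp add: P.minus_eq P.r_neg)
      next
        case smult
        have "?s u v r = \<beta> (u @ (k \<odot>\<^bsub>M\<^esub> a) # v) \<ominus>\<^bsub>P\<^esub> k \<odot>\<^bsub>P\<^esub> \<beta> (u @ a # v)"
          using smult(1,2) d1 unfolding smult(3)
          by (simp only: linear_map_minus[OF F.module_axioms P suv] linear_map_smult[OF suv] sduv
              F.smult_closed M.smult_closed)
        then show ?thesis
          using linear_map_smult[OF bluv smult(1,2)] linear_map_closed[OF bluv] smult(1,2)
          by (simp add: P.minus_eq P.r_neg)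
      qed
    qed
    then show "r \<in> J" using r linear_relations_closed[OF M] by (auto simp: J_def)
  qed
  ultimately have "x \<in> J" using x FR.genideal_minimal by blast
  then have "?s [] [] x = \<zero>\<^bsub>P\<^esub>" "x \<in> carrier ?F" by (auto simp: J_def)
  then show ?thesis
    using FR.l_one FR.r_one by (simp add: free_algebra_simps(5))
qed

definition tensor_word ::
    "('k,'r) ring_scheme \<Rightarrow> ('k,'a,'m) module_scheme \<Rightarrow> 'a list \<Rightarrow> ('a list \<Rightarrow> 'k)" where
  "tensor_word K M w = tensor_alg_proj K M (delta K w)"

lemma tensor_alg_incl_word: "tensor_alg_incl K M v = tensor_word K M [v]"
  by (simp add: tensor_alg_incl_def tensor_word_def)

lemma tensor_alg_algebra:
  assumes M: "module K M"
  shows "assoc_algebra K (tensor_alg K M)"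
  unfolding tensor_alg_def Let_def
  by (rule quot_algebra[OF free_algebra_assoc_algebra linear_relations_ideal[OF M]])
    (use M module.axioms in auto)

lemma tensor_alg_proj:
  assumes M: "module K M"
  shows tensor_alg_proj_linear: "linear_map K (free_algebra K (carrier M)) (tensor_alg K M) (tensor_alg_proj K M)"
    and tensor_alg_proj_idem: "t \<in> carrier (tensor_alg K M) \<Longrightarrow> t \<in> carrier (free_algebra K (carrier M)) \<and> tensor_alg_proj K M t = t"
    and tensor_alg_proj_mult: "f \<in> carrier (free_algebra K (carrier M)) \<Longrightarrow> g \<in> carrier (free_algebra K (carrier M)) \<Longrightarrow>
      tensor_alg_proj K M (f \<otimes>\<^bsub>free_algebra K (carrier M)\<^esub> g) =
        tensor_alg_proj K M f \<otimes>\<^bsub>tensor_alg K M\<^esub> tensor_alg_proj K M g"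
proof -
  interpret M: module K M by fact
  let ?F = "free_algebra K (carrier M)"
  note FA = free_algebra_assoc_algebra[OF M.is_cring, of "carrier M"]
  interpret F: module K ?F by (rule assoc_algebra_module[OF FA])
  note I = linear_relations_ideal[OF M]
  note S = ideal_submodule[OF FA I]
  show "linear_map K ?F (tensor_alg K M) (tensor_alg_proj K M)"
    unfolding tensor_alg_def tensor_alg_proj_def Let_def by (rule F.coset_rep_linear[OF S])
  show "t \<in> carrier (tensor_alg K M) \<Longrightarrow> t \<in> carrier ?F \<and> tensor_alg_proj K M t = t"
    unfolding tensor_alg_def tensor_alg_proj_def Let_def quot_simps
    using F.coset_rep_closed[OF S] F.coset_rep_idem[OF S] by auto
  show "f \<in> carrier ?F \<Longrightarrow> g \<in> carrier ?F \<Longrightarrow>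
      tensor_alg_proj K M (f \<otimes>\<^bsub>?F\<^esub> g) = tensor_alg_proj K M f \<otimes>\<^bsub>tensor_alg K M\<^esub> tensor_alg_proj K M g"
    unfolding tensor_alg_def tensor_alg_proj_def Let_def quot_simps using coset_rep_mult[OF FA I] by simp
qed

lemma delta_free_algebra:
  assumes "cring K" "w \<in> lists X"
  shows "delta K w \<in> carrier (free_algebra K X)"
  unfolding free_algebra_simps by (rule delta_carrier[OF assms])

lemma tensor_word:
  assumes M: "module K M"
  shows tensor_word_closed: "w \<in> lists (carrier M) \<Longrightarrow> tensor_word K M w \<in> carrier (tensor_alg K M)"
    and tensor_word_append: "u \<in> lists (carrier M) \<Longrightarrow> v \<in> lists (carrier M) \<Longrightarrow>
      tensor_word K M (u @ v) = tensor_word K M u \<otimes>\<^bsub>tensor_alg K M\<^esub> tensor_word K M v"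
    and tensor_word_Nil: "tensor_word K M [] = \<one>\<^bsub>tensor_alg K M\<^esub>"
proof -
  interpret M: module K M by fact
  show "w \<in> lists (carrier M) \<Longrightarrow> tensor_word K M w \<in> carrier (tensor_alg K M)"
    unfolding tensor_word_def
    using linear_map_closed[OF tensor_alg_proj_linear[OF M]] delta_free_algebra[OF M.is_cring] by metis
  show "u \<in> lists (carrier M) \<Longrightarrow> v \<in> lists (carrier M) \<Longrightarrow>
      tensor_word K M (u @ v) = tensor_word K M u \<otimes>\<^bsub>tensor_alg K M\<^esub> tensor_word K M v"
    unfolding tensor_word_def
    using tensor_alg_proj_mult[OF M] delta_free_algebra[OF M.is_cring] free_algebra_mult_delta[OF M.is_cring] by metis
  show "tensor_word K M [] = \<one>\<^bsub>tensor_alg K M\<^esub>"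
    unfolding tensor_word_def tensor_alg_def tensor_alg_proj_def Let_def quot_simps free_algebra_simps ..
qed

lemma tensor_alg_incl_linear:
  assumes M: "module K M"
  shows "linear_map K M (tensor_alg K M) (tensor_alg_incl K M)"
proof -
  interpret M: module K M by fact
  let ?F = "free_algebra K (carrier M)"
  note FA = free_algebra_assoc_algebra[OF M.is_cring, of "carrier M"]
  interpret F: module K ?F by (rule assoc_algebra_module[OF FA])
  interpret FR: ring ?F by (rule assoc_algebra_ring[OF FA])
  note I = linear_relations_ideal[OF M]
  note S = ideal_submodule[OF FA I]
  note lin = tensor_alg_proj_linear[OF M]
  have d: "delta K [a] \<in> carrier ?F" if "a \<in> carrier M" for a
    by (rule delta_free_algebra[OF M.is_cring]) (use that in auto)
  have eq: "tensor_alg_proj K M x = tensor_alg_proj K M y"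
    if "x \<ominus>\<^bsub>?F\<^esub> y \<in> linear_relations K M" "x \<in> carrier ?F" "y \<in> carrier ?F" for x y
    unfolding tensor_alg_proj_def Let_def F.coset_rep_eq_iff[OF S that(2,3)]
    using that(1) FR.genideal_self[OF linear_relations_closed[OF M]] by auto
  show ?thesis
  proof (rule linear_mapI)
    fix a b assume ab: "a \<in> carrier M" "b \<in> carrier M"
    have "tensor_alg_proj K M (delta K [a \<oplus>\<^bsub>M\<^esub> b]) = tensor_alg_proj K M (delta K [a] \<oplus>\<^bsub>?F\<^esub> delta K [b])"
      by (rule eq) (use ab d in \<open>auto simp: linear_relations_def Let_def\<close>)
    then show "tensor_alg_incl K M (a \<oplus>\<^bsub>M\<^esub> b) = tensor_alg_incl K M a \<oplus>\<^bsub>tensor_alg K M\<^esub> tensor_alg_incl K M b"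
      unfolding tensor_alg_incl_def using linear_map_add[OF lin] ab d by auto
  next
    fix k a assume ab: "k \<in> carrier K" "a \<in> carrier M"
    have "tensor_alg_proj K M (delta K [k \<odot>\<^bsub>M\<^esub> a]) = tensor_alg_proj K M (k \<odot>\<^bsub>?F\<^esub> delta K [a])"
      by (rule eq) (use ab d in \<open>auto simp: linear_relations_def Let_def\<close>)
    then show "tensor_alg_incl K M (k \<odot>\<^bsub>M\<^esub> a) = k \<odot>\<^bsub>tensor_alg K M\<^esub> tensor_alg_incl K M a"
      unfolding tensor_alg_incl_def using linear_map_smult[OF lin] ab d by auto
  qed (use linear_map_closed[OF lin] d in \<open>auto simp: tensor_alg_incl_def\<close>)
qed

lemma tensor_alg_linear_eq:
  assumes M: "module K M" and P: "module K P"
    and f: "linear_map K (tensor_alg K M) P f" and g: "linear_map K (tensor_alg K M) P g"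
    and eq: "\<And>w. w \<in> lists (carrier M) \<Longrightarrow> f (tensor_word K M w) = g (tensor_word K M w)"
    and t: "t \<in> carrier (tensor_alg K M)"
  shows "f t = g t"
proof -
  interpret M: module K M by fact
  note lin = tensor_alg_proj_linear[OF M]
  have "f (tensor_alg_proj K M t) = g (tensor_alg_proj K M t)"
    by (rule linear_map_eq_free_algebra[OF M.is_cring P linear_map_comp[OF lin f] linear_map_comp[OF lin g]])
      (use eq tensor_alg_proj_idem[OF M t] in \<open>auto simp: tensor_word_def\<close>)
  then show ?thesis using tensor_alg_proj_idem[OF M t] by auto
qed

lemma tensor_alg_lift:
  assumes M: "module K M" and P: "module K P" and b: "multilinear K M P \<beta>"
  shows tensor_alg_lift_linear: "linear_map K (tensor_alg K M) P (lin_ext K P \<beta>)"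
    and tensor_alg_lift_word: "w \<in> lists (carrier M) \<Longrightarrow> lin_ext K P \<beta> (tensor_word K M w) = \<beta> w"
proof -
  interpret M: module K M by fact
  let ?F = "free_algebra K (carrier M)"
  note FA = free_algebra_assoc_algebra[OF M.is_cring, of "carrier M"]
  interpret F: module K ?F by (rule assoc_algebra_module[OF FA])
  note S = ideal_submodule[OF FA linear_relations_ideal[OF M]]
  have h: "linear_map K ?F P (lin_ext K P \<beta>)"
    using lin_ext_linear[OF P, of "lists (carrier M)" \<beta>] multilinear_closed[OF b]
    by (simp add: linear_map_cong_carrier[OF free_algebra_simps(1,2,4)])
  have null: "lin_ext K P \<beta> x = \<zero>\<^bsub>P\<^esub>" if "x \<in> Idl\<^bsub>?F\<^esub> (linear_relations K M)" for x
    using lin_ext_linear_relations[OF M P b that] .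
  note q = linear_map_quot[OF F.module_axioms P h S null]
  show "linear_map K (tensor_alg K M) P (lin_ext K P \<beta>)"
    unfolding tensor_alg_def Let_def by (rule q(2))
  show "w \<in> lists (carrier M) \<Longrightarrow> lin_ext K P \<beta> (tensor_word K M w) = \<beta> w"
    unfolding tensor_word_def tensor_alg_proj_def Let_def
    using q(1)[OF _ delta_free_algebra[OF M.is_cring]] lin_ext_delta[OF P, of \<beta> w] multilinear_closed[OF b] by simp
qed

text \<open>
  Although the representative of an element of the \<open>n\<close>-th tensor power may involve words of other
  lengths, the element is the image of a formal sum of words of length \<open>n\<close>, and these formal sums
  form a free module themselves.
\<close>
lemma tensor_power_linear:
  assumes M: "module K M" and P: "module K P" and f: "linear_map K (tensor_alg K M) P f"
    and H: "submodule H K P" and eq: "\<And>w. w \<in> lists (carrier M) \<Longrightarrow> length w = n \<Longrightarrow> f (tensor_word K M w) \<in> H"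
    and t: "t \<in> tensor_power K M n"
  shows "f t \<in> H"
proof -
  interpret M: module K M by fact
  let ?L = "{w \<in> lists (carrier M). length w = n}"
  let ?G = "free_module K ?L"
  have G: "module K ?G" by (rule free_module_module[OF M.is_cring])
  have lin: "linear_map K ?G (tensor_alg K M) (tensor_alg_proj K M)"
  proof -
    have "carrier ?G \<subseteq> carrier (free_algebra K (carrier M))"
      by (auto simp: free_algebra_simps free_module_simps)
    moreover have "add ?G = add (free_algebra K (carrier M))" "smult ?G = smult (free_algebra K (carrier M))"
      by (auto simp: free_algebra_simps free_module_def)
    ultimately show ?thesis
      using linear_map_subset[OF tensor_alg_proj_linear[OF M]] by blast
  qed
  obtain g where g: "g \<in> carrier ?G" "t = tensor_alg_proj K M g"
    using t unfolding tensor_power_def free_algebra_simps free_module_simps by blast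
  have "f (tensor_alg_proj K M g) \<in> H"
    by (rule linear_map_mspan[OF G P linear_map_comp[OF lin f] H, of "delta K ` ?L"])
      (use g free_module_span[OF M.is_cring, of ?L] eq in
        \<open>auto simp: tensor_word_def intro!: delta_carrier M.is_cring\<close>)
  then show ?thesis using g by simp
qed

lemma tensor_power_word:
  assumes M: "module K M" and w: "w \<in> lists (carrier M)"
  shows "tensor_word K M w \<in> tensor_power K M (length w)"
proof -
  interpret M: module K M by fact
  show ?thesis
  unfolding tensor_power_def tensor_word_def
  using delta_free_algebra[OF M.is_cring w] by (auto simp: delta_def)
qed

text \<open>
  With \<open>tensor_alg_lift\<close> this yields the algebra map extending \<open>q\<close>, which is multiplicative
  by \<open>tensor_alg_lift_mult\<close>.
\<close>
lemma word_prod_multilinear: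
  assumes M: "module K M" and A: "assoc_algebra K A" and q: "linear_map K M A q"
  shows "multilinear K M A (\<lambda>w. word_prod A (map q w))"
proof -
  interpret A: ring A by (rule assoc_algebra_ring[OF A])
  note bil = assoc_algebra_mult_bilinear[OF A]
  have cl: "word_prod A (map q w) \<in> carrier A" if "w \<in> lists (carrier M)" for w
    by (rule word_prod_closed) (use that linear_map_closed[OF q] A.monoid_axioms in auto)
  have "linear_map K M A (\<lambda>a. word_prod A (map q (u @ a # v)))"
    if uv: "u \<in> lists (carrier M)" "v \<in> lists (carrier M)" for u v
  proof (rule linear_map_cong[OF M])
    show "linear_map K M A (\<lambda>a. word_prod A (map q u) \<otimes>\<^bsub>A\<^esub> (q a \<otimes>\<^bsub>A\<^esub> word_prod A (map q v)))"
      using linear_map_comp[OF linear_map_comp[OF q bilinear_map_left[OF bil cl[OF uv(2)]]]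
          bilinear_map_right[OF bil cl[OF uv(1)]]] .
    fix a assume a: "a \<in> carrier M"
    have "set (map q u) \<subseteq> carrier A" "set (map q (a # v)) \<subseteq> carrier A"
      using linear_map_closed[OF q] uv a by auto
    then show "word_prod A (map q u) \<otimes>\<^bsub>A\<^esub> (q a \<otimes>\<^bsub>A\<^esub> word_prod A (map q v)) = word_prod A (map q (u @ a # v))"
      using word_prod_append[OF A.monoid_axioms, of "map q u" "map q (a # v)"] by (simp add: word_prod_simps)
  qed
  then show ?thesis using cl unfolding multilinear_def by auto
qed

lemma word_prod_tensor_word:
  assumes M: "module K M" and w: "w \<in> lists (carrier M)"
  shows "word_prod (tensor_alg K M) (map (tensor_alg_incl K M) w) = tensor_word K M w"
  using w
proof (induction w)
  case Nil
  then show ?case by (simp add: word_prod_simps tensor_word_Nil[OF M])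
next
  case (Cons a w)
  then show ?case
    using tensor_word_append[OF M, of "[a]" w] by (simp add: word_prod_simps tensor_alg_incl_word)
qed

lemma tensor_alg_lift_mult:
  assumes M: "module K M" and A: "assoc_algebra K A" and q: "linear_map K M A q"
    and s: "s \<in> carrier (tensor_alg K M)" and t: "t \<in> carrier (tensor_alg K M)"
  defines "h \<equiv> lin_ext K A (\<lambda>w. word_prod A (map q w))"
  shows "h (s \<otimes>\<^bsub>tensor_alg K M\<^esub> t) = h s \<otimes>\<^bsub>A\<^esub> h t"
proof -
  interpret A: ring A by (rule assoc_algebra_ring[OF A])
  note AM = assoc_algebra_module[OF A]
  note ml = word_prod_multilinear[OF M A q]
  note hl = tensor_alg_lift_linear[OF M AM ml, folded h_def]
    and hw = tensor_alg_lift_word[OF M AM ml, folded h_def]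
  note bA = assoc_algebra_mult_bilinear[OF A]
    and bT = assoc_algebra_mult_bilinear[OF tensor_alg_algebra[OF M]]
  note wc = tensor_word_closed[OF M]
  have 1: "h (tensor_word K M u \<otimes>\<^bsub>tensor_alg K M\<^esub> t) = h (tensor_word K M u) \<otimes>\<^bsub>A\<^esub> h t"
    if u: "u \<in> lists (carrier M)" for u
  proof (rule tensor_alg_linear_eq[OF M AM linear_map_comp[OF bilinear_map_right[OF bT wc[OF u]] hl]
        linear_map_comp[OF hl bilinear_map_right[OF bA linear_map_closed[OF hl wc[OF u]]]] _ t])
    fix v assume v: "v \<in> lists (carrier M)"
    have "set (map q u) \<subseteq> carrier A" "set (map q v) \<subseteq> carrier A"
      using linear_map_closed[OF q] u v by auto
    then show "h (tensor_word K M u \<otimes>\<^bsub>tensor_alg K M\<^esub> tensor_word K M v) =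
      h (tensor_word K M u) \<otimes>\<^bsub>A\<^esub> h (tensor_word K M v)"
      unfolding tensor_word_append[OF M u v, symmetric]
      using hw[of "u @ v"] hw[OF u] hw[OF v] u v word_prod_append[OF A.monoid_axioms] by simp
  qed
  show ?thesis
    by (rule tensor_alg_linear_eq[OF M AM linear_map_comp[OF bilinear_map_left[OF bT t] hl]
          linear_map_comp[OF hl bilinear_map_left[OF bA linear_map_closed[OF hl t]]] _ s])
      (rule 1)
qed

lemma tensor_alg_eval_lin_ext:
  "tensor_alg_eval K A = lin_ext K A (word_prod A)"
  by (intro ext) (simp add: tensor_alg_eval_def lin_ext_def word_prod_def)


section \<open>Complements and kernels over a field\<close>

lemma (in module) minus_eq_zero_iff:
  assumes "x \<in> carrier M" "y \<in> carrier M"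
  shows "x \<ominus>\<^bsub>M\<^esub> y = \<zero>\<^bsub>M\<^esub> \<longleftrightarrow> x = y"
proof
  assume "x \<ominus>\<^bsub>M\<^esub> y = \<zero>\<^bsub>M\<^esub>"
  then have "(x \<ominus>\<^bsub>M\<^esub> y) \<oplus>\<^bsub>M\<^esub> y = y" using assms by simp
  then show "x = y" using assms by (simp add: M.minus_eq M.a_assoc M.l_neg)
qed (use assms in \<open>simp add: M.minus_eq M.r_neg\<close>)

lemma (in module) submodule_Union_chain:
  assumes "\<C> \<noteq> {}" "subset.chain {W. submodule W R M} \<C>"
  shows "submodule (\<Union>\<C>) R M"
proof -
  have sub: "submodule W R M" if "W \<in> \<C>" for W
    using assms(2) that unfolding subset.chain_def by blast
  have comp: "W \<subseteq> W' \<or> W' \<subseteq> W" if "W \<in> \<C>" "W' \<in> \<C>" for W W'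
    using assms(2) that unfolding subset.chain_def by blast
  show ?thesis
  proof (rule submoduleI')
    show "\<Union>\<C> \<subseteq> carrier M" using submodule_subset[OF sub] by blast
    show "\<zero>\<^bsub>M\<^esub> \<in> \<Union>\<C>" using assms(1) submodule_zero[OF sub] by blast
    fix a b assume "a \<in> \<Union>\<C>" "b \<in> \<Union>\<C>"
    then obtain W W' where W: "W \<in> \<C>" "W' \<in> \<C>" "a \<in> W" "b \<in> W'" by auto
    then show "a \<oplus>\<^bsub>M\<^esub> b \<in> \<Union>\<C>"
      using comp[OF W(1,2)] submodule_add[OF sub[OF W(1)]] submodule_add[OF sub[OF W(2)]] by blast
  next
    fix k a assume "k \<in> carrier R" "a \<in> \<Union>\<C>"
    then show "k \<odot>\<^bsub>M\<^esub> a \<in> \<Union>\<C>" using submodule_smult[OF sub] by blast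
  qed
qed

text \<open>
  A submodule maximal among those meeting \<open>N\<close> trivially is a complement: if \<open>x\<close> is not in
  \<open>N + W\<close>, then \<open>W + K x\<close> still meets \<open>N\<close> trivially, as a nonzero coefficient of
  \<open>x\<close> could be inverted.
\<close>
lemma complement_exists:
  assumes K: "field K" and M: "module K M" and N: "submodule N K M"
  obtains W where "submodule W K M" "W \<inter> N = {\<zero>\<^bsub>M\<^esub>}"
    "\<And>x. x \<in> carrier M \<Longrightarrow> \<exists>n\<in>N. \<exists>w\<in>W. x = n \<oplus>\<^bsub>M\<^esub> w"
proof -
  interpret K: field K by fact
  interpret M: module K M by fact
  note Nc = M.submodule_closed[OF N]
  define \<A> where "\<A> = {W. submodule W K M \<and> W \<inter> N \<subseteq> {\<zero>\<^bsub>M\<^esub>}}"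
  have "{\<zero>\<^bsub>M\<^esub>} \<in> \<A>" unfolding \<A>_def using M.zero_submodule by auto
  then have "\<A> \<noteq> {}" by auto
  moreover have "\<Union>\<C> \<in> \<A>" if "\<C> \<noteq> {}" "subset.chain \<A> \<C>" for \<C>
  proof -
    have "subset.chain {W. submodule W K M} \<C>"
      using that(2) unfolding subset.chain_def \<A>_def by blast
    then have "submodule (\<Union>\<C>) K M" by (rule M.submodule_Union_chain[OF that(1)])
    moreover have "\<Union>\<C> \<inter> N \<subseteq> {\<zero>\<^bsub>M\<^esub>}"
      using that(2) unfolding subset.chain_def \<A>_def by blast
    ultimately show ?thesis unfolding \<A>_def by simp
  qed
  ultimately have "\<exists>W\<in>\<A>. \<forall>X\<in>\<A>. W \<subseteq> X \<longrightarrow> X = W"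
    by (rule subset_Zorn_nonempty)
  then obtain W where W: "W \<in> \<A>" and max: "\<And>X. X \<in> \<A> \<Longrightarrow> W \<subseteq> X \<Longrightarrow> X = W" by auto
  have Ws: "submodule W K M" and WN: "W \<inter> N \<subseteq> {\<zero>\<^bsub>M\<^esub>}" using W unfolding \<A>_def by auto
  note Wc = M.submodule_closed[OF Ws]
  have "\<exists>n\<in>N. \<exists>w\<in>W. x = n \<oplus>\<^bsub>M\<^esub> w" if x: "x \<in> carrier M" for x
  proof (rule ccontr)
    assume no: "\<not> ?thesis"
    define X where "X = {w \<oplus>\<^bsub>M\<^esub> k \<odot>\<^bsub>M\<^esub> x | w k. w \<in> W \<and> k \<in> carrier K}"
    have XI: "w \<oplus>\<^bsub>M\<^esub> k \<odot>\<^bsub>M\<^esub> x \<in> X" if "w \<in> W" "k \<in> carrier K" for w k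
      using that unfolding X_def by blast
    have "submodule X K M"
    proof (rule M.submoduleI')
      show "X \<subseteq> carrier M" unfolding X_def using Wc(2) x by auto
      show "\<zero>\<^bsub>M\<^esub> \<in> X" using XI[OF Wc(3) K.zero_closed] x by simp
    next
      fix a b assume "a \<in> X" "b \<in> X"
      then obtain w k w' k' where *: "w \<in> W" "k \<in> carrier K" "a = w \<oplus>\<^bsub>M\<^esub> k \<odot>\<^bsub>M\<^esub> x"
        "w' \<in> W" "k' \<in> carrier K" "b = w' \<oplus>\<^bsub>M\<^esub> k' \<odot>\<^bsub>M\<^esub> x" unfolding X_def by blast
      have "a \<oplus>\<^bsub>M\<^esub> b = (w \<oplus>\<^bsub>M\<^esub> w') \<oplus>\<^bsub>M\<^esub> (k \<oplus>\<^bsub>K\<^esub> k') \<odot>\<^bsub>M\<^esub> x"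
        using * Wc(2)[of w] Wc(2)[of w'] x by (simp add: M.smult_l_distr M.a_ac)
      then show "a \<oplus>\<^bsub>M\<^esub> b \<in> X" using XI[of "w \<oplus>\<^bsub>M\<^esub> w'" "k \<oplus>\<^bsub>K\<^esub> k'"] * Wc(4) by auto
    next
      fix l a assume "l \<in> carrier K" "a \<in> X"
      then obtain w k where *: "l \<in> carrier K" "w \<in> W" "k \<in> carrier K" "a = w \<oplus>\<^bsub>M\<^esub> k \<odot>\<^bsub>M\<^esub> x"
        unfolding X_def by blast
      have "l \<odot>\<^bsub>M\<^esub> a = l \<odot>\<^bsub>M\<^esub> w \<oplus>\<^bsub>M\<^esub> (l \<otimes>\<^bsub>K\<^esub> k) \<odot>\<^bsub>M\<^esub> x"
        using * Wc(2)[of w] x by (simp add: M.smult_r_distr M.smult_assoc1)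
      then show "l \<odot>\<^bsub>M\<^esub> a \<in> X" using XI[of "l \<odot>\<^bsub>M\<^esub> w" "l \<otimes>\<^bsub>K\<^esub> k"] * Wc(7) by auto
    qed
    moreover have "X \<inter> N \<subseteq> {\<zero>\<^bsub>M\<^esub>}"
    proof
      fix a assume a: "a \<in> X \<inter> N"
      then obtain w k where *: "w \<in> W" "k \<in> carrier K" "a = w \<oplus>\<^bsub>M\<^esub> k \<odot>\<^bsub>M\<^esub> x"
        unfolding X_def by blast
      have wc: "w \<in> carrier M" using * Wc(2) by auto
      show "a \<in> {\<zero>\<^bsub>M\<^esub>}"
      proof (cases "k = \<zero>\<^bsub>K\<^esub>")
        case True
        then have "a = w" using * x wc by simp
        then show ?thesis using a * WN by auto
      next
        case False
        then have k: "k \<in> Units K" using * K.field_Units by auto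
        define l where "l = inv\<^bsub>K\<^esub> k"
        have l: "l \<in> carrier K" "l \<otimes>\<^bsub>K\<^esub> k = \<one>\<^bsub>K\<^esub>" using k unfolding l_def by auto
        have "l \<odot>\<^bsub>M\<^esub> a = l \<odot>\<^bsub>M\<^esub> w \<oplus>\<^bsub>M\<^esub> x"
          using * wc x l by (simp add: M.smult_r_distr M.smult_assoc1[symmetric])
        then have "x = l \<odot>\<^bsub>M\<^esub> a \<oplus>\<^bsub>M\<^esub> (\<ominus>\<^bsub>M\<^esub> (l \<odot>\<^bsub>M\<^esub> w))"
          using l wc x by (simp add: M.a_ac M.r_neg2 M.r_neg1 M.r_neg)
        moreover have "l \<odot>\<^bsub>M\<^esub> a \<in> N" "\<ominus>\<^bsub>M\<^esub> (l \<odot>\<^bsub>M\<^esub> w) \<in> W"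
          using a l * Nc(7) Wc(7) Wc(5) by auto
        ultimately show ?thesis using no by blast
      qed
    qed
    ultimately have "X \<in> \<A>" unfolding \<A>_def by simp
    moreover have "W \<subseteq> X"
    proof
      fix w assume "w \<in> W"
      then show "w \<in> X" using XI[of w "\<zero>\<^bsub>K\<^esub>"] Wc(2) x by simp
    qed
    ultimately have "X = W" by (rule max)
    moreover have "x \<in> X" using XI[OF Wc(3) K.one_closed] x by simp
    ultimately have "x \<in> W" by simp
    then show False using no Nc(3) x by (metis M.l_zero)
  qed
  moreover have "W \<inter> N = {\<zero>\<^bsub>M\<^esub>}" using WN Wc(3) Nc(3) by auto
  ultimately show ?thesis using that[OF Ws] by blast
qed

lemma projection_exists:
  assumes K: "field K" and M: "module K M" and N: "submodule N K M"
  obtains e where "linear_map K M M e" "\<And>x. x \<in> carrier M \<Longrightarrow> e x \<in> N" "\<And>x. x \<in> N \<Longrightarrow> e x = x"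
proof -
  interpret M: module K M by fact
  obtain W where W: "submodule W K M" "W \<inter> N = {\<zero>\<^bsub>M\<^esub>}"
    and ex: "\<And>x. x \<in> carrier M \<Longrightarrow> \<exists>n\<in>N. \<exists>w\<in>W. x = n \<oplus>\<^bsub>M\<^esub> w"
    by (rule complement_exists[OF assms]) blast
  note Nc = M.submodule_closed[OF N] and Wc = M.submodule_closed[OF W(1)]
  define e where "e x = (SOME n. n \<in> N \<and> (\<exists>w\<in>W. x = n \<oplus>\<^bsub>M\<^esub> w))" for x
  have uniq: "n = n'" if "n \<in> N" "n' \<in> N" "w \<in> W" "w' \<in> W" "n \<oplus>\<^bsub>M\<^esub> w = n' \<oplus>\<^bsub>M\<^esub> w'" for n n' w w'
  proof -
    have c: "n \<in> carrier M" "n' \<in> carrier M" "w \<in> carrier M" "w' \<in> carrier M" using that Nc Wc by auto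
    have "n \<ominus>\<^bsub>M\<^esub> n' = (n \<oplus>\<^bsub>M\<^esub> w) \<ominus>\<^bsub>M\<^esub> w \<ominus>\<^bsub>M\<^esub> n'"
      using c by (simp add: M.minus_eq M.a_assoc M.r_neg)
    also have "\<dots> = (n' \<oplus>\<^bsub>M\<^esub> w') \<ominus>\<^bsub>M\<^esub> w \<ominus>\<^bsub>M\<^esub> n'" using that(5) by simp
    also have "\<dots> = (n' \<ominus>\<^bsub>M\<^esub> n') \<oplus>\<^bsub>M\<^esub> (w' \<ominus>\<^bsub>M\<^esub> w)"
      using c by (simp add: M.minus_eq M.a_ac)
    also have "\<dots> = w' \<ominus>\<^bsub>M\<^esub> w"
      using c by (simp add: M.minus_eq M.r_neg)
    finally have "n \<ominus>\<^bsub>M\<^esub> n' \<in> W \<inter> N" using Nc(6)[OF that(1,2)] Wc(6)[OF that(4,3)] by auto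
    then have "n \<ominus>\<^bsub>M\<^esub> n' = \<zero>\<^bsub>M\<^esub>" using W(2) by auto
    then show ?thesis using c by (simp add: M.minus_eq_zero_iff)
  qed
  have e: "e x \<in> N" "\<exists>w\<in>W. x = e x \<oplus>\<^bsub>M\<^esub> w" if "x \<in> carrier M" for x
  proof -
    have "e x \<in> N \<and> (\<exists>w\<in>W. x = e x \<oplus>\<^bsub>M\<^esub> w)"
      unfolding e_def by (rule someI_ex) (use ex[OF that] in blast)
    then show "e x \<in> N" "\<exists>w\<in>W. x = e x \<oplus>\<^bsub>M\<^esub> w" by auto
  qed
  have eI: "e x = n" if "n \<in> N" "w \<in> W" "x = n \<oplus>\<^bsub>M\<^esub> w" for x n w
  proof -
    have "x \<in> carrier M" using that Nc Wc by auto
    from e[OF this] obtain w' where w': "e x \<in> N" "w' \<in> W" "x = e x \<oplus>\<^bsub>M\<^esub> w'" by blast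
    show ?thesis by (rule uniq[OF w'(1) that(1) w'(2) that(2)]) (use w'(3) that(3) in simp)
  qed
  have "linear_map K M M e"
  proof (rule linear_mapI)
    show "e x \<in> carrier M" if "x \<in> carrier M" for x using e(1)[OF that] Nc(2) by auto
    fix x y assume x: "x \<in> carrier M" and y: "y \<in> carrier M"
    from e(2)[OF x] e(2)[OF y] obtain w v where wv: "w \<in> W" "v \<in> W" "x = e x \<oplus>\<^bsub>M\<^esub> w" "y = e y \<oplus>\<^bsub>M\<^esub> v" by blast
    have c: "w \<in> carrier M" "v \<in> carrier M" "e x \<in> carrier M" "e y \<in> carrier M"
      using wv Wc(2) Nc(2) e(1) x y by auto
    have "(e x \<oplus>\<^bsub>M\<^esub> w) \<oplus>\<^bsub>M\<^esub> (e y \<oplus>\<^bsub>M\<^esub> v) = (e x \<oplus>\<^bsub>M\<^esub> e y) \<oplus>\<^bsub>M\<^esub> (w \<oplus>\<^bsub>M\<^esub> v)"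
      using c by (simp add: M.a_ac)
    then have "x \<oplus>\<^bsub>M\<^esub> y = (e x \<oplus>\<^bsub>M\<^esub> e y) \<oplus>\<^bsub>M\<^esub> (w \<oplus>\<^bsub>M\<^esub> v)"
      using wv(3,4) by metis
    then show "e (x \<oplus>\<^bsub>M\<^esub> y) = e x \<oplus>\<^bsub>M\<^esub> e y"
      by (rule eI[rotated 2]) (use wv e x y Nc(4) Wc(4) in auto)
  next
    fix k x assume k: "k \<in> carrier K" and x: "x \<in> carrier M"
    from e(2)[OF x] obtain w where w: "w \<in> W" "x = e x \<oplus>\<^bsub>M\<^esub> w" by blast
    have c: "w \<in> carrier M" "e x \<in> carrier M" using w Wc(2) Nc(2) e(1) x by auto
    have "k \<odot>\<^bsub>M\<^esub> (e x \<oplus>\<^bsub>M\<^esub> w) = k \<odot>\<^bsub>M\<^esub> e x \<oplus>\<^bsub>M\<^esub> k \<odot>\<^bsub>M\<^esub> w"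
      using c k by (simp add: M.smult_r_distr)
    then have "k \<odot>\<^bsub>M\<^esub> x = k \<odot>\<^bsub>M\<^esub> e x \<oplus>\<^bsub>M\<^esub> k \<odot>\<^bsub>M\<^esub> w" using w(2) by metis
    then show "e (k \<odot>\<^bsub>M\<^esub> x) = k \<odot>\<^bsub>M\<^esub> e x"
      by (rule eI[rotated 2]) (use w e x k Nc(7) Wc(7) in auto)
  qed
  moreover have "e x = x" if "x \<in> N" for x
    by (rule eI[OF that Wc(3)]) (use that Nc(2) in auto)
  ultimately show ?thesis using that e(1) by blast
qed

text \<open>
  A map \<open>g\<close> with \<open>f g f = f\<close> lets identities such as \<open>(f \<otimes> C)(t) = 0\<close> be solved
  for \<open>t\<close>. It is obtained by projecting to the image of \<open>f\<close> and lifting to a complement of the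
  kernel.
\<close>
lemma generalized_inverse_exists:
  assumes K: "field K" and A: "module K A" and B: "module K B" and f: "linear_map K A B f"
  obtains g where "linear_map K B A g" "\<And>a. a \<in> carrier A \<Longrightarrow> f (g (f a)) = f a"
proof -
  interpret A: module K A by fact
  interpret B: module K B by fact
  note fl = linear_map_closed[OF f] linear_map_add[OF f] linear_map_smult[OF f] linear_map_minus[OF A B f]
  have ker: "submodule {x \<in> carrier A. f x = \<zero>\<^bsub>B\<^esub>} K A" by (rule submodule_kernel[OF A B f])
  obtain e1 where e1: "linear_map K A A e1" "\<And>x. x \<in> carrier A \<Longrightarrow> f (e1 x) = \<zero>\<^bsub>B\<^esub>"
    "\<And>x. x \<in> carrier A \<Longrightarrow> f x = \<zero>\<^bsub>B\<^esub> \<Longrightarrow> e1 x = x"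
    by (rule projection_exists[OF K A ker]) auto
  obtain e2 where e2: "linear_map K B B e2" "\<And>y. y \<in> carrier B \<Longrightarrow> e2 y \<in> f ` carrier A"
    "\<And>y. y \<in> f ` carrier A \<Longrightarrow> e2 y = y"
    by (rule projection_exists[OF K B submodule_image[OF A B f A.carrier_is_submodule]]) auto
  define s where "s a = a \<ominus>\<^bsub>A\<^esub> e1 a" for a
  have s: "linear_map K A A s"
    unfolding s_def using linear_map_diff[OF A A linear_map_id e1(1)] by simp
  note sl = linear_map_closed[OF s] linear_map_add[OF s] linear_map_smult[OF s] linear_map_minus[OF A A s]
  have fs: "f (s a) = f a" if "a \<in> carrier A" for a
    using that e1(2)[OF that] linear_map_closed[OF e1(1) that] fl(1)
    unfolding s_def by (metis fl(4) B.minus_eq B.minus_equality B.r_zero B.zero_closed B.l_zero)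
  have s_eq: "s a = s a'" if "a \<in> carrier A" "a' \<in> carrier A" "f a = f a'" for a a'
  proof -
    have "f (a \<ominus>\<^bsub>A\<^esub> a') = \<zero>\<^bsub>B\<^esub>" using that by (simp add: fl B.minus_eq B.r_neg)
    then have "e1 (a \<ominus>\<^bsub>A\<^esub> a') = a \<ominus>\<^bsub>A\<^esub> a'" using that by (intro e1(3)) auto
    then have "s (a \<ominus>\<^bsub>A\<^esub> a') = \<zero>\<^bsub>A\<^esub>" unfolding s_def using that by (simp add: A.minus_eq A.r_neg)
    then show ?thesis using that by (simp add: sl A.minus_eq_zero_iff)
  qed
  define pre where "pre y = (SOME a. a \<in> carrier A \<and> f a = e2 y)" for y
  have pre: "pre y \<in> carrier A" "f (pre y) = e2 y" if "y \<in> carrier B" for y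
  proof -
    have "pre y \<in> carrier A \<and> f (pre y) = e2 y"
      unfolding pre_def by (rule someI_ex) (use e2(2)[OF that] in auto)
    then show "pre y \<in> carrier A" "f (pre y) = e2 y" by auto
  qed
  have "linear_map K B A (\<lambda>y. s (pre y))"
  proof (rule linear_mapI)
    fix x y assume xy: "x \<in> carrier B" "y \<in> carrier B"
    have "s (pre (x \<oplus>\<^bsub>B\<^esub> y)) = s (pre x \<oplus>\<^bsub>A\<^esub> pre y)"
      by (rule s_eq) (use xy in \<open>auto simp: pre fl linear_map_add[OF e2(1)]\<close>)
    then show "s (pre (x \<oplus>\<^bsub>B\<^esub> y)) = s (pre x) \<oplus>\<^bsub>A\<^esub> s (pre y)" using xy by (simp add: sl pre)
  next
    fix k x assume kx: "k \<in> carrier K" "x \<in> carrier B"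
    have "s (pre (k \<odot>\<^bsub>B\<^esub> x)) = s (k \<odot>\<^bsub>A\<^esub> pre x)"
      by (rule s_eq) (use kx in \<open>auto simp: pre fl linear_map_smult[OF e2(1)]\<close>)
    then show "s (pre (k \<odot>\<^bsub>B\<^esub> x)) = k \<odot>\<^bsub>A\<^esub> s (pre x)" using kx by (simp add: sl pre)
  qed (auto simp: sl pre)
  moreover have "f (s (pre (f a))) = f a" if "a \<in> carrier A" for a
    using that fs[of "pre (f a)"] pre[of "f a"] fl(1) e2(3) by auto
  ultimately show ?thesis using that by blast
qed

text \<open>
  The kernel of \<open>f \<otimes> C\<close> is \<open>ker f \<otimes> C\<close>, in the form that an element of it is fixed by
  \<open>s \<otimes> C\<close> for some \<open>s\<close> with values in \<open>ker f\<close>. With a generalized inverse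
  \<open>g\<close> of \<open>f\<close>, the map \<open>s = id - g f\<close> will do.
\<close>
lemma tensor_kernel:
  assumes K: "field K" and A: "module K A" and B: "module K B" and C: "module K C" and f: "linear_map K A B f"
    and t: "t \<in> carrier (tensor K A C)" and z: "tmap K B C f id t = \<zero>\<^bsub>tensor K B C\<^esub>"
  obtains s where "linear_map K A A s" "\<And>a. a \<in> carrier A \<Longrightarrow> f (s a) = \<zero>\<^bsub>B\<^esub>" "tmap K A C s id t = t"
proof -
  interpret A: module K A by fact
  interpret B: module K B by fact
  interpret C: module K C by fact
  obtain g where g: "linear_map K B A g" "\<And>a. a \<in> carrier A \<Longrightarrow> f (g (f a)) = f a"
    by (rule generalized_inverse_exists[OF K A B f]) auto
  note gf = linear_map_comp[OF f g(1)]
  define s where "s a = a \<ominus>\<^bsub>A\<^esub> g (f a)" for a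
  have s: "linear_map K A A s"
    unfolding s_def using linear_map_diff[OF A A linear_map_id gf] by simp
  have fs: "f (s a) = \<zero>\<^bsub>B\<^esub>" if "a \<in> carrier A" for a
    unfolding s_def using that linear_map_minus[OF A B f that linear_map_closed[OF gf that]] g(2)[OF that]
      linear_map_closed[OF f that] by (simp add: B.minus_eq B.r_neg)
  note AC = tensor_module[OF A C]
  interpret AC: module K "tensor K A C" by fact
  note ts = tmap_linear[OF A C A C s linear_map_id] and tgf = tmap_linear[OF A C A C gf linear_map_id]
  have "tmap K A C s id t \<oplus>\<^bsub>tensor K A C\<^esub> tmap K A C (\<lambda>a. g (f a)) id t = id t"
  proof (rule tensor_linear_eq[OF A C AC linear_map_sum[OF AC AC ts tgf] linear_map_id _ t])
    fix a c assume ac: "a \<in> carrier A" "c \<in> carrier C"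
    have "tmap K A C s id (pure K A C a c) \<oplus>\<^bsub>tensor K A C\<^esub> tmap K A C (\<lambda>a. g (f a)) id (pure K A C a c)
      = pure K A C (s a \<oplus>\<^bsub>A\<^esub> g (f a)) c"
      using ac linear_map_closed[OF s] linear_map_closed[OF gf]
        linear_map_add[OF bilinear_map_left[OF pure_bilinear[OF A C] ac(2)]]
      by (simp add: tmap_pure[OF A C A C s linear_map_id] tmap_pure[OF A C A C gf linear_map_id])
    also have "s a \<oplus>\<^bsub>A\<^esub> g (f a) = a"
      unfolding s_def using ac linear_map_closed[OF gf] by (simp add: A.minus_eq A.a_assoc A.l_neg)
    finally show "tmap K A C s id (pure K A C a c) \<oplus>\<^bsub>tensor K A C\<^esub> tmap K A C (\<lambda>a. g (f a)) id (pure K A C a c)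
      = id (pure K A C a c)" by (simp add: id_def[symmetric])
  qed
  moreover have "tmap K A C (\<lambda>a. g (f a)) id t = \<zero>\<^bsub>tensor K A C\<^esub>"
  proof -
    have "tmap K A C (\<lambda>a. g (f a)) id t = tmap K A C g id (tmap K B C f id t)"
      using tmap_comp[OF A C B C A C f linear_map_id g(1) linear_map_id t] by (simp add: id_def)
    then show ?thesis
      using linear_map_zero[OF tensor_module[OF B C] AC tmap_linear[OF B C A C g(1) linear_map_id]] z by simp
  qed
  ultimately have "tmap K A C s id t = t"
    using linear_map_closed[OF ts t] by simp
  then show ?thesis using that s fs by blast
qed


section \<open>Graded modules\<close>

lemma graded_decompI:
  assumes "module K M" "finite S" "\<And>n. f n \<in> G n" "\<And>n. n \<notin> S \<Longrightarrow> f n = \<zero>\<^bsub>M\<^esub>" "\<And>n. f n \<in> carrier M"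
    and "x = (\<Oplus>\<^bsub>M\<^esub>n\<in>S. f n)"
  shows "graded_decomp M G x f"
proof -
  interpret M: module K M by fact
  have sub: "{n. f n \<noteq> \<zero>\<^bsub>M\<^esub>} \<subseteq> S" using assms(4) by auto
  have "(\<Oplus>\<^bsub>M\<^esub>n\<in>{n. f n \<noteq> \<zero>\<^bsub>M\<^esub>}. f n) = (\<Oplus>\<^bsub>M\<^esub>n\<in>S. f n)"
    by (rule M.M.add.finprod_mono_neutral_cong_left) (use assms sub in auto)
  then show ?thesis
    unfolding graded_decomp_def using assms finite_subset[OF sub] by auto
qed

lemma graded_decomp_sum:
  assumes "module K M" "graded_decomp M G x f" "\<And>n. G n \<subseteq> carrier M" "finite S" "{n. f n \<noteq> \<zero>\<^bsub>M\<^esub>} \<subseteq> S"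
  shows "x = (\<Oplus>\<^bsub>M\<^esub>n\<in>S. f n)"
proof -
  interpret M: module K M by fact
  have "f n \<in> carrier M" for n using assms(2,3) unfolding graded_decomp_def by blast
  then have "(\<Oplus>\<^bsub>M\<^esub>n\<in>{n. f n \<noteq> \<zero>\<^bsub>M\<^esub>}. f n) = (\<Oplus>\<^bsub>M\<^esub>n\<in>S. f n)"
    by (intro M.M.add.finprod_mono_neutral_cong_left) (use assms in auto)
  then show ?thesis using assms(2) unfolding graded_decomp_def by auto
qed

text \<open>
  A decomposition determines the components, so that each property of them is proved by exhibiting
  decompositions.
\<close>
lemma component_eq:
  assumes "graded_module K M G" "x \<in> carrier M" "graded_decomp M G x f"
  shows "component M G n x = f n"
proof -
  have "\<exists>!f. graded_decomp M G x f" using assms(1,2) unfolding graded_module_def by auto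
  from the1_equality[of "graded_decomp M G x", OF this assms(3)] show ?thesis unfolding component_def by simp
qed

lemma graded_module_module: "graded_module K M G \<Longrightarrow> module K M"
  and graded_module_submodule: "graded_module K M G \<Longrightarrow> submodule (G n) K M"
  unfolding graded_module_def by auto

lemma graded_module_carrier: "graded_module K M G \<Longrightarrow> G n \<subseteq> carrier M"
  using module.submodule_subset[OF graded_module_module graded_module_submodule] by blast

lemma graded_decomp_component:
  assumes G: "graded_module K M G" and x: "x \<in> carrier M"
  shows "graded_decomp M G x (\<lambda>n. component M G n x)"
proof -
  obtain f where "graded_decomp M G x f" using assms unfolding graded_module_def by blast
  moreover from this have "(\<lambda>n. component M G n x) = f"
    using component_eq[OF assms] by auto
  ultimately show ?thesis by simp
qed

lemma component_in:
  assumes "graded_module K M G" "x \<in> carrier M"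
  shows "component M G n x \<in> G n"
  using graded_decomp_component[OF assms] unfolding graded_decomp_def by auto

lemma component_homogeneous:
  assumes G: "graded_module K M G" and x: "x \<in> G k"
  shows "component M G n x = (if n = k then x else \<zero>\<^bsub>M\<^esub>)"
proof -
  interpret M: module K M using graded_module_module[OF G] .
  have xc: "x \<in> carrier M" using graded_module_carrier[OF G] x by auto
  have "graded_decomp M G x (\<lambda>n. if n = k then x else \<zero>\<^bsub>M\<^esub>)"
    by (rule graded_decompI[OF M.module_axioms, of "{k}"])
      (use x xc M.submodule_zero[OF graded_module_submodule[OF G]] in auto)
  then show ?thesis by (rule component_eq[OF G xc])
qed

lemma component_linear:
  assumes G: "graded_module K M G"
  shows "linear_map K M M (component M G n)"
proof -
  interpret M: module K M using graded_module_module[OF G] .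
  let ?c = "\<lambda>x n. component M G n x"
  note sub = graded_module_submodule[OF G]
  note car = graded_module_carrier[OF G]
  have cc: "?c x n \<in> carrier M" if "x \<in> carrier M" for x n
    using component_in[OF G that] car by blast
  have fin: "finite {n. ?c x n \<noteq> \<zero>\<^bsub>M\<^esub>}" if "x \<in> carrier M" for x
    using graded_decomp_component[OF G that] unfolding graded_decomp_def by auto
  note ds = graded_decomp_sum[OF M.module_axioms graded_decomp_component[OF G] car]
  show ?thesis
  proof (rule linear_mapI)
    fix x y assume x: "x \<in> carrier M" and y: "y \<in> carrier M"
    let ?S = "{n. ?c x n \<noteq> \<zero>\<^bsub>M\<^esub>} \<union> {n. ?c y n \<noteq> \<zero>\<^bsub>M\<^esub>}"
    have S: "finite ?S" using fin x y by auto
    have "graded_decomp M G (x \<oplus>\<^bsub>M\<^esub> y) (\<lambda>n. ?c x n \<oplus>\<^bsub>M\<^esub> ?c y n)"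
    proof (rule graded_decompI[OF M.module_axioms S])
      have "x \<oplus>\<^bsub>M\<^esub> y = (\<Oplus>\<^bsub>M\<^esub>n\<in>?S. ?c x n) \<oplus>\<^bsub>M\<^esub> (\<Oplus>\<^bsub>M\<^esub>n\<in>?S. ?c y n)"
        using ds[OF x S] ds[OF y S] by auto
      also have "\<dots> = (\<Oplus>\<^bsub>M\<^esub>n\<in>?S. ?c x n \<oplus>\<^bsub>M\<^esub> ?c y n)"
        by (rule M.finsum_addf[symmetric]) (use cc x y in auto)
      finally show "x \<oplus>\<^bsub>M\<^esub> y = (\<Oplus>\<^bsub>M\<^esub>n\<in>?S. ?c x n \<oplus>\<^bsub>M\<^esub> ?c y n)" .
    qed (use x y cc component_in[OF G] M.submodule_add[OF sub] in auto)
    then show "component M G n (x \<oplus>\<^bsub>M\<^esub> y) = component M G n x \<oplus>\<^bsub>M\<^esub> component M G n y"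
      using component_eq[OF G] x y by auto
  next
    fix k x assume k: "k \<in> carrier K" and x: "x \<in> carrier M"
    let ?S = "{n. ?c x n \<noteq> \<zero>\<^bsub>M\<^esub>}"
    have S: "finite ?S" using fin x by auto
    have "graded_decomp M G (k \<odot>\<^bsub>M\<^esub> x) (\<lambda>n. k \<odot>\<^bsub>M\<^esub> ?c x n)"
    proof (rule graded_decompI[OF M.module_axioms S])
      have "k \<odot>\<^bsub>M\<^esub> x = k \<odot>\<^bsub>M\<^esub> (\<Oplus>\<^bsub>M\<^esub>n\<in>?S. ?c x n)"
        using ds[OF x S] by simp
      also have "\<dots> = (\<Oplus>\<^bsub>M\<^esub>n\<in>?S. k \<odot>\<^bsub>M\<^esub> ?c x n)"
        by (rule M.finsum_smult_ldistr) (use cc x k S in auto)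
      finally show "k \<odot>\<^bsub>M\<^esub> x = (\<Oplus>\<^bsub>M\<^esub>n\<in>?S. k \<odot>\<^bsub>M\<^esub> ?c x n)" .
    qed (use x k cc component_in[OF G] M.submodule_smult[OF sub] in auto)
    then show "component M G n (k \<odot>\<^bsub>M\<^esub> x) = k \<odot>\<^bsub>M\<^esub> component M G n x"
      using component_eq[OF G] x k by auto
  qed (use cc in auto)
qed

section \<open>The product and the coproduct of the braided tensor algebra\<close>

text \<open>
  The image of \<open>X \<otimes> Y\<close> in \<open>A \<otimes> B\<close>, for subspaces \<open>X\<close> and \<open>Y\<close>.
\<close>
definition tens_span ::
    "('k,'r) ring_scheme \<Rightarrow> ('k,'a,'m) module_scheme \<Rightarrow> ('k,'b,'n) module_scheme \<Rightarrow> 'a set \<Rightarrow> 'b set \<Rightarrow>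
     ('a \<times> 'b \<Rightarrow> 'k) set" where
  "tens_span K A B X Y = mspan K (tensor K A B) {pure K A B x y | x y. x \<in> X \<and> y \<in> Y}"

lemma tens_span_linear:
  assumes "module K A" "module K B" "module K P" "linear_map K (tensor K A B) P f" "submodule H K P"
    and "X \<subseteq> carrier A" "Y \<subseteq> carrier B" "\<And>x y. x \<in> X \<Longrightarrow> y \<in> Y \<Longrightarrow> f (pure K A B x y) \<in> H"
    and "t \<in> tens_span K A B X Y"
  shows "f t \<in> H"
  by (rule linear_map_mspan[OF tensor_module[OF assms(1,2)] assms(3-5),
        of "{pure K A B x y | x y. x \<in> X \<and> y \<in> Y}"])
    (use assms(6-9) pure_closed[OF assms(1,2)] in \<open>auto simp: tens_span_def subset_iff\<close>)

lemma tens_span_zero: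
  assumes "module K A" "module K B" "module K P" "linear_map K (tensor K A B) P f"
    and "X \<subseteq> carrier A" "Y \<subseteq> carrier B" "\<And>x y. x \<in> X \<Longrightarrow> y \<in> Y \<Longrightarrow> f (pure K A B x y) = \<zero>\<^bsub>P\<^esub>"
    and "t \<in> tens_span K A B X Y"
  shows "f t = \<zero>\<^bsub>P\<^esub>"
  using tens_span_linear[OF assms(1-4) module.zero_submodule[OF assms(3)] assms(5,6) _ assms(8)] assms(7) by auto

lemma tens_span_eq:
  assumes "module K A" "module K B" "module K P" "linear_map K (tensor K A B) P f" "linear_map K (tensor K A B) P g"
    and "X \<subseteq> carrier A" "Y \<subseteq> carrier B" "\<And>x y. x \<in> X \<Longrightarrow> y \<in> Y \<Longrightarrow> f (pure K A B x y) = g (pure K A B x y)"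
    and "t \<in> tens_span K A B X Y"
  shows "f t = g t"
  by (rule linear_map_eq_on_mspan[OF tensor_module[OF assms(1,2)] assms(3-5),
        of "{pure K A B x y | x y. x \<in> X \<and> y \<in> Y}"])
    (use assms(6-9) pure_closed[OF assms(1,2)] in \<open>auto simp: tens_span_def subset_iff\<close>)

lemma tens_span_submodule:
  assumes "module K A" "module K B" "X \<subseteq> carrier A" "Y \<subseteq> carrier B"
  shows "submodule (tens_span K A B X Y) K (tensor K A B)"
  unfolding tens_span_def
  by (rule module.mspan_submodule[OF tensor_module[OF assms(1,2)]])
    (use assms(3,4) pure_closed[OF assms(1,2)] in \<open>auto simp: subset_iff\<close>)

lemma pure_tens_span: "x \<in> X \<Longrightarrow> y \<in> Y \<Longrightarrow> pure K A B x y \<in> tens_span K A B X Y"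
  unfolding tens_span_def by (rule mspan_superset) auto

lemma pure_zero:
  assumes A: "module K A" and B: "module K B"
  shows pure_zero_left: "b \<in> carrier B \<Longrightarrow> pure K A B \<zero>\<^bsub>A\<^esub> b = \<zero>\<^bsub>tensor K A B\<^esub>"
    and pure_zero_right: "a \<in> carrier A \<Longrightarrow> pure K A B a \<zero>\<^bsub>B\<^esub> = \<zero>\<^bsub>tensor K A B\<^esub>"
  using linear_map_zero[OF A tensor_module[OF A B] bilinear_map_left[OF pure_bilinear[OF A B]]]
    linear_map_zero[OF B tensor_module[OF A B] bilinear_map_right[OF pure_bilinear[OF A B]]] by auto

lemma mult_map:
  assumes A: "assoc_algebra K A"
  shows mult_map_linear: "linear_map K (tensor K A A) A (mult_map K A)"
    and mult_map_pure: "x \<in> carrier A \<Longrightarrow> y \<in> carrier A \<Longrightarrow> mult_map K A (pure K A A x y) = x \<otimes>\<^bsub>A\<^esub> y"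
  unfolding mult_map_def
  using tensor_universal[OF assoc_algebra_module[OF A] assoc_algebra_module[OF A] assoc_algebra_module[OF A]
      assoc_algebra_mult_bilinear[OF A]] by auto

text \<open>
  The equality criterion on words, applied to the composite with the projection modulo \<open>H\<close>.
\<close>
lemma tensor_alg_linear_mem:
  assumes M: "module K M" and P: "module K P" and f: "linear_map K (tensor_alg K M) P f" and H: "submodule H K P"
    and mem: "\<And>w. w \<in> lists (carrier M) \<Longrightarrow> f (tensor_word K M w) \<in> H"
    and t: "t \<in> carrier (tensor_alg K M)"
  shows "f t \<in> H"
proof -
  interpret P: module K P by fact
  note Q = P.quot_module[OF H]
  have "coset_rep P H (f t) = \<zero>\<^bsub>quot P H\<^esub>"
    by (rule tensor_alg_linear_eq[OF M Q linear_map_comp[OF f P.coset_rep_linear[OF H]]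
          linear_map_const_zero[OF Q] _ t])
      (use mem P.coset_rep_eq_zero_iff[OF H] P.submodule_carrier[OF H] in auto)
  then show ?thesis using P.coset_rep_eq_zero_iff[OF H linear_map_closed[OF f t]] by simp
qed

lemma braid12:
  assumes V: "module K V" and c: "linear_map K (tensor K V V) (tensor K V V) c"
  shows braid12_linear: "linear_map K (tensor K (tensor K V V) V) (tensor K (tensor K V V) V) (braid12 K V c)"
    and braid12_pure: "u \<in> carrier (tensor K V V) \<Longrightarrow> z \<in> carrier V \<Longrightarrow>
      braid12 K V c (pure K (tensor K V V) V u z) = pure K (tensor K V V) V (c u) z"
proof -
  note VV = tensor_module[OF V V]
  show "linear_map K (tensor K (tensor K V V) V) (tensor K (tensor K V V) V) (braid12 K V c)"
    unfolding braid12_def by (rule tmap_linear[OF VV V VV V c linear_map_id])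
  show "u \<in> carrier (tensor K V V) \<Longrightarrow> z \<in> carrier V \<Longrightarrow>
      braid12 K V c (pure K (tensor K V V) V u z) = pure K (tensor K V V) V (c u) z"
    unfolding braid12_def using tmap_pure[OF VV V VV V c linear_map_id] by simp
qed

lemma braid23:
  assumes V: "module K V" and c: "linear_map K (tensor K V V) (tensor K V V) c"
  shows braid23_linear: "linear_map K (tensor K (tensor K V V) V) (tensor K (tensor K V V) V) (braid23 K V c)"
    and braid23_pure: "x \<in> carrier V \<Longrightarrow> y \<in> carrier V \<Longrightarrow> z \<in> carrier V \<Longrightarrow>
      braid23 K V c (pure K (tensor K V V) V (pure K V V x y) z) =
        assoc_l K V V V (pure K V (tensor K V V) x (c (pure K V V y z)))"
proof -
  note VV = tensor_module[OF V V]
  note tl = tmap_linear[OF V VV V VV linear_map_id c]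
  show "linear_map K (tensor K (tensor K V V) V) (tensor K (tensor K V V) V) (braid23 K V c)"
    unfolding braid23_def
    using linear_map_comp[OF linear_map_comp[OF assoc_r_linear[OF V V V] tl] assoc_l_linear[OF V V V]]
    by (simp add: comp_def)
  show "x \<in> carrier V \<Longrightarrow> y \<in> carrier V \<Longrightarrow> z \<in> carrier V \<Longrightarrow>
      braid23 K V c (pure K (tensor K V V) V (pure K V V x y) z) =
        assoc_l K V V V (pure K V (tensor K V V) x (c (pure K V V y z)))"
    unfolding braid23_def
    using assoc_r_pure[OF V V V] tmap_pure[OF V VV V VV linear_map_id c] pure_closed[OF V V] by simp
qed

locale braided_tensor_alg =
  fixes K :: "('k,'r) ring_scheme"
    and V :: "('k,'v,'m) module_scheme"
    and c :: "('v \<times> 'v \<Rightarrow> 'k) \<Rightarrow> ('v \<times> 'v \<Rightarrow> 'k)"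
    and T :: "('k, 'v list \<Rightarrow> 'k) braided_bialg"
  assumes K: "field K" and V: "module K V" and T: "braided_tensor_algebra K V c T"
begin

abbreviation TT where "TT \<equiv> tensor K T T"
abbreviation pr where "pr \<equiv> component T (grading T)"
abbreviation m where "m \<equiv> mult_map K T"
abbreviation pu where "pu \<equiv> pure K T T"
abbreviation tm where "tm \<equiv> tmap K T T"
abbreviation \<Delta> where "\<Delta> \<equiv> comult_comp K T"
abbreviation \<Gamma> where "\<Gamma> \<equiv> Gamma K T"
abbreviation G where "G \<equiv> grading T"
abbreviation times_T (infixl "\<cdot>" 70) where "x \<cdot> y \<equiv> x \<otimes>\<^bsub>T\<^esub> y"

lemma T_tensor_alg:
  shows carrier_T: "carrier T = carrier (tensor_alg K V)"
    and mult_T: "mult T = mult (tensor_alg K V)"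
    and one_T: "\<one>\<^bsub>T\<^esub> = \<one>\<^bsub>tensor_alg K V\<^esub>"
    and add_T: "add T = add (tensor_alg K V)"
    and smult_T: "smult T = smult (tensor_alg K V)"
proof -
  have "module.truncate T = tensor_alg K V"
    using T by (simp add: braided_tensor_algebra_def Let_def)
  from this[symmetric] show "carrier T = carrier (tensor_alg K V)" "mult T = mult (tensor_alg K V)"
    "\<one>\<^bsub>T\<^esub> = \<one>\<^bsub>tensor_alg K V\<^esub>"
    "add T = add (tensor_alg K V)" "smult T = smult (tensor_alg K V)"
    by (simp_all add: module.truncate_def)
qed

lemma grading_T: "G = tensor_power K V"
  and graded_braided_bialgebra_T: "graded_braided_bialgebra K T"
  and braided_bialgebra_T: "braided_bialgebra K T"
  and graded_algebra_T: "graded_algebra K T G"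
  using T unfolding braided_tensor_algebra_def graded_braided_bialgebra_def Let_def by blast+

lemma algebra_T: "assoc_algebra K T"
  and graded_T: "graded_module K T G"
  and one_G: "\<one>\<^bsub>T\<^esub> \<in> G 0"
  and mult_G: "x \<in> G a \<Longrightarrow> y \<in> G b \<Longrightarrow> x \<cdot> y \<in> G (a + b)"
  using graded_algebra_T unfolding graded_algebra_def by blast+

lemma module_T: "module K T" by (rule assoc_algebra_module[OF algebra_T])
lemma module_TT: "module K TT" by (rule tensor_module[OF module_T module_T])

sublocale TM: module K T by (rule module_T)
sublocale TR: ring T by (rule assoc_algebra_ring[OF algebra_T])
sublocale TTM: module K TT by (rule module_TT)

lemmas mult_bilinear = assoc_algebra_mult_bilinear[OF algebra_T]
lemmas mult_right_linear = bilinear_map_right[OF mult_bilinear]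
lemmas mult_left_linear = bilinear_map_left[OF mult_bilinear]
lemmas m_linear = mult_map_linear[OF algebra_T]
lemmas m_pure = mult_map_pure[OF algebra_T]
lemmas pu_bilinear = pure_bilinear[OF module_T module_T]
lemmas pu_closed = pure_closed[OF module_T module_T]
lemmas tm_linear = tmap_linear[OF module_T module_T module_T module_T]
lemmas tm_pure = tmap_pure[OF module_T module_T module_T module_T]
lemmas tm_comp = tmap_comp[OF module_T module_T module_T module_T module_T module_T]
lemmas pr_linear = component_linear[OF graded_T]
lemmas pr_in = component_in[OF graded_T]
lemmas pr_G = component_homogeneous[OF graded_T]
lemmas G_carrier = graded_module_carrier[OF graded_T]
lemmas G_submodule = graded_module_submodule[OF graded_T]
lemmas pu_zero = pure_zero[OF module_T module_T]
lemmas span_linear = tens_span_linear[OF module_T module_T]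
lemmas span_zero = tens_span_zero[OF module_T module_T]
lemmas span_eq = tens_span_eq[OF module_T module_T]
lemmas TT_eq = tensor_linear_eq[OF module_T module_T]

lemma in_G: "x \<in> G n \<Longrightarrow> x \<in> carrier T"
  using G_carrier by auto

lemma linear_T: "linear_map K T P f = linear_map K (tensor_alg K V) P f"
  by (rule linear_map_cong_carrier[OF carrier_T add_T smult_T])

lemma word_T: "w \<in> lists (carrier V) \<Longrightarrow> tensor_word K V w \<in> carrier T"
  using tensor_word_closed[OF V] by (simp add: carrier_T)

lemma word_append: "u \<in> lists (carrier V) \<Longrightarrow> v \<in> lists (carrier V) \<Longrightarrow>
    tensor_word K V (u @ v) = tensor_word K V u \<cdot> tensor_word K V v"
  using tensor_word_append[OF V] by (simp add: mult_T)

lemma word_G: "w \<in> lists (carrier V) \<Longrightarrow> tensor_word K V w \<in> G (length w)"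
  using tensor_power_word[OF V] by (simp add: grading_T)

lemma T_linear_eq:
  assumes "module K P" "linear_map K T P f" "linear_map K T P g"
    and "\<And>w. w \<in> lists (carrier V) \<Longrightarrow> f (tensor_word K V w) = g (tensor_word K V w)" "t \<in> carrier T"
  shows "f t = g t"
  using tensor_alg_linear_eq[OF V assms(1)] assms(2-5) by (simp add: linear_T carrier_T)

lemma T_linear_mem:
  assumes "module K P" "linear_map K T P f" "submodule H K P"
    and "\<And>w. w \<in> lists (carrier V) \<Longrightarrow> f (tensor_word K V w) \<in> H" "t \<in> carrier T"
  shows "f t \<in> H"
  using tensor_alg_linear_mem[OF V assms(1) _ assms(3)] assms(2,4,5) by (simp add: linear_T carrier_T)

lemma G_linear:
  assumes "module K P" "linear_map K T P f" "submodule H K P"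
    and "\<And>w. w \<in> lists (carrier V) \<Longrightarrow> length w = n \<Longrightarrow> f (tensor_word K V w) \<in> H" "t \<in> G n"
  shows "f t \<in> H"
  using tensor_power_linear[OF V assms(1) _ assms(3), of f n t] assms(2,4,5) by (simp add: linear_T grading_T)

lemma G_linear_eq:
  assumes P: "module K P" and f: "linear_map K T P f" and g: "linear_map K T P g"
    and eq: "\<And>w. w \<in> lists (carrier V) \<Longrightarrow> length w = n \<Longrightarrow> f (tensor_word K V w) = g (tensor_word K V w)"
    and t: "t \<in> G n"
  shows "f t = g t"
proof -
  interpret P: module K P by fact
  have "f t \<ominus>\<^bsub>P\<^esub> g t \<in> {\<zero>\<^bsub>P\<^esub>}"
    by (rule G_linear[OF P linear_map_diff[OF module_T P f g] P.zero_submodule _ t])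
      (use eq linear_map_closed[OF g] word_T in \<open>auto simp: P.minus_eq_zero_iff\<close>)
  then show ?thesis
    using P.minus_eq_zero_iff linear_map_closed[OF f] linear_map_closed[OF g] in_G[OF t] by simp
qed


lemma comult_T:
  shows D_linear: "linear_map K T TT (comult T)"
    and D_mult: "t \<in> carrier TT \<Longrightarrow> comult T (m t) =
      tm m m (middle_braid K T (braiding T) (tmap K TT TT (comult T) (comult T) t))"
    and counit_right_D: "x \<in> carrier T \<Longrightarrow> counit_right K T (comult T x) = x"
    and D_braid: "t \<in> carrier TT \<Longrightarrow> tmap K TT T (comult T) id (braiding T t) =
      braid23 K T (braiding T) (braid12 K T (braiding T) (assoc_l K T T T (tmap K T TT id (comult T) t)))"
proof -
  note b = braided_bialgebra_T[unfolded braided_bialgebra_def Let_def]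
  note co = b[THEN conjunct2, THEN conjunct1, unfolded braided_coalgebra_def Let_def, THEN conjunct2]
  show "linear_map K T TT (comult T)" by (rule co[THEN conjunct1])
  show "comult T (m t) =
      tm m m (middle_braid K T (braiding T) (tmap K TT TT (comult T) (comult T) t))" if "t \<in> carrier TT"
    by (rule b[THEN conjunct2, THEN conjunct2, THEN conjunct1, THEN bspec, OF that])
  note co5 = co[THEN conjunct2, THEN conjunct2, THEN conjunct2, THEN conjunct2]
  show "counit_right K T (comult T x) = x" if "x \<in> carrier T"
    by (rule co5[THEN conjunct1, THEN bspec, OF that, THEN conjunct2, THEN conjunct2])
  show "tmap K TT T (comult T) id (braiding T t) =
      braid23 K T (braiding T) (braid12 K T (braiding T) (assoc_l K T T T (tmap K T TT id (comult T) t)))"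
    if "t \<in> carrier TT"
    by (rule co5[THEN conjunct2, THEN bspec, OF that, THEN conjunct1])
qed

lemma counit_T:
  shows counit_closed: "x \<in> carrier T \<Longrightarrow> counit T x \<in> carrier K"
    and counit_add: "x \<in> carrier T \<Longrightarrow> y \<in> carrier T \<Longrightarrow> counit T (x \<oplus>\<^bsub>T\<^esub> y) = counit T x \<oplus>\<^bsub>K\<^esub> counit T y"
    and counit_smult: "k \<in> carrier K \<Longrightarrow> x \<in> carrier T \<Longrightarrow> counit T (k \<odot>\<^bsub>T\<^esub> x) = k \<otimes>\<^bsub>K\<^esub> counit T x"
    and counit_one: "counit T \<one>\<^bsub>T\<^esub> = \<one>\<^bsub>K\<^esub>"
    and counit_pos: "n > 0 \<Longrightarrow> x \<in> G n \<Longrightarrow> counit T x = \<zero>\<^bsub>K\<^esub>"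
proof -
  note b = braided_bialgebra_T[unfolded braided_bialgebra_def Let_def]
  note co = b[THEN conjunct2, THEN conjunct1, unfolded braided_coalgebra_def Let_def, THEN conjunct2, THEN conjunct2]
  show "counit T x \<in> carrier K" if "x \<in> carrier T"
    using co[THEN conjunct1] that by (rule funcset_mem)
  show "counit T (x \<oplus>\<^bsub>T\<^esub> y) = counit T x \<oplus>\<^bsub>K\<^esub> counit T y" if "x \<in> carrier T" "y \<in> carrier T"
    by (rule co[THEN conjunct2, THEN conjunct1, THEN bspec, OF that(1), THEN bspec, OF that(2)])
  show "counit T (k \<odot>\<^bsub>T\<^esub> x) = k \<otimes>\<^bsub>K\<^esub> counit T x" if "k \<in> carrier K" "x \<in> carrier T"
    by (rule co[THEN conjunct2, THEN conjunct2, THEN conjunct1, THEN bspec, OF that(1), THEN bspec, OF that(2)])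
  show "counit T \<one>\<^bsub>T\<^esub> = \<one>\<^bsub>K\<^esub>"
    by (rule b[THEN conjunct2, THEN conjunct2, THEN conjunct2, THEN conjunct2, THEN conjunct1])
  note g = graded_braided_bialgebra_T[unfolded graded_braided_bialgebra_def Let_def]
  show "counit T x = \<zero>\<^bsub>K\<^esub>" if "n > 0" "x \<in> G n"
    by (rule g[THEN conjunct2, THEN conjunct2, THEN conjunct2, THEN conjunct2, rule_format, OF that])
qed

lemma braiding_T:
  shows br_linear: "linear_map K TT TT (braiding T)"
    and br_one_left: "x \<in> carrier T \<Longrightarrow> braiding T (pu \<one>\<^bsub>T\<^esub> x) = pu x \<one>\<^bsub>T\<^esub>"
    and br_one_right: "x \<in> carrier T \<Longrightarrow> braiding T (pu x \<one>\<^bsub>T\<^esub>) = pu \<one>\<^bsub>T\<^esub> x"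
proof -
  note a = braided_bialgebra_T[unfolded braided_bialgebra_def Let_def, THEN conjunct1,
      unfolded braided_algebra_def Let_def, THEN conjunct2]
  show "linear_map K TT TT (braiding T)"
    by (rule a[THEN conjunct1, unfolded braided_vector_space_def, THEN conjunct2, THEN conjunct1])
  note o = a[THEN conjunct2, THEN conjunct2, THEN bspec]
  show "braiding T (pu \<one>\<^bsub>T\<^esub> x) = pu x \<one>\<^bsub>T\<^esub>" if "x \<in> carrier T"
    by (rule o[OF that, THEN conjunct1])
  show "braiding T (pu x \<one>\<^bsub>T\<^esub>) = pu \<one>\<^bsub>T\<^esub> x" if "x \<in> carrier T"
    by (rule o[OF that, THEN conjunct2])
qed

lemma br_G:
  assumes "x \<in> G a" "y \<in> G b"
  shows "braiding T (pu x y) \<in> tens_span K T T (G b) (G a)"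
proof -
  have "braiding T ` mspan K TT {pu x y | x y. x \<in> G a \<and> y \<in> G b} \<subseteq> mspan K TT {pu x y | x y. x \<in> G b \<and> y \<in> G a}"
    by (rule graded_braided_bialgebra_T[unfolded graded_braided_bialgebra_def Let_def, THEN conjunct2, THEN conjunct2,
          THEN conjunct2, THEN conjunct1, rule_format])
  moreover have "pu x y \<in> mspan K TT {pu x y | x y. x \<in> G a \<and> y \<in> G b}"
    by (rule mspan_superset) (use assms in auto)
  ultimately show ?thesis unfolding tens_span_def by blast
qed

lemma D_G_linear_eq:
  assumes P: "module K P" and f: "linear_map K TT P f" and g: "linear_map K TT P g" and x: "x \<in> G n"
    and eq: "\<And>a b y z. a + b = n \<Longrightarrow> y \<in> G a \<Longrightarrow> z \<in> G b \<Longrightarrow> f (pu y z) = g (pu y z)"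
  shows "f (comult T x) = g (comult T x)"
proof -
  let ?S = "\<Union>{{pu y z | y z. y \<in> G a \<and> z \<in> G b} | a b. a + b = n}"
  have "comult T x \<in> mspan K TT ?S"
    by (rule graded_braided_bialgebra_T[unfolded graded_braided_bialgebra_def Let_def, THEN conjunct2, THEN conjunct2,
          THEN conjunct1, rule_format, OF x])
  moreover have S: "\<exists>a b y z. t = pu y z \<and> a + b = n \<and> y \<in> G a \<and> z \<in> G b" if "t \<in> ?S" for t
    using that by auto
  moreover have "?S \<subseteq> carrier TT"
  proof
    fix t assume "t \<in> ?S"
    from S[OF this] obtain a b y z where "t = pu y z" "y \<in> G a" "z \<in> G b" by (elim exE conjE)
    then show "t \<in> carrier TT" using pu_closed[OF in_G in_G] by simp
  qed
  moreover have "f t = g t" if t: "t \<in> ?S" for t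
    using S[OF t] by (elim exE conjE) (simp add: eq)
  ultimately show ?thesis
    by (intro linear_map_eq_on_mspan[OF module_TT P f g, of ?S "comult T x"])
qed

lemma \<Delta>_linear: "linear_map K T TT (\<Delta> a b)"
  unfolding comult_comp_def
  by (rule linear_map_comp[OF D_linear tm_linear[OF pr_linear pr_linear]])

text \<open>
  \<open>T\<^sup>0\<close> is spanned by the empty word, which is the unit.
\<close>
lemma degree_zero:
  assumes "x \<in> G 0"
  shows "x = counit T x \<odot>\<^bsub>T\<^esub> \<one>\<^bsub>T\<^esub>"
proof (rule G_linear_eq[OF module_T linear_map_id[unfolded id_def] _ _ assms])
  show "linear_map K T T (\<lambda>x. counit T x \<odot>\<^bsub>T\<^esub> \<one>\<^bsub>T\<^esub>)"
    by (rule linear_mapI)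
      (auto simp: counit_closed counit_add counit_smult TM.smult_l_distr TM.smult_assoc1)
  show "tensor_word K V w = counit T (tensor_word K V w) \<odot>\<^bsub>T\<^esub> \<one>\<^bsub>T\<^esub>" if "w \<in> lists (carrier V)" "length w = 0" for w
    using that by (simp add: tensor_word_Nil[OF V] one_T[symmetric] counit_one)
qed

text \<open>
  The counit vanishes in positive degrees, so \<open>pr 0\<close> is \<open>b \<mapsto> \<epsilon>(b) 1\<close> and the claim becomes the
  counit axiom.
\<close>
lemma \<Delta>_zero_right:
  assumes "x \<in> carrier T"
  shows "\<Delta> n 0 x = pu (pr n x) \<one>\<^bsub>T\<^esub>"
proof -
  have bil: "bilinear_map K T T T (\<lambda>x y. counit T y \<odot>\<^bsub>T\<^esub> x)"
  proof (intro bilinear_mapI linear_mapI)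
    fix k x y assume "k \<in> carrier K" "x \<in> carrier T" "y \<in> carrier T"
    then show "counit T y \<odot>\<^bsub>T\<^esub> (k \<odot>\<^bsub>T\<^esub> x) = k \<odot>\<^bsub>T\<^esub> (counit T y \<odot>\<^bsub>T\<^esub> x)"
      using TM.m_comm[of k "counit T y"] by (simp add: counit_closed TM.smult_assoc1[symmetric])
  qed (auto simp: counit_closed counit_add counit_smult TM.smult_l_distr TM.smult_r_distr TM.smult_assoc1)
  note cr = tlift_linear[OF module_T module_T module_T bil] tlift_pure[OF module_T module_T module_T bil]
  have "tm (pr n) (pr 0) t = pu (pr n (counit_right K T t)) \<one>\<^bsub>T\<^esub>" if t: "t \<in> carrier TT" for t
    unfolding counit_right_def
  proof (rule TT_eq[OF module_TT tm_linear[OF pr_linear pr_linear] _ _ t])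
    show "linear_map K TT TT (\<lambda>t. pu (pr n (tlift K T (\<lambda>x y. counit T y \<odot>\<^bsub>T\<^esub> x) t)) \<one>\<^bsub>T\<^esub>)"
      using linear_map_comp[OF linear_map_comp[OF cr(1) pr_linear] bilinear_map_left[OF pu_bilinear TR.one_closed]] .
    fix a b assume ab: "a \<in> carrier T" "b \<in> carrier T"
    have p0: "pr 0 b = counit T b \<odot>\<^bsub>T\<^esub> \<one>\<^bsub>T\<^esub>"
    proof -
      have z: "linear_map K T T (\<lambda>x. counit T x \<odot>\<^bsub>T\<^esub> \<one>\<^bsub>T\<^esub>)"
        by (rule linear_mapI)
          (auto simp: counit_closed counit_add counit_smult TM.smult_l_distr TM.smult_assoc1)
      have "pr 0 b \<ominus>\<^bsub>T\<^esub> counit T b \<odot>\<^bsub>T\<^esub> \<one>\<^bsub>T\<^esub> = \<zero>\<^bsub>T\<^esub>"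
      proof (rule T_linear_eq[OF module_T linear_map_diff[OF module_T module_T pr_linear z]
            linear_map_const_zero[OF module_T] _ ab(2)])
        fix w assume w: "w \<in> lists (carrier V)"
        note wG = word_G[OF w]
        show "pr 0 (tensor_word K V w) \<ominus>\<^bsub>T\<^esub> counit T (tensor_word K V w) \<odot>\<^bsub>T\<^esub> \<one>\<^bsub>T\<^esub> = \<zero>\<^bsub>T\<^esub>"
        proof (cases "length w = 0")
          case True
          then have "tensor_word K V w \<in> G 0" using wG by simp
          from degree_zero[OF this] pr_G[OF this, of 0] word_T[OF w] show ?thesis
            by (simp add: TM.minus_eq_zero_iff counit_closed)
        next
          case False
          then show ?thesis using counit_pos[OF _ wG] pr_G[OF wG, of 0]
            by (simp add: TM.minus_eq_zero_iff)
        qed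
      qed
      then show ?thesis using ab linear_map_closed[OF pr_linear] by (simp add: TM.minus_eq_zero_iff counit_closed)
    qed
    have "tm (pr n) (pr 0) (pu a b) = pu (pr n a) (counit T b \<odot>\<^bsub>T\<^esub> \<one>\<^bsub>T\<^esub>)"
      using ab by (simp add: tm_pure[OF pr_linear pr_linear] p0)
    also have "\<dots> = pu (counit T b \<odot>\<^bsub>T\<^esub> pr n a) \<one>\<^bsub>T\<^esub>"
      using linear_map_smult[OF bilinear_map_left[OF pu_bilinear]] linear_map_smult[OF bilinear_map_right[OF pu_bilinear]]
        ab linear_map_closed[OF pr_linear] by (simp add: counit_closed)
    also have "\<dots> = pu (pr n (tlift K T (\<lambda>x y. counit T y \<odot>\<^bsub>T\<^esub> x) (pu a b))) \<one>\<^bsub>T\<^esub>"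
      using ab by (simp add: cr(2) linear_map_smult[OF pr_linear] counit_closed)
    finally show "tm (pr n) (pr 0) (pu a b) = pu (pr n (tlift K T (\<lambda>x y. counit T y \<odot>\<^bsub>T\<^esub> x) (pu a b))) \<one>\<^bsub>T\<^esub>" .
  qed
  then show ?thesis
    unfolding comult_comp_def using linear_map_closed[OF D_linear assms] counit_right_D[OF assms] by simp
qed

text \<open>
  The coproduct is only ever needed modulo terms whose right factor has degree at least 2. What remains is
  the component of bidegree \<open>(n, 1)\<close> and the trivial term \<open>x \<otimes> 1\<close>.
\<close>
lemma D_split:
  assumes P: "module K P" and f: "linear_map K TT P f" and x: "x \<in> G (Suc n)"
    and z: "\<And>a b y z. a + b = Suc n \<Longrightarrow> b \<ge> 2 \<Longrightarrow> y \<in> G a \<Longrightarrow> z \<in> G b \<Longrightarrow> f (pu y z) = \<zero>\<^bsub>P\<^esub>"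
  shows "f (comult T x) = f (\<Delta> n 1 x) \<oplus>\<^bsub>P\<^esub> f (pu x \<one>\<^bsub>T\<^esub>)"
proof -
  interpret P: module K P by fact
  note t1 = tm_linear[OF pr_linear pr_linear]
  note fz = linear_map_zero[OF module_TT P f] and fc = linear_map_closed[OF f]
  have "f (comult T x) = f (tm (pr n) (pr 1) (comult T x)) \<oplus>\<^bsub>P\<^esub> f (tm (pr (Suc n)) (pr 0) (comult T x))"
  proof (rule D_G_linear_eq[OF P f _ x])
    show "linear_map K TT P (\<lambda>t. f (tm (pr n) (pr 1) t) \<oplus>\<^bsub>P\<^esub> f (tm (pr (Suc n)) (pr 0) t))"
      by (rule linear_map_sum[OF module_TT P linear_map_comp[OF t1 f] linear_map_comp[OF t1 f]])
    fix a b y v assume ab: "a + b = Suc n" and y: "y \<in> G a" and v: "v \<in> G b"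
    note yv = in_G[OF y] in_G[OF v]
    have "tm (pr n) (pr 1) (pu y v) = (if b = 1 then pu y v else \<zero>\<^bsub>TT\<^esub>)"
      using ab yv by (auto simp: tm_pure[OF pr_linear pr_linear] pr_G[OF y] pr_G[OF v] pu_zero)
    moreover have "tm (pr (Suc n)) (pr 0) (pu y v) = (if b = 0 then pu y v else \<zero>\<^bsub>TT\<^esub>)"
      using ab yv by (auto simp: tm_pure[OF pr_linear pr_linear] pr_G[OF y] pr_G[OF v] pu_zero)
    moreover have "b = 0 \<or> b = 1 \<or> b \<ge> 2" by auto
    ultimately show "f (pu y v) = f (tm (pr n) (pr 1) (pu y v)) \<oplus>\<^bsub>P\<^esub> f (tm (pr (Suc n)) (pr 0) (pu y v))"
      using z[OF ab _ y v] fz fc[OF pu_closed[OF yv]] by auto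
  qed
  then show ?thesis
    using \<Delta>_zero_right[OF in_G[OF x], of "Suc n"] pr_G[OF x] unfolding comult_comp_def by simp
qed

lemma \<Delta>_component:
  assumes "x \<in> carrier T"
  shows "\<Delta> a b (pr (a + b) x) = \<Delta> a b x"
proof (rule T_linear_eq[OF module_TT linear_map_comp[OF pr_linear \<Delta>_linear] \<Delta>_linear _ assms])
  fix w assume w: "w \<in> lists (carrier V)"
  note wG = word_G[OF w]
  show "\<Delta> a b (pr (a + b) (tensor_word K V w)) = \<Delta> a b (tensor_word K V w)"
  proof (cases "length w = a + b")
    case True
    then show ?thesis by (simp add: pr_G[OF wG])
  next
    case False
    have "tm (pr a) (pr b) (comult T (tensor_word K V w)) = \<zero>\<^bsub>TT\<^esub>"
    proof (rule D_G_linear_eq[OF module_TT tm_linear[OF pr_linear pr_linear] linear_map_const_zero[OF module_TT] wG])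
      fix a' b' y z assume *: "a' + b' = length w" "y \<in> G a'" "z \<in> G b'"
      then have "a \<noteq> a' \<or> b \<noteq> b'" using False by auto
      then show "tm (pr a) (pr b) (pu y z) = \<zero>\<^bsub>TT\<^esub>"
        using *(2,3)[THEN in_G] by (auto simp: tm_pure[OF pr_linear pr_linear] pr_G[OF *(2)] pr_G[OF *(3)] pu_zero)
    qed
    then show ?thesis
      using False by (simp add: pr_G[OF wG] linear_map_zero[OF module_T module_TT \<Delta>_linear])
        (simp add: comult_comp_def)
  qed
qed

text \<open>
  The product of the braided tensor square \<open>T \<otimes> T\<close>, for which the coproduct is multiplicative
  (\<open>D_product\<close>).
\<close>
definition mul2 where "mul2 s t = tm m m (middle_braid K T (braiding T) (pure K TT TT s t))"

lemma middle_braid_linear: "linear_map K (tensor K TT TT) (tensor K TT TT) (middle_braid K T (braiding T))"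
proof -
  note TT_T = tensor_module[OF module_TT module_T]
  note A = assoc_l_linear[OF module_TT module_T module_T]
    and B = tmap_linear[OF TT_T module_T TT_T module_T braid23_linear[OF module_T br_linear] linear_map_id]
    and C = assoc_r_linear[OF module_TT module_T module_T]
  show ?thesis
    unfolding middle_braid_def Let_def using linear_map_comp[OF linear_map_comp[OF A B] C] by (simp add: comp_def)
qed

lemma mul2_bilinear: "bilinear_map K TT TT TT mul2"
  unfolding mul2_def
  by (rule bilinear_map_post[OF pure_bilinear[OF module_TT module_TT]
        linear_map_comp[OF middle_braid_linear
          tmap_linear[OF module_TT module_TT module_T module_T m_linear m_linear]]])

lemma mul2_pure:
  assumes "a \<in> carrier T" "b \<in> carrier T" "x \<in> carrier T" "y \<in> carrier T"
  shows "mul2 (pu a b) (pu x y) = tm (\<lambda>p. a \<cdot> p) (\<lambda>q. q \<cdot> y) (braiding T (pu b x))"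
proof -
  note TT_T = tensor_module[OF module_TT module_T]
  let ?pu3 = "pure K TT T"
  let ?pu4 = "pure K (tensor K TT T) T"
  let ?mm = "tm m m"
  note ar = assoc_r_linear[OF module_TT module_T module_T] assoc_r_pure[OF module_TT module_T module_T]
  note al = assoc_l_linear[OF module_T module_T module_T] assoc_l_pure[OF module_T module_T module_T]
  note mm = tmap_linear[OF module_TT module_TT module_T module_T m_linear m_linear]
    tmap_pure[OF module_TT module_TT module_T module_T m_linear m_linear]
  let ?F = "\<lambda>u. ?mm (assoc_r K TT T T (?pu4 (assoc_l K T T T (pure K T TT a u)) y))"
  have F: "linear_map K TT TT ?F"
    using linear_map_comp[OF linear_map_comp[OF linear_map_comp[OF linear_map_comp[OF
      bilinear_map_right[OF pure_bilinear[OF module_T module_TT] assms(1)] al(1)]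
      bilinear_map_left[OF pure_bilinear[OF TT_T module_T] assms(4)]] ar(1)] mm(1)] .
  have bc: "braiding T (pu b x) \<in> carrier TT" using linear_map_closed[OF br_linear pu_closed] assms by auto
  have "mul2 (pu a b) (pu x y) = ?F (braiding T (pu b x))"
    using assms pu_closed
    by (simp add: mul2_def middle_braid_def Let_def assoc_l_pure[OF module_TT module_T module_T]
        tmap_pure[OF TT_T module_T TT_T module_T braid23_linear[OF module_T br_linear] linear_map_id]
        pure_closed[OF module_TT module_T] braid23_pure[OF module_T br_linear])
  also have "\<dots> = tm (\<lambda>p. a \<cdot> p) (\<lambda>q. q \<cdot> y) (braiding T (pu b x))"
  proof (rule TT_eq[OF module_TT F tm_linear[OF mult_right_linear mult_left_linear] _ bc])
    fix p q assume "p \<in> carrier T" "q \<in> carrier T"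
    then show "?F (pu p q) = tm (\<lambda>p. a \<cdot> p) (\<lambda>q. q \<cdot> y) (pu p q)"
      using assms pu_closed
      by (simp add: al(2) ar(2) mm(2) m_pure tm_pure[OF mult_right_linear mult_left_linear])
  qed (use assms in auto)
  finally show ?thesis .
qed

lemma D_product:
  assumes "x \<in> carrier T" "y \<in> carrier T"
  shows "comult T (x \<cdot> y) = mul2 (comult T x) (comult T y)"
  using D_mult[OF pu_closed[OF assms]] assms
  by (simp add: m_pure mul2_def tmap_pure[OF module_T module_T module_TT module_TT D_linear D_linear])

lemma D_primitive:
  assumes "v \<in> G 1"
  shows "comult T v = pu v \<one>\<^bsub>T\<^esub> \<oplus>\<^bsub>TT\<^esub> pu \<one>\<^bsub>T\<^esub> v"
proof (rule G_linear_eq[OF module_TT D_linear _ _ assms])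
  show "linear_map K T TT (\<lambda>v. pu v \<one>\<^bsub>T\<^esub> \<oplus>\<^bsub>TT\<^esub> pu \<one>\<^bsub>T\<^esub> v)"
    by (rule linear_map_sum[OF module_T module_TT bilinear_map_left[OF pu_bilinear] bilinear_map_right[OF pu_bilinear]])
      auto
  fix w assume "w \<in> lists (carrier V)" "length w = 1"
  then obtain a where "w = [a]" "a \<in> carrier V" by (cases w) auto
  then show "comult T (tensor_word K V w) = pu (tensor_word K V w) \<one>\<^bsub>T\<^esub> \<oplus>\<^bsub>TT\<^esub> pu \<one>\<^bsub>T\<^esub> (tensor_word K V w)"
    using T by (simp add: braided_tensor_algebra_def Let_def tensor_alg_incl_word)
qed

text \<open>
  Splitting off the last letter is a section of the multiplication \<open>T \<otimes> V \<rightarrow> T\<close>, which is therefore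
  injective (\<open>split_last_product\<close>).
\<close>
definition split_last where
  "split_last = lin_ext K TT (\<lambda>w. if w = [] then \<zero>\<^bsub>TT\<^esub> else
     pu (tensor_word K V (butlast w)) (tensor_alg_incl K V (last w)))"

lemma incl_linear: "linear_map K V T (tensor_alg_incl K V)"
  using tensor_alg_incl_linear[OF V] unfolding linear_map_def by (simp add: carrier_T add_T smult_T)

lemma word_multilinear:
  assumes "u \<in> lists (carrier V)" "v \<in> lists (carrier V)"
  shows "linear_map K V T (\<lambda>a. tensor_word K V (u @ a # v))"
proof (rule linear_map_cong[OF V])
  show "linear_map K V T (\<lambda>a. tensor_word K V u \<cdot> (tensor_alg_incl K V a \<cdot> tensor_word K V v))"
    using linear_map_comp[OF linear_map_comp[OF incl_linear mult_left_linear[OF word_T[OF assms(2)]]]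
        mult_right_linear[OF word_T[OF assms(1)]]] .
  fix a assume a: "a \<in> carrier V"
  then show "tensor_word K V u \<cdot> (tensor_alg_incl K V a \<cdot> tensor_word K V v) = tensor_word K V (u @ a # v)"
    using word_append[OF assms(1), of "[a] @ v"] word_append[of "[a]" v] assms(2)
    by (simp add: tensor_alg_incl_word)
qed

lemma split_last:
  shows split_last_linear: "linear_map K T TT split_last"
    and split_last_word: "w \<in> lists (carrier V) \<Longrightarrow> a \<in> carrier V \<Longrightarrow>
      split_last (tensor_word K V (w @ [a])) = pu (tensor_word K V w) (tensor_alg_incl K V a)"
proof -
  let ?\<beta> = "\<lambda>w. if w = [] then \<zero>\<^bsub>TT\<^esub> else pu (tensor_word K V (butlast w)) (tensor_alg_incl K V (last w))"
  note ic = linear_map_closed[OF incl_linear]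
  have ml: "multilinear K V TT ?\<beta>"
    unfolding multilinear_def
  proof (intro conjI ballI)
    fix w assume w: "w \<in> lists (carrier V)"
    have "butlast w \<in> lists (carrier V)" "w \<noteq> [] \<Longrightarrow> last w \<in> carrier V"
      using w by (auto dest: in_set_butlastD)
    then show "?\<beta> w \<in> carrier TT" using pu_closed word_T ic by auto
  next
    fix u v assume uv: "u \<in> lists (carrier V)" "v \<in> lists (carrier V)"
    show "linear_map K V TT (\<lambda>a. ?\<beta> (u @ a # v))"
    proof (cases "v = []")
      case True
      then show ?thesis
        using linear_map_comp[OF incl_linear bilinear_map_right[OF pu_bilinear word_T[OF uv(1)]]] by simp
    next
      case False
      have b: "butlast v \<in> lists (carrier V)" "last v \<in> carrier V"
        using uv False by (auto dest: in_set_butlastD)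
      show ?thesis
        using linear_map_comp[OF word_multilinear[OF uv(1) b(1)] bilinear_map_left[OF pu_bilinear ic[OF b(2)]]] False
        by (simp add: butlast_append)
    qed
  qed
  show "linear_map K T TT split_last"
    unfolding linear_T split_last_def by (rule tensor_alg_lift_linear[OF V module_TT ml])
  show "w \<in> lists (carrier V) \<Longrightarrow> a \<in> carrier V \<Longrightarrow>
      split_last (tensor_word K V (w @ [a])) = pu (tensor_word K V w) (tensor_alg_incl K V a)"
    unfolding split_last_def using tensor_alg_lift_word[OF V module_TT ml, of "w @ [a]"] by simp
qed

lemma split_last_product:
  assumes "t \<in> tens_span K T T (carrier T) (G 1)"
  shows "split_last (m t) = t"
proof (rule span_eq[OF module_TT linear_map_comp[OF m_linear split_last_linear] linear_map_id[unfolded id_def] _ _ _ assms])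
  fix x v assume x: "x \<in> carrier T" and v: "v \<in> G 1"
  have "split_last (x \<cdot> v) = pu x v"
  proof (rule G_linear_eq[OF module_TT linear_map_comp[OF mult_right_linear[OF x] split_last_linear]
        bilinear_map_right[OF pu_bilinear x] _ v])
    fix u assume u: "u \<in> lists (carrier V)" "length u = 1"
    then obtain a where a: "u = [a]" "a \<in> carrier V" by (cases u) auto
    note uT = word_T[OF u(1)]
    show "split_last (x \<cdot> tensor_word K V u) = pu x (tensor_word K V u)"
    proof (rule T_linear_eq[OF module_TT linear_map_comp[OF mult_left_linear[OF uT] split_last_linear]
          bilinear_map_left[OF pu_bilinear uT] _ x])
      fix w assume w: "w \<in> lists (carrier V)"
      show "split_last (tensor_word K V w \<cdot> tensor_word K V u) = pu (tensor_word K V w) (tensor_word K V u)"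
        using word_append[OF w u(1)] split_last_word[OF w a(2)] a by (simp add: tensor_alg_incl_word)
    qed
  qed
  then show "split_last (m (pu x v)) = pu x v" using m_pure[OF x in_G[OF v]] by simp
qed (use G_carrier in auto)


section \<open>The Nichols ideal is an ideal\<close>

text \<open>
  \<open>N n\<close> is the degree \<open>n\<close> part of the Nichols ideal, and \<open>W n\<close> is
  \<open>N\<^sup>n \<otimes> T\<^sup>1\<close>, inside \<open>T \<otimes> T\<close>.
\<close>
definition N where "N n = {x \<in> G n. \<Gamma> n x = \<zero>\<^bsub>T\<^esub>}"
definition W where "W n = tens_span K T T (N n) (G 1)"

lemma \<Gamma>_linear: "linear_map K T T (\<Gamma> n)"
proof (induction n)
  case 0
  show ?case unfolding Gamma.simps by (rule linear_map_id)
next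
  case (Suc n)
  then show ?case
    using linear_map_comp[OF linear_map_comp[OF \<Delta>_linear tm_linear[OF Suc linear_map_id]] m_linear] by simp
qed

lemma N_G: "x \<in> N n \<Longrightarrow> x \<in> G n"
  and N_T: "x \<in> N n \<Longrightarrow> x \<in> carrier T"
  and N_carrier: "N n \<subseteq> carrier T"
  using in_G by (auto simp: N_def)

lemma N_submodule: "submodule (N n) K T"
  by (rule TM.submoduleI')
    (auto simp: N_def in_G TM.submodule_closed[OF G_submodule] linear_map_zero[OF module_T module_T \<Gamma>_linear]
      linear_map_add[OF \<Gamma>_linear] linear_map_smult[OF \<Gamma>_linear])

lemma N_0: "N 0 = {\<zero>\<^bsub>T\<^esub>}"
  using TM.submodule_zero[OF G_submodule] by (auto simp: N_def)

lemma W_submodule: "submodule (W n) K TT"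
  unfolding W_def by (rule tens_span_submodule[OF module_T module_T N_carrier G_carrier])

lemma N_SucI:
  assumes x: "x \<in> G (Suc n)" and d: "\<Delta> n 1 x \<in> W n"
  shows "x \<in> N (Suc n)"
proof -
  have "tm (\<Gamma> n) id (\<Delta> n 1 x) = \<zero>\<^bsub>TT\<^esub>"
    by (rule span_zero[OF module_TT tm_linear[OF \<Gamma>_linear linear_map_id] N_carrier G_carrier _ d[unfolded W_def]])
      (auto simp: tm_pure[OF \<Gamma>_linear linear_map_id] N_T in_G N_def pu_zero)
  then show ?thesis
    using x by (simp add: N_def linear_map_zero[OF module_TT module_T m_linear])
qed

text \<open>
  This is \<open>tensor_kernel\<close> for \<open>\<Gamma>\<^sub>n\<close>. It has to be applied to \<open>\<Gamma>\<^sub>n pr\<^sub>n\<close>,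
  since \<open>N\<^sup>n\<close> is the kernel of \<open>\<Gamma>\<^sub>n\<close> on \<open>T\<^sup>n\<close> only.
\<close>
lemma W_I:
  assumes t: "t \<in> carrier TT" and p: "tm (pr n) (pr 1) t = t" and z: "tm (\<Gamma> n) id t = \<zero>\<^bsub>TT\<^esub>"
  shows "t \<in> W n"
proof -
  note prp = tm_linear[OF pr_linear pr_linear]
  have pp: "pr n (pr n x) = pr n x" if "x \<in> carrier T" for x
    using pr_G[OF pr_in[OF that]] by simp
  have "tm (pr n) id t = tm (pr n) id (tm (pr n) (pr 1) t)" using p by simp
  also have "\<dots> = tm (\<lambda>x. pr n (pr n x)) (\<lambda>x. id (pr 1 x)) t"
    by (rule tm_comp[OF pr_linear pr_linear pr_linear linear_map_id t])
  also have "\<dots> = tm (pr n) (pr 1) t"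
    by (rule tmap_cong[OF module_T module_T module_T module_T linear_map_comp[OF pr_linear pr_linear]
          linear_map_comp[OF pr_linear linear_map_id] _ _ t]) (auto simp: pp)
  finally have pt: "tm (pr n) id t = t" using p by simp
  have "tm (\<lambda>x. \<Gamma> n (pr n x)) id t = tm (\<Gamma> n) id (tm (pr n) id t)"
    using tm_comp[OF pr_linear linear_map_id \<Gamma>_linear linear_map_id t] by (simp add: id_def)
  then have z': "tm (\<lambda>x. \<Gamma> n (pr n x)) id t = \<zero>\<^bsub>TT\<^esub>" using pt z by simp
  obtain s where s: "linear_map K T T s" "\<And>a. a \<in> carrier T \<Longrightarrow> \<Gamma> n (pr n (s a)) = \<zero>\<^bsub>T\<^esub>" "tm s id t = t"
    by (rule tensor_kernel[OF K module_T module_T module_T linear_map_comp[OF pr_linear \<Gamma>_linear] t z']) blast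
  have "tm (pr n) (pr 1) (tm s id t) = tm (\<lambda>x. pr n (s x)) (\<lambda>x. pr 1 (id x)) t"
    by (rule tm_comp[OF s(1) linear_map_id pr_linear pr_linear t])
  then have e: "tm (\<lambda>x. pr n (s x)) (pr 1) t = t" using p s(3) by (simp add: id_def)
  have "tm (\<lambda>x. pr n (s x)) (pr 1) t \<in> W n"
  proof (rule span_linear[OF module_TT tm_linear[OF linear_map_comp[OF s(1) pr_linear] pr_linear] W_submodule
        subset_refl subset_refl])
    show "t \<in> tens_span K T T (carrier T) (carrier T)"
      using t tensor_span[OF module_T module_T] by (simp add: tens_span_def)
    fix x y assume xy: "x \<in> carrier T" "y \<in> carrier T"
    have "pr n (s x) \<in> N n" using s(2)[OF xy(1)] pr_in[OF linear_map_closed[OF s(1) xy(1)]] by (simp add: N_def)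
    then show "tm (\<lambda>x. pr n (s x)) (pr 1) (pu x y) \<in> W n"
      using xy pr_in[OF xy(2)]
      by (simp add: tm_pure[OF linear_map_comp[OF s(1) pr_linear] pr_linear] W_def pure_tens_span)
  qed
  then show ?thesis using e by simp
qed

lemma \<Delta>_idem:
  assumes "x \<in> carrier T"
  shows "tm (pr a) (pr b) (\<Delta> a b x) = \<Delta> a b x"
proof -
  note D = linear_map_closed[OF D_linear assms]
  have pp: "pr k (pr k x) = pr k x" if "x \<in> carrier T" for x k
    using pr_G[OF pr_in[OF that]] by simp
  have "tm (pr a) (pr b) (\<Delta> a b x) = tm (\<lambda>x. pr a (pr a x)) (\<lambda>x. pr b (pr b x)) (comult T x)"
    unfolding comult_comp_def by (rule tm_comp[OF pr_linear pr_linear pr_linear pr_linear D])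
  also have "\<dots> = tm (pr a) (pr b) (comult T x)"
    by (rule tmap_cong[OF module_T module_T module_T module_T linear_map_comp[OF pr_linear pr_linear]
          linear_map_comp[OF pr_linear pr_linear] _ _ D]) (auto simp: pp)
  finally show ?thesis unfolding comult_comp_def .
qed

text \<open>
  The definition of \<open>\<Gamma>\<close> ends with the multiplication \<open>T \<otimes> T\<^sup>1 \<rightarrow> T\<close>, which can be
  cancelled because it is injective.
\<close>
lemma \<Gamma>_Suc_eq_zero:
  assumes x: "x \<in> carrier T" and z: "\<Gamma> (Suc n) x = \<zero>\<^bsub>T\<^esub>"
  shows "tm (\<Gamma> n) id (\<Delta> n 1 x) = \<zero>\<^bsub>TT\<^esub>"
proof -
  note D = linear_map_closed[OF D_linear x]
  let ?s = "tm (\<Gamma> n) id (\<Delta> n 1 x)"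
  have "?s = tm (\<lambda>x. \<Gamma> n (pr n x)) (\<lambda>x. id (pr 1 x)) (comult T x)"
    unfolding comult_comp_def by (rule tm_comp[OF pr_linear pr_linear \<Gamma>_linear linear_map_id D])
  then have e: "?s = tm (\<lambda>x. \<Gamma> n (pr n x)) (pr 1) (comult T x)" by simp
  have "?s \<in> tens_span K T T (carrier T) (G 1)"
    unfolding e
  proof (rule span_linear[OF module_TT tm_linear[OF linear_map_comp[OF pr_linear \<Gamma>_linear] pr_linear]
        tens_span_submodule[OF module_T module_T subset_refl G_carrier] subset_refl subset_refl])
    show "comult T x \<in> tens_span K T T (carrier T) (carrier T)"
      using D tensor_span[OF module_T module_T] by (simp add: tens_span_def)
    fix x y assume xy: "x \<in> carrier T" "y \<in> carrier T"
    then show "tm (\<lambda>x. \<Gamma> n (pr n x)) (pr 1) (pu x y) \<in> tens_span K T T (carrier T) (G 1)"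
      using linear_map_closed[OF linear_map_comp[OF pr_linear \<Gamma>_linear]] pr_in
      by (simp add: tm_pure[OF linear_map_comp[OF pr_linear \<Gamma>_linear] pr_linear] pure_tens_span)
  qed
  then have "split_last (m ?s) = ?s" by (rule split_last_product)
  then show ?thesis using z linear_map_zero[OF module_T module_TT split_last_linear] by simp
qed

lemma \<Delta>_N:
  assumes "x \<in> N (Suc n)"
  shows "\<Delta> n 1 x \<in> W n"
proof -
  have x: "x \<in> carrier T" "\<Gamma> (Suc n) x = \<zero>\<^bsub>T\<^esub>" using assms in_G unfolding N_def by auto
  show ?thesis
    by (rule W_I[OF linear_map_closed[OF \<Delta>_linear x(1)] \<Delta>_idem[OF x(1)] \<Gamma>_Suc_eq_zero[OF x]])
qed

lemma \<Gamma>_1: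
  assumes "x \<in> G 1"
  shows "\<Gamma> 1 x = x"
proof -
  note xT = in_G[OF assms]
  have "\<Delta> 0 1 x = pu \<one>\<^bsub>T\<^esub> x"
    unfolding comult_comp_def D_primitive[OF assms]
    using linear_map_add[OF tm_linear[OF pr_linear pr_linear], of "pu x \<one>\<^bsub>T\<^esub>" "pu \<one>\<^bsub>T\<^esub> x" 0 1] xT
    by (simp add: pu_closed tm_pure[OF pr_linear pr_linear] pr_G[OF one_G] pr_G[OF assms] pu_zero)
  then show ?thesis
    using tm_pure[OF linear_map_id linear_map_id, of "\<one>\<^bsub>T\<^esub>" x] xT by (simp add: m_pure)
qed

lemma N_1: "N 1 = {\<zero>\<^bsub>T\<^esub>}"
  using TM.submodule_zero[OF G_submodule] \<Gamma>_1 by (auto simp: N_def simp del: Gamma.simps)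

lemma pr_tm_span:
  assumes "t \<in> tens_span K T T (G a) (G b)"
  shows "tm (pr a) (pr b) t = t"
  by (rule span_eq[OF module_TT tm_linear[OF pr_linear pr_linear] linear_map_id[unfolded id_def] G_carrier G_carrier _ assms])
    (simp add: tm_pure[OF pr_linear pr_linear] in_G pr_G)

lemma span_carrier: "t \<in> tens_span K T T (G a) (G b) \<Longrightarrow> t \<in> carrier TT"
  using TTM.submodule_subset[OF tens_span_submodule[OF module_T module_T G_carrier G_carrier]] by auto

text \<open>
  By induction on the degree; let \<open>y \<in> N\<^sup>n\<^sup>+\<^sup>1\<close>. Compatibility of the braiding with the coproduct expresses
  \<open>(\<Delta> \<otimes> T) c (v \<otimes> y)\<close> by moving \<open>v\<close> past the two tensor factors of \<open>\<Delta>(y)\<close>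
  in turn. The part that matters for \<open>\<Gamma>\<^sub>n\<^sub>+\<^sub>1 \<otimes> T\<close> comes from \<open>\<Delta>\<^sup>n\<^sup>,\<^sup>1(y)\<close>, which
  is in \<open>N\<^sup>n \<otimes> V\<close>, and moving \<open>v\<close> past \<open>N\<^sup>n\<close> is covered by the induction hypothesis.
  So \<open>\<Gamma>\<^sub>n\<^sub>+\<^sub>1 \<otimes> T\<close> kills \<open>c(v \<otimes> y)\<close>.
\<close>
lemma braiding_N:
  assumes v: "v \<in> G 1" and y: "y \<in> N n"
  shows "braiding T (pu v y) \<in> W n"
  using y
proof (induction n arbitrary: y)
  case 0
  then show ?case
    using v TTM.submodule_zero[OF W_submodule] linear_map_zero[OF module_TT module_TT br_linear]
    by (simp add: N_0 pu_zero in_G)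
next
  case (Suc n)
  note vT = in_G[OF v] and yT = N_T[OF Suc.prems] and yG = N_G[OF Suc.prems]
  let ?t = "braiding T (pu v y)"
  note TT_T = tensor_module[OF module_TT module_T]
  note T_TT = tensor_module[OF module_T module_TT]
  have tG: "?t \<in> tens_span K T T (G (Suc n)) (G 1)" by (rule br_G[OF v yG])
  note tT = span_carrier[OF tG]
  \<comment> \<open>\<open>\<Gamma>\<^sub>n\<^sub>+\<^sub>1\<close> is \<open>?M\<close> after the coproduct.\<close>
  let ?M = "\<lambda>s. m (tm (\<Gamma> n) id (tm (pr n) (pr 1) s))"
  have M: "linear_map K TT T ?M"
    by (rule linear_map_comp[OF linear_map_comp[OF tm_linear[OF pr_linear pr_linear]
            tm_linear[OF \<Gamma>_linear linear_map_id]] m_linear])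
  have Mp: "?M (pu p q) = \<Gamma> n (pr n p) \<cdot> pr 1 q" if "p \<in> carrier T" "q \<in> carrier T" for p q
    using that linear_map_closed[OF pr_linear] linear_map_closed[OF \<Gamma>_linear]
    by (simp add: tm_pure[OF pr_linear pr_linear] tm_pure[OF \<Gamma>_linear linear_map_id] m_pure)
  let ?c23 = "braid23 K T (braiding T)" and ?c12 = "braid12 K T (braiding T)"
  let ?al = "assoc_l K T T T"
  note al = assoc_l_linear[OF module_T module_T module_T] assoc_l_pure[OF module_T module_T module_T]
  note c12 = braid12_linear[OF module_T br_linear] braid12_pure[OF module_T br_linear]
  note c23 = braid23_linear[OF module_T br_linear] braid23_pure[OF module_T br_linear]
  note tM = tmap_linear[OF module_TT module_T module_T module_T M linear_map_id]
    tmap_pure[OF module_TT module_T module_T module_T M linear_map_id]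
  \<comment> \<open>\<open>?\<Xi> q u\<close> is what becomes of \<open>v \<otimes> p \<otimes> q\<close> once \<open>v\<close> has been moved past \<open>p\<close>, giving \<open>u\<close>.\<close>
  let ?\<Xi> = "\<lambda>q u. tm ?M id (?c23 (pure K TT T u q))"
  have \<Xi>: "linear_map K TT TT (?\<Xi> q)" if "q \<in> carrier T" for q
    using linear_map_comp[OF linear_map_comp[OF bilinear_map_left[OF pure_bilinear[OF module_TT module_T] that] c23(1)]
        tM(1)] .
  have \<Xi>_zero: "?\<Xi> q (pu p r) = \<zero>\<^bsub>TT\<^esub>"
    if p: "p \<in> G a" and r: "r \<in> G 1" and q: "q \<in> G b" and *: "b \<noteq> 1 \<or> p \<in> N n" for a b p q r
  proof -
    note pT = in_G[OF p] and rT = in_G[OF r] and qT = in_G[OF q]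
    have "?\<Xi> q (pu p r) = tm ?M id (?al (pure K T TT p (braiding T (pu r q))))"
      using pT rT qT by (simp add: c23(2))
    also have "\<dots> = \<zero>\<^bsub>TT\<^esub>"
    proof (rule span_zero[OF module_TT linear_map_comp[OF linear_map_comp[OF
            bilinear_map_right[OF pure_bilinear[OF module_T module_TT] pT] al(1)] tM(1)] G_carrier G_carrier _ br_G[OF r q]])
      fix q' r' assume q': "q' \<in> G b" and r': "r' \<in> G 1"
      note q'T = in_G[OF q'] and r'T = in_G[OF r']
      have "\<Gamma> n (pr n p) \<cdot> pr 1 q' = \<zero>\<^bsub>T\<^esub>"
      proof (cases "b = 1")
        case True
        then have "p \<in> N n" using * by simp
        then have "\<Gamma> n (pr n p) = \<zero>\<^bsub>T\<^esub>" using pr_G[OF N_G, of p n n] by (simp add: N_def)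
        then show ?thesis using linear_map_closed[OF pr_linear q'T] by simp
      next
        case False
        then have "pr 1 q' = \<zero>\<^bsub>T\<^esub>" using pr_G[OF q', of 1] by simp
        then show ?thesis using linear_map_closed[OF \<Gamma>_linear linear_map_closed[OF pr_linear pT]] by simp
      qed
      then show "tm ?M id (?al (pure K T TT p (pu q' r'))) = \<zero>\<^bsub>TT\<^esub>"
        unfolding al(2)[OF pT q'T r'T] tM(2)[OF pu_closed[OF pT q'T] r'T] Mp[OF pT q'T]
        using r'T by (simp add: pu_zero)
    qed
    finally show ?thesis .
  qed
  \<comment> \<open>\<open>?\<Psi>\<close> moves \<open>v\<close> past both factors of its argument and then applies \<open>?M\<close>.\<close>
  let ?\<Psi> = "\<lambda>s. tm ?M id (?c23 (?c12 (?al (pure K T TT v s))))"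
  have \<Psi>: "linear_map K TT TT ?\<Psi>"
    using linear_map_comp[OF linear_map_comp[OF linear_map_comp[OF linear_map_comp[OF
      bilinear_map_right[OF pure_bilinear[OF module_T module_TT] vT] al(1)] c12(1)] c23(1)] tM(1)] .
  have \<Psi>p: "?\<Psi> (pu p q) = ?\<Xi> q (braiding T (pu v p))" if "p \<in> carrier T" "q \<in> carrier T" for p q
    using that vT pu_closed by (simp add: al(2) c12(2))
  have \<Psi>_zero: "?\<Psi> (pu p q) = \<zero>\<^bsub>TT\<^esub>" if p: "p \<in> G a" and q: "q \<in> G b" and "b \<noteq> 1" for a b p q
    unfolding \<Psi>p[OF in_G[OF p] in_G[OF q]]
    by (rule span_zero[OF module_TT \<Xi>[OF in_G[OF q]] G_carrier G_carrier _ br_G[OF v p]])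
      (rule \<Xi>_zero, use q \<open>b \<noteq> 1\<close> in auto)
  have "?\<Psi> (comult T y) = ?\<Psi> (\<Delta> n 1 y) \<oplus>\<^bsub>TT\<^esub> ?\<Psi> (pu y \<one>\<^bsub>T\<^esub>)"
    by (rule D_split[OF module_TT \<Psi> yG]) (rule \<Psi>_zero, auto)
  also have "?\<Psi> (pu y \<one>\<^bsub>T\<^esub>) = \<zero>\<^bsub>TT\<^esub>" by (rule \<Psi>_zero[OF yG one_G]) simp
  also have "?\<Psi> (\<Delta> n 1 y) = \<zero>\<^bsub>TT\<^esub>"
  proof (rule span_zero[OF module_TT \<Psi> N_carrier G_carrier _ \<Delta>_N[OF Suc.prems, unfolded W_def]])
    fix p q assume p: "p \<in> N n" and q: "q \<in> G 1"
    show "?\<Psi> (pu p q) = \<zero>\<^bsub>TT\<^esub>"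
      unfolding \<Psi>p[OF N_T[OF p] in_G[OF q]]
      by (rule span_zero[OF module_TT \<Xi>[OF in_G[OF q]] N_carrier G_carrier _ Suc.IH[OF p, unfolded W_def]])
        (rule \<Xi>_zero[OF N_G _ q], auto)
  qed
  finally have \<Psi>D: "?\<Psi> (comult T y) = \<zero>\<^bsub>TT\<^esub>" by (simp add: id_def)
  have "tm (\<Gamma> (Suc n)) id ?t = tm (\<lambda>x. ?M (comult T x)) (\<lambda>x. id (id x)) ?t"
    by (simp add: comult_comp_def id_def)
  also have "\<dots> = tm ?M id (tmap K TT T (comult T) id ?t)"
    by (rule tmap_comp[OF module_T module_T module_TT module_T module_T module_T D_linear linear_map_id M
          linear_map_id tT, symmetric])
  also have "\<dots> = ?\<Psi> (comult T y)"
    using D_braid[OF pu_closed[OF vT yT]] tmap_pure[OF module_T module_T module_T module_TT linear_map_id D_linear vT yT]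
    by simp
  also note \<Psi>D
  finally show ?case
    using W_I[OF tT pr_tm_span[OF tG]] by blast
qed

text \<open>
  Let \<open>x \<in> N\<^sup>n\<^sup>+\<^sup>1\<close>. With \<open>\<Delta>(v) = v \<otimes> 1 + 1 \<otimes> v\<close> and \<open>\<Delta>(x) = \<Sum> p \<otimes> q\<close>, the coproduct of \<open>xv\<close>
  is \<open>\<Sum> p c(q \<otimes> v) + \<Sum> p \<otimes> qv\<close>. In bidegree \<open>(n + 1, 1)\<close> the first sum involves only
  \<open>\<Delta>\<^sup>n\<^sup>,\<^sup>1(x) \<in> N\<^sup>n \<otimes> V\<close> and lies in \<open>N\<^sup>n V \<otimes> V\<close>; the second contributes
  \<open>x \<otimes> v\<close>.
\<close>
lemma N_mult_right:
  assumes v: "v \<in> G 1" and x: "x \<in> N n"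
  shows "x \<cdot> v \<in> N (Suc n)"
  using v x
proof (induction n arbitrary: v x)
  case 0
  then show ?case using in_G[of v 1] TM.submodule_zero[OF N_submodule] by (simp add: N_0)
next
  case (Suc n)
  note v = Suc.prems(1)
  note vT = in_G[OF v] and xT = N_T[OF Suc.prems(2)] and xG = N_G[OF Suc.prems(2)]
  have xvG: "x \<cdot> v \<in> G (Suc (Suc n))" using mult_G[OF xG v] by simp
  note prp = tm_linear[OF pr_linear pr_linear]
  \<comment> \<open>The two sums above, as linear functions of \<open>\<Delta>(x)\<close>, in bidegree \<open>(n + 1, 1)\<close>.\<close>
  let ?A = "\<lambda>t. tm (pr (Suc n)) (pr 1) (mul2 t (pu v \<one>\<^bsub>T\<^esub>))"
  let ?B = "\<lambda>t. tm (pr (Suc n)) (pr 1) (mul2 t (pu \<one>\<^bsub>T\<^esub> v))"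
  let ?\<Phi> = "\<lambda>t. ?A t \<oplus>\<^bsub>TT\<^esub> ?B t"
  have A: "linear_map K TT TT ?A" and B: "linear_map K TT TT ?B"
    using linear_map_comp[OF bilinear_map_left[OF mul2_bilinear] prp] pu_closed vT by auto
  have \<Phi>: "linear_map K TT TT ?\<Phi>" by (rule linear_map_sum[OF module_TT module_TT A B])
  have D: "\<Delta> (Suc n) 1 (x \<cdot> v) = ?\<Phi> (comult T x)"
    unfolding comult_comp_def D_product[OF xT vT] D_primitive[OF v]
    using linear_map_add[OF bilinear_map_right[OF mul2_bilinear linear_map_closed[OF D_linear xT]]]
      linear_map_add[OF prp] bilinear_map_closed[OF mul2_bilinear linear_map_closed[OF D_linear xT]]
      pu_closed vT by simp
  have Bp: "?B (pu p q) = pu (pr (Suc n) p) (pr 1 (q \<cdot> v))" if "p \<in> carrier T" "q \<in> carrier T" for p q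
    using that vT by (simp add: mul2_pure br_one_right tm_pure[OF mult_right_linear mult_left_linear]
        tm_pure[OF pr_linear pr_linear])
  have Ap: "?A (pu p q) = tm (pr (Suc n)) (pr 1) (tm (\<lambda>r. p \<cdot> r) (\<lambda>r. r \<cdot> \<one>\<^bsub>T\<^esub>) (braiding T (pu q v)))"
    if "p \<in> carrier T" "q \<in> carrier T" for p q
    using that vT by (simp add: mul2_pure)
  have Al: "linear_map K TT TT (\<lambda>u. tm (pr (Suc n)) (pr 1) (tm (\<lambda>r. p \<cdot> r) (\<lambda>r. r \<cdot> \<one>\<^bsub>T\<^esub>) u))"
    if "p \<in> carrier T" for p
    by (rule linear_map_comp[OF tm_linear[OF mult_right_linear[OF that] mult_left_linear] prp]) simp
  have As: "tm (pr (Suc n)) (pr 1) (tm (\<lambda>r. p \<cdot> r) (\<lambda>r. r \<cdot> \<one>\<^bsub>T\<^esub>) (pu r s))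
      = pu (pr (Suc n) (p \<cdot> r)) (pr 1 s)"
    if "p \<in> carrier T" "r \<in> carrier T" "s \<in> carrier T" for p r s
    using that by (simp add: tm_pure[OF mult_right_linear mult_left_linear] tm_pure[OF pr_linear pr_linear])
  have B0: "?B (pu p q) = \<zero>\<^bsub>TT\<^esub>" if "p \<in> carrier T" "q \<in> G b" "b \<noteq> 0" for p q b
    unfolding Bp[OF that(1) in_G[OF that(2)]]
    using that pr_G[OF mult_G[OF that(2) v], of 1] linear_map_closed[OF pr_linear] by (simp add: pu_zero)
  have "?\<Phi> (comult T x) = ?\<Phi> (\<Delta> n 1 x) \<oplus>\<^bsub>TT\<^esub> ?\<Phi> (pu x \<one>\<^bsub>T\<^esub>)"
  proof (rule D_split[OF module_TT \<Phi> xG])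
    fix a b p q assume ab: "a + b = Suc n" "2 \<le> b" and p: "p \<in> G a" and q: "q \<in> G b"
    have "?A (pu p q) = \<zero>\<^bsub>TT\<^esub>"
      unfolding Ap[OF in_G[OF p] in_G[OF q]]
    proof (rule span_zero[OF module_TT Al[OF in_G[OF p]] G_carrier G_carrier _ br_G[OF q v]])
      fix r s assume r: "r \<in> G 1" and s: "s \<in> G b"
      have "pr 1 s = \<zero>\<^bsub>T\<^esub>" using pr_G[OF s, of 1] ab by simp
      then show "tm (pr (Suc n)) (pr 1) (tm (\<lambda>r. p \<cdot> r) (\<lambda>r. r \<cdot> \<one>\<^bsub>T\<^esub>) (pu r s)) = \<zero>\<^bsub>TT\<^esub>"
        using As[OF in_G[OF p] in_G[OF r] in_G[OF s]] linear_map_closed[OF pr_linear] in_G[OF p] in_G[OF r]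
        by (simp add: pu_zero)
    qed
    then show "?\<Phi> (pu p q) = \<zero>\<^bsub>TT\<^esub>" using B0[OF in_G[OF p] q] ab by simp
  qed
  moreover have "?\<Phi> (\<Delta> n 1 x) \<in> W (Suc n)"
  proof (rule span_linear[OF module_TT \<Phi> W_submodule N_carrier G_carrier _ \<Delta>_N[OF Suc.prems(2), unfolded W_def]])
    fix p q assume p: "p \<in> N n" and q: "q \<in> G 1"
    have "?A (pu p q) \<in> W (Suc n)"
      unfolding Ap[OF N_T[OF p] in_G[OF q]]
    proof (rule span_linear[OF module_TT Al[OF N_T[OF p]] W_submodule G_carrier G_carrier _ br_G[OF q v]])
      fix r s assume r: "r \<in> G 1" and s: "s \<in> G 1"
      have pr: "p \<cdot> r \<in> N (Suc n)"
        by (rule Suc.IH[OF r p])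
      then show "tm (pr (Suc n)) (pr 1) (tm (\<lambda>r. p \<cdot> r) (\<lambda>r. r \<cdot> \<one>\<^bsub>T\<^esub>) (pu r s)) \<in> W (Suc n)"
        using As[OF N_T[OF p] in_G[OF r] in_G[OF s]] pr_G[OF N_G[OF pr]] pr_G[OF s] s
        by (simp add: W_def pure_tens_span)
    qed
    then show "?\<Phi> (pu p q) \<in> W (Suc n)"
      using B0[OF N_T[OF p] q] TTM.submodule_carrier[OF W_submodule] by simp
  qed
  moreover have "?\<Phi> (pu x \<one>\<^bsub>T\<^esub>) = pu x v"
  proof -
    have "?A (pu x \<one>\<^bsub>T\<^esub>) = \<zero>\<^bsub>TT\<^esub>"
      unfolding Ap[OF xT TR.one_closed] br_one_left[OF vT] As[OF xT vT TR.one_closed]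
      using pr_G[OF one_G, of 1] linear_map_closed[OF pr_linear] xT vT by (simp add: pu_zero)
    moreover have "?B (pu x \<one>\<^bsub>T\<^esub>) = pu x v"
      using Bp[OF xT TR.one_closed] pr_G[OF xG] pr_G[OF v] vT by simp
    ultimately show ?thesis using pu_closed[OF xT vT] by simp
  qed
  moreover have "pu x v \<in> W (Suc n)" unfolding W_def by (rule pure_tens_span[OF Suc.prems(2,1)])
  ultimately have "\<Delta> (Suc n) 1 (x \<cdot> v) \<in> W (Suc n)"
    using D TTM.submodule_add[OF W_submodule] by simp
  then show ?case by (rule N_SucI[OF xvG])
qed

text \<open>
  For \<open>x \<in> N\<^sup>n\<^sup>+\<^sup>1\<close> the coproduct of \<open>vx\<close> is \<open>\<Sum> vp \<otimes> q + \<Sum> c(v \<otimes> p) q\<close>. In bidegree \<open>(n + 1, 1)\<close>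
  the first sum lies in \<open>V N\<^sup>n \<otimes> V\<close>, and the second contributes \<open>c(v \<otimes> x)\<close>, which is
  handled by \<open>braiding_N\<close>.
\<close>
lemma N_mult_left:
  assumes v: "v \<in> G 1" and x: "x \<in> N n"
  shows "v \<cdot> x \<in> N (Suc n)"
  using x
proof (induction n arbitrary: x)
  case 0
  then show ?case using in_G[OF v] TM.submodule_zero[OF N_submodule] by (simp add: N_0)
next
  case (Suc n)
  note vT = in_G[OF v] and xT = N_T[OF Suc.prems] and xG = N_G[OF Suc.prems]
  have vxG: "v \<cdot> x \<in> G (Suc (Suc n))" using mult_G[OF v xG] by simp
  note prp = tm_linear[OF pr_linear pr_linear]
  let ?A = "\<lambda>t. tm (pr (Suc n)) (pr 1) (mul2 (pu v \<one>\<^bsub>T\<^esub>) t)"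
  let ?B = "\<lambda>t. tm (pr (Suc n)) (pr 1) (mul2 (pu \<one>\<^bsub>T\<^esub> v) t)"
  let ?\<Phi> = "\<lambda>t. ?A t \<oplus>\<^bsub>TT\<^esub> ?B t"
  have A: "linear_map K TT TT ?A" and B: "linear_map K TT TT ?B"
    using linear_map_comp[OF bilinear_map_right[OF mul2_bilinear] prp] pu_closed vT by auto
  have \<Phi>: "linear_map K TT TT ?\<Phi>" by (rule linear_map_sum[OF module_TT module_TT A B])
  have D: "\<Delta> (Suc n) 1 (v \<cdot> x) = ?\<Phi> (comult T x)"
    unfolding comult_comp_def D_product[OF vT xT] D_primitive[OF v]
    using linear_map_add[OF bilinear_map_left[OF mul2_bilinear linear_map_closed[OF D_linear xT]]]
      linear_map_add[OF prp] bilinear_map_closed[OF mul2_bilinear _ linear_map_closed[OF D_linear xT]]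
      pu_closed vT by simp
  have Ap: "?A (pu p q) = pu (pr (Suc n) (v \<cdot> p)) (pr 1 q)" if "p \<in> carrier T" "q \<in> carrier T" for p q
    using that vT by (simp add: mul2_pure br_one_left tm_pure[OF mult_right_linear mult_left_linear]
        tm_pure[OF pr_linear pr_linear])
  have Bp: "?B (pu p q) = tm (pr (Suc n)) (pr 1) (tm (\<lambda>r. \<one>\<^bsub>T\<^esub> \<cdot> r) (\<lambda>r. r \<cdot> q) (braiding T (pu v p)))"
    if "p \<in> carrier T" "q \<in> carrier T" for p q
    using that vT by (simp add: mul2_pure)
  have Bl: "linear_map K TT TT (\<lambda>u. tm (pr (Suc n)) (pr 1) (tm (\<lambda>r. \<one>\<^bsub>T\<^esub> \<cdot> r) (\<lambda>r. r \<cdot> q) u))"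
    if "q \<in> carrier T" for q
    by (rule linear_map_comp[OF tm_linear[OF mult_right_linear mult_left_linear[OF that]] prp]) simp
  have Bs: "tm (pr (Suc n)) (pr 1) (tm (\<lambda>r. \<one>\<^bsub>T\<^esub> \<cdot> r) (\<lambda>r. r \<cdot> q) (pu r s))
      = pu (pr (Suc n) r) (pr 1 (s \<cdot> q))"
    if "q \<in> carrier T" "r \<in> carrier T" "s \<in> carrier T" for q r s
    using that by (simp add: tm_pure[OF mult_right_linear mult_left_linear] tm_pure[OF pr_linear pr_linear])
  have B0: "?B (pu p q) = \<zero>\<^bsub>TT\<^esub>" if p: "p \<in> G a" and q: "q \<in> G b" and "b \<noteq> 0" for p q a b
    unfolding Bp[OF in_G[OF p] in_G[OF q]]
  proof (rule span_zero[OF module_TT Bl[OF in_G[OF q]] G_carrier G_carrier _ br_G[OF v p]])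
    fix r s assume r: "r \<in> G a" and s: "s \<in> G 1"
    have "pr 1 (s \<cdot> q) = \<zero>\<^bsub>T\<^esub>" using pr_G[OF mult_G[OF s q], of 1] \<open>b \<noteq> 0\<close> by simp
    then show "tm (pr (Suc n)) (pr 1) (tm (\<lambda>r. \<one>\<^bsub>T\<^esub> \<cdot> r) (\<lambda>r. r \<cdot> q) (pu r s)) = \<zero>\<^bsub>TT\<^esub>"
      using Bs[OF in_G[OF q] in_G[OF r] in_G[OF s]] linear_map_closed[OF pr_linear in_G[OF r]]
      by (simp add: pu_zero)
  qed
  have "?\<Phi> (comult T x) = ?\<Phi> (\<Delta> n 1 x) \<oplus>\<^bsub>TT\<^esub> ?\<Phi> (pu x \<one>\<^bsub>T\<^esub>)"
  proof (rule D_split[OF module_TT \<Phi> xG])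
    fix a b p q assume ab: "a + b = Suc n" "2 \<le> b" and p: "p \<in> G a" and q: "q \<in> G b"
    have "pr 1 q = \<zero>\<^bsub>T\<^esub>" using pr_G[OF q, of 1] ab by simp
    then have "?A (pu p q) = \<zero>\<^bsub>TT\<^esub>"
      using Ap[OF in_G[OF p] in_G[OF q]] linear_map_closed[OF pr_linear] vT in_G[OF p] by (simp add: pu_zero)
    then show "?\<Phi> (pu p q) = \<zero>\<^bsub>TT\<^esub>" using B0[OF p q] ab by simp
  qed
  moreover have "?\<Phi> (\<Delta> n 1 x) \<in> W (Suc n)"
  proof (rule span_linear[OF module_TT \<Phi> W_submodule N_carrier G_carrier _ \<Delta>_N[OF Suc.prems, unfolded W_def]])
    fix p q assume p: "p \<in> N n" and q: "q \<in> G 1"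
    note vp = Suc.IH[OF p]
    have "?A (pu p q) \<in> W (Suc n)"
      using Ap[OF N_T[OF p] in_G[OF q]] pr_G[OF N_G[OF vp]] pr_G[OF q] vp q
      by (simp add: W_def pure_tens_span)
    then show "?\<Phi> (pu p q) \<in> W (Suc n)"
      using B0[OF N_G[OF p] q] TTM.submodule_carrier[OF W_submodule] by simp
  qed
  moreover have "?\<Phi> (pu x \<one>\<^bsub>T\<^esub>) \<in> W (Suc n)"
  proof -
    have "?A (pu x \<one>\<^bsub>T\<^esub>) = \<zero>\<^bsub>TT\<^esub>"
      unfolding Ap[OF xT TR.one_closed]
      using pr_G[OF one_G, of 1] linear_map_closed[OF pr_linear] xT vT by (simp add: pu_zero)
    moreover have "?B (pu x \<one>\<^bsub>T\<^esub>) \<in> W (Suc n)"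
      unfolding Bp[OF xT TR.one_closed]
    proof (rule span_linear[OF module_TT Bl[OF TR.one_closed] W_submodule N_carrier G_carrier _
          braiding_N[OF v Suc.prems, unfolded W_def]])
      fix r s assume r: "r \<in> N (Suc n)" and s: "s \<in> G 1"
      then show "tm (pr (Suc n)) (pr 1) (tm (\<lambda>r. \<one>\<^bsub>T\<^esub> \<cdot> r) (\<lambda>r. r \<cdot> \<one>\<^bsub>T\<^esub>) (pu r s)) \<in> W (Suc n)"
        using Bs[OF TR.one_closed N_T[OF r] in_G[OF s]] pr_G[OF N_G[OF r]] pr_G[OF s] in_G[OF s]
        by (simp add: W_def pure_tens_span)
    qed
    ultimately show ?thesis using TTM.submodule_carrier[OF W_submodule] by simp
  qed
  ultimately have "\<Delta> (Suc n) 1 (v \<cdot> x) \<in> W (Suc n)"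
    using D TTM.submodule_add[OF W_submodule] by simp
  then show ?case by (rule N_SucI[OF vxG])
qed

abbreviation I where "I \<equiv> Nichols_ideal K T"

lemma I_span: "I = mspan K T (\<Union>n. N n)"
  by (simp add: Nichols_ideal_def N_def)

lemma I_submodule: "submodule I K T"
  unfolding I_span by (rule TM.mspan_submodule) (use N_carrier in auto)

lemma N_I: "x \<in> N n \<Longrightarrow> x \<in> I"
  unfolding I_span by (rule mspan_superset) auto

lemma I_linear:
  assumes "module K P" "linear_map K T P f" "submodule H K P" "\<And>n x. x \<in> N n \<Longrightarrow> f x \<in> H" "x \<in> I"
  shows "f x \<in> H"
  by (rule linear_map_mspan[OF module_T assms(1-3), of "\<Union>n. N n"])
    (use assms(4,5) N_T in \<open>auto simp: I_span\<close>)

lemma I_component: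
  assumes "x \<in> I"
  shows "pr n x \<in> N n"
  by (rule I_linear[OF module_T pr_linear N_submodule _ assms])
    (use pr_G[OF N_G] TM.submodule_zero[OF N_submodule] in auto)

lemma I_homogeneous: "x \<in> I \<Longrightarrow> x \<in> G n \<Longrightarrow> x \<in> N n"
  using I_component[of x n] pr_G[of x n n] by simp

text \<open>
  \<open>T\<close> is spanned by words, so stability under products with letters is enough.
\<close>
lemma ideal_I: "ideal I T"
proof (rule submodule_ideal[OF algebra_T I_submodule])
  note IT = TM.submodule_carrier[OF I_submodule]
  have L: "v \<cdot> z \<in> I" and R: "z \<cdot> v \<in> I" if v: "v \<in> G 1" and z: "z \<in> I" for v z
    using I_linear[OF module_T mult_right_linear[OF in_G[OF v]] I_submodule _ z]
      I_linear[OF module_T mult_left_linear[OF in_G[OF v]] I_submodule _ z]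
      N_I[OF N_mult_left[OF v]] N_I[OF N_mult_right[OF v]] by auto
  fix x z assume x: "x \<in> carrier T" and z: "z \<in> I"
  show "x \<cdot> z \<in> I"
  proof (rule T_linear_mem[OF module_T mult_left_linear[OF IT[OF z]] I_submodule _ x])
    fix w assume "w \<in> lists (carrier V)"
    then show "tensor_word K V w \<cdot> z \<in> I"
    proof (induction w)
      case Nil
      then show ?case using z IT by (simp add: tensor_word_Nil[OF V] one_T[symmetric])
    next
      case (Cons a w)
      then have "tensor_word K V [a] \<in> G 1" using word_G[of "[a]"] by simp
      then show ?case
        using word_append[of "[a]" w] Cons L[of "tensor_word K V [a]"] word_T[of w] word_T[of "[a]"] IT[OF z]
        by (simp add: TR.m_assoc)
    qed
  qed
  show "z \<cdot> x \<in> I"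
  proof (rule T_linear_mem[OF module_T mult_right_linear[OF IT[OF z]] I_submodule _ x])
    fix w assume "w \<in> lists (carrier V)"
    then show "z \<cdot> tensor_word K V w \<in> I"
    proof (induction w rule: rev_induct)
      case Nil
      then show ?case using z IT by (simp add: tensor_word_Nil[OF V] one_T[symmetric])
    next
      case (snoc a w)
      then have "tensor_word K V [a] \<in> G 1" using word_G[of "[a]"] by simp
      then show ?case
        using word_append[of w "[a]"] snoc R[of "tensor_word K V [a]"] word_T[of w] word_T[of "[a]"] IT[OF z]
        by (simp add: TR.m_assoc[symmetric])
    qed
  qed
qed

end


section \<open>The quadratic case\<close>

lemma quot_bialg_simps:
  "carrier (quot_bialg K B J) = carrier (quot B J)"
  "mult (quot_bialg K B J) = mult (quot B J)"
  "one (quot_bialg K B J) = one (quot B J)"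
  "zero (quot_bialg K B J) = zero (quot B J)"
  "add (quot_bialg K B J) = add (quot B J)"
  "smult (quot_bialg K B J) = smult (quot B J)"
  "comult (quot_bialg K B J) = (\<lambda>x. tmap K (quot B J) (quot B J) (coset_rep B J) (coset_rep B J) (comult B x))"
  "grading (quot_bialg K B J) = (\<lambda>n. coset_rep B J ` grading B n)"
  by (simp_all add: quot_bialg_def Let_def module.extend_def braided_bialg.fields_def)

text \<open>
  A quotient bialgebra and the underlying quotient have the same tensor square, as the tensor product
  depends on the module structure only.
\<close>
lemma tmap_cong_carrier:
  assumes "carrier A' = carrier A" "add A' = add A" "smult A' = smult A"
  shows "tmap K A' A' f g = tmap K A A f g"
proof -
  have "bilinear_relations K A' A' = bilinear_relations K A A"
    unfolding bilinear_relations_def assms ..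
  then have n: "tensor_null K A' A' = tensor_null K A A"
    unfolding tensor_null_def assms by simp
  have t: "tensor K A' A' = tensor K A A"
    unfolding tensor_def n assms ..
  have p: "pure K A' A' = pure K A A"
    by (intro ext) (simp add: pure_def n assms)
  show ?thesis unfolding tmap_def t p ..
qed

lemma linear_map_cong_codomain:
  assumes "carrier N' = carrier N" "add N' = add N" "smult N' = smult N"
  shows "linear_map K M N' f = linear_map K M N f"
  unfolding linear_map_def assms by auto

locale quadratic_nichols = braided_tensor_alg +
  assumes Q: "quadratic_algebra K (Nichols K T) (grading (Nichols K T))"
begin

abbreviation B where "B \<equiv> Nichols K T"
abbreviation p where "p \<equiv> coset_rep T I"

lemmas B_simps = quot_bialg_simps[of K T I, folded Nichols_def]

lemma algebra_B: "assoc_algebra K B"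
  and graded_B: "graded_module K B (grading B)"
  using Q by (auto simp: quadratic_algebra_def graded_algebra_def)

lemma module_B: "module K B" by (rule assoc_algebra_module[OF algebra_B])
sublocale BM: module K B by (rule module_B)
sublocale BR: ring B by (rule assoc_algebra_ring[OF algebra_B])

lemma p_linear: "linear_map K T B p"
  using TM.coset_rep_linear[OF I_submodule]
  by (simp add: linear_map_cong_codomain[OF B_simps(1,5,6)])

lemma B_linear: "linear_map K B M f = linear_map K (quot T I) M f"
  by (rule linear_map_cong_carrier[OF B_simps(1,5,6)])

lemma p_zero_iff: "x \<in> carrier T \<Longrightarrow> p x = \<zero>\<^bsub>B\<^esub> \<longleftrightarrow> x \<in> I"
  using TM.coset_rep_eq_zero_iff[OF I_submodule] by (simp add: B_simps)

lemma carrier_B: "carrier B = p ` carrier T"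
  by (simp add: B_simps quot_simps)

lemma B_T: "x \<in> carrier B \<Longrightarrow> x \<in> carrier T"
  using TM.coset_rep_closed[OF I_submodule] by (auto simp: carrier_B)

lemma p_B: "x \<in> carrier B \<Longrightarrow> p x = x"
  using TM.coset_rep_idem[OF I_submodule] by (auto simp: carrier_B)

lemma p_mult: "x \<in> carrier T \<Longrightarrow> y \<in> carrier T \<Longrightarrow> p (x \<cdot> y) = p x \<otimes>\<^bsub>B\<^esub> p y"
  using coset_rep_mult[OF algebra_T ideal_I] by (simp add: B_simps quot_simps)

lemma p_one: "p \<one>\<^bsub>T\<^esub> = \<one>\<^bsub>B\<^esub>"
  by (simp add: B_simps quot_simps)

lemma grading_B: "grading B n = p ` G n"
  by (simp add: B_simps)

text \<open>
  As \<open>N\<^sup>1 = 0\<close>, the condition \<open>\<Delta>\<^sup>1\<^sup>,\<^sup>1(x) \<in> N\<^sup>1 \<otimes> V\<close> means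
  \<open>\<Delta>\<^sup>1\<^sup>,\<^sup>1(x) = 0\<close>.
\<close>
lemma E_deg_2: "N 2 \<subseteq> E_deg K T 2"
proof
  fix x assume x: "x \<in> N 2"
  have "\<Delta> 1 1 x \<in> W 1" using \<Delta>_N[of x 1] x by (simp add: numeral_2_eq_2)
  then have "\<Delta> 1 1 x \<in> tens_span K T T {\<zero>\<^bsub>T\<^esub>} (G 1)" unfolding W_def N_1 .
  then have "id (\<Delta> 1 1 x) = \<zero>\<^bsub>TT\<^esub>"
  proof (rule span_zero[OF module_TT linear_map_id _ G_carrier, rotated 2])
    fix y z assume "y \<in> {\<zero>\<^bsub>T\<^esub>}" "z \<in> G 1"
    then show "id (pu y z) = \<zero>\<^bsub>TT\<^esub>" using pu_zero(1)[OF in_G] by simp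
  qed simp
  then have z: "\<Delta> 1 1 x = \<zero>\<^bsub>TT\<^esub>" by simp
  have "a = 1 \<and> b = 1" if "1 \<le> a \<and> 1 \<le> b \<and> a + b = 2" for a b :: nat using that by auto
  then show "x \<in> E_deg K T 2" using z N_G[OF x] unfolding E_deg_def by blast
qed

lemma E_deg_N:
  assumes "x \<in> E_deg K T n" "n \<ge> 2"
  shows "x \<in> N n"
proof -
  obtain k where k: "n = Suc k" "k \<ge> 1" using assms(2) by (cases n) auto
  have "x \<in> G (Suc k)" "\<Delta> k 1 x = \<zero>\<^bsub>TT\<^esub>" using assms(1) k unfolding E_deg_def by auto
  then show ?thesis using N_SucI TTM.submodule_zero[OF W_submodule] k by simp
qed

lemma E_space_carrier: "E_space K T \<subseteq> carrier T"
  unfolding E_space_def by (rule TM.mspan_carrier) (auto simp: E_deg_def in_G)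

lemma ideal_E: "ideal (E_ideal K T) T"
  unfolding E_ideal_def by (rule TR.genideal_ideal[OF E_space_carrier])

lemma E_ideal_subset: "E_ideal K T \<subseteq> I"
  unfolding E_ideal_def
proof (rule TR.genideal_minimal[OF ideal_I])
  show "E_space K T \<subseteq> I"
    unfolding E_space_def by (rule mspan_minimal[OF I_submodule]) (auto intro: N_I E_deg_N)
qed

lemma N_2_E_ideal: "N 2 \<subseteq> E_ideal K T"
proof -
  have "E_deg K T 2 \<subseteq> E_space K T"
    unfolding E_space_def by (auto intro!: mspan_superset)
  then show ?thesis
    using E_deg_2 TR.genideal_self[OF E_space_carrier] unfolding E_ideal_def by blast
qed

text \<open>
  The quadratic presentation of \<open>B = T/N\<close> concerns the tensor algebra \<open>T'\<close> of \<open>B\<^sup>1\<close>, which is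
  isomorphic to \<open>T\<close> but consists of words in chosen representatives. The algebra map
  \<open>\<psi> : T' \<rightarrow> T\<close> extending the inverse of \<open>V \<rightarrow> B\<^sup>1\<close> turns the projection \<open>T \<rightarrow> B\<close> into the
  evaluation \<open>T' \<rightarrow> B\<close>. The preimage under \<open>\<psi>\<close> of the ideal generated by \<open>E(T)\<close> contains
  the quadratic relations, hence all relations \<open>R\<close>; and every element of \<open>N\<close> is the image of
  a relation.
\<close>
lemma Nichols_subset_E_ideal: "I \<subseteq> E_ideal K T"
proof
  fix x assume xI: "x \<in> I"
  have xT: "x \<in> carrier T" using xI TM.submodule_carrier[OF I_submodule] by auto
  define A1 where "A1 = B\<lparr>carrier := grading B 1\<rparr>"
  have A1s: "carrier A1 = grading B 1" "add A1 = add B" "smult A1 = smult B"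
    by (simp_all add: A1_def)
  have A1: "module K A1"
    unfolding A1_def by (rule submodule.submodule_is_module[OF graded_module_submodule[OF graded_B] module_B])
  let ?T' = "tensor_alg K A1" and ?ev = "tensor_alg_eval K B" and ?q = "pr 1"
  note T'A = tensor_alg_algebra[OF A1]
  note T'M = assoc_algebra_module[OF T'A]
  interpret T'R: ring ?T' by (rule assoc_algebra_ring[OF T'A])
  have A1_B: "carrier A1 \<subseteq> carrier B" unfolding A1s by (rule graded_module_carrier[OF graded_B])
  have q1: "pr 1 z = \<zero>\<^bsub>T\<^esub>" if "z \<in> I" for z using I_component[OF that, of 1] unfolding N_1 by simp
  note qq = linear_map_quot[OF module_T module_T pr_linear I_submodule q1]
  have q: "linear_map K A1 T ?q"
    by (rule linear_map_subset[OF _ A1_B A1s(2,3)]) (unfold B_linear, rule qq(2))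
  \<comment> \<open>\<open>N\<^sup>1 = 0\<close>, so the degree 1 component of any representative of \<open>v\<close> is \<open>v\<close>.\<close>
  have qp: "?q (p v) = v" if "v \<in> G 1" for v
    using qq(1)[OF _ in_G[OF that]] pr_G[OF that, of 1] by simp
  have pq: "p (?q a) = a" if "a \<in> carrier A1" for a
    using that qp unfolding A1s grading_B by auto
  define \<psi> where "\<psi> = lin_ext K T (\<lambda>w. word_prod T (map ?q w))"
  note ml = word_prod_multilinear[OF A1 algebra_T q]
  note \<psi>_linear = tensor_alg_lift_linear[OF A1 module_T ml, folded \<psi>_def]
    and \<psi>_word = tensor_alg_lift_word[OF A1 module_T ml, folded \<psi>_def]
    and \<psi>_mult = tensor_alg_lift_mult[OF A1 algebra_T q, folded \<psi>_def]
  have idl: "linear_map K A1 B id" by (rule linear_map_subset[OF linear_map_id A1_B A1s(2,3)])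
  note ml' = word_prod_multilinear[OF A1 algebra_B idl, simplified]
  note ev_linear = tensor_alg_lift_linear[OF A1 module_B ml', folded tensor_alg_eval_lin_ext]
    and ev_word = tensor_alg_lift_word[OF A1 module_B ml', folded tensor_alg_eval_lin_ext]
  have p_word: "p (word_prod T (map ?q w)) = word_prod B w" if "w \<in> lists (carrier A1)" for w
    using that
  proof (induction w)
    case Nil
    then show ?case by (simp add: word_prod_simps p_one)
  next
    case (Cons a w)
    then have "word_prod T (map ?q w) \<in> carrier T" "?q a \<in> carrier T"
      using linear_map_closed[OF q] by (auto intro!: word_prod_closed[OF TR.monoid_axioms])
    then show ?case using Cons by (simp add: word_prod_simps p_mult pq[of a, simplified])
  qed
  have p\<psi>: "p (\<psi> t) = ?ev t" if t: "t \<in> carrier ?T'" for t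
    by (rule tensor_alg_linear_eq[OF A1 module_B linear_map_comp[OF \<psi>_linear p_linear] ev_linear _ t])
      (simp add: \<psi>_word ev_word p_word del: One_nat_def)
  define R where "R = a_kernel ?T' B ?ev"
  have R: "R = {t \<in> carrier ?T'. ?ev t = \<zero>\<^bsub>B\<^esub>}"
    by (simp add: R_def a_kernel_def kernel_def)
  have Rq: "R = Idl\<^bsub>?T'\<^esub> (R \<inter> tensor_power K A1 2)"
    using Q unfolding quadratic_algebra_def Let_def R_def A1_def by blast
  note ES = ideal_submodule[OF algebra_T ideal_E]
  interpret E: ideal "E_ideal K T" T by (rule ideal_E)
  define J where "J = {t \<in> carrier ?T'. \<psi> t \<in> E_ideal K T}"
  have "submodule J K ?T'" unfolding J_def by (rule submodule_vimage[OF T'M module_T \<psi>_linear ES])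
  then have "ideal J ?T'"
    by (rule submodule_ideal[OF T'A])
      (auto simp: J_def \<psi>_mult intro: E.I_l_closed E.I_r_closed linear_map_closed[OF \<psi>_linear])
  moreover have "R \<inter> tensor_power K A1 2 \<subseteq> J"
  proof
    fix t assume t: "t \<in> R \<inter> tensor_power K A1 2"
    have tc: "t \<in> carrier ?T'" using t R by auto
    have "\<psi> t \<in> G 2"
    proof (rule tensor_power_linear[OF A1 module_T \<psi>_linear G_submodule, of 2])
      fix w assume w: "w \<in> lists (carrier A1)" "length w = 2"
      then obtain a b where ab: "w = [a, b]" "a \<in> carrier A1" "b \<in> carrier A1"
        by (auto simp: length_Suc_conv numeral_2_eq_2)
      have "?q a \<in> G 1" "?q b \<in> G 1" using ab A1_B B_T pr_in by auto
      then show "\<psi> (tensor_word K A1 w) \<in> G 2"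
        using \<psi>_word[OF w(1)] ab mult_G[of "?q a" 1 "?q b" 1] in_G[of "?q b" 1]
        by (simp add: word_prod_simps numeral_2_eq_2)
    qed (use t in auto)
    moreover have "\<psi> t \<in> I"
      using p\<psi>[OF tc] t R p_zero_iff[OF linear_map_closed[OF \<psi>_linear tc]] by auto
    ultimately have "\<psi> t \<in> N 2" using I_homogeneous by auto
    then show "t \<in> J" using N_2_E_ideal tc by (auto simp: J_def)
  qed
  ultimately have RJ: "R \<subseteq> J" using Rq T'R.genideal_minimal[of J] by metis
  let ?i = "\<lambda>v. p (tensor_alg_incl K V v)"
  have iG: "tensor_alg_incl K V v \<in> G 1" if "v \<in> carrier V" for v
    using word_G[of "[v]"] that by (simp add: tensor_alg_incl_word)
  have iA1: "?i v \<in> carrier A1" if "v \<in> carrier V" for v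
    using iG[OF that] unfolding A1s grading_B by auto
  have i: "linear_map K V A1 ?i"
    using linear_map_comp[OF incl_linear p_linear] iA1 unfolding linear_map_def A1s by auto
  have q': "linear_map K V ?T' (\<lambda>v. tensor_alg_incl K A1 (?i v))"
    by (rule linear_map_comp[OF i tensor_alg_incl_linear[OF A1]])
  note ml'' = word_prod_multilinear[OF V T'A q']
  \<comment> \<open>A right inverse of \<open>\<psi>\<close>.\<close>
  define y where "y = lin_ext K ?T' (\<lambda>w. word_prod ?T' (map (\<lambda>v. tensor_alg_incl K A1 (?i v)) w))"
  have y: "linear_map K T ?T' y"
    unfolding linear_T y_def by (rule tensor_alg_lift_linear[OF V T'M ml''])
  have "\<psi> (y x) = x"
  proof (rule T_linear_eq[OF module_T linear_map_comp[OF y \<psi>_linear] linear_map_id[unfolded id_def] _ xT])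
    fix w assume w: "w \<in> lists (carrier V)"
    have wi: "map ?i w \<in> lists (carrier A1)" using w iA1 by auto
    have "y (tensor_word K V w) = tensor_word K A1 (map ?i w)"
      using tensor_alg_lift_word[OF V T'M ml'' w] word_prod_tensor_word[OF A1 wi]
      by (simp add: y_def comp_def)
    moreover have "map ?q (map ?i w) = map (tensor_alg_incl K V) w"
      using w qp iG by auto
    moreover have "word_prod T (map (tensor_alg_incl K V) w) = tensor_word K V w"
      using word_prod_tensor_word[OF V w] by (simp add: word_prod_def mult_T one_T)
    ultimately show "\<psi> (y (tensor_word K V w)) = tensor_word K V w"
      using \<psi>_word[OF wi] by metis
  qed
  moreover have "y x \<in> R"
    using p\<psi>[OF linear_map_closed[OF y xT]] \<open>\<psi> (y x) = x\<close> linear_map_closed[OF y xT] p_zero_iff[OF xT] xI R by auto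
  ultimately show "x \<in> E_ideal K T" using RJ by (auto simp: J_def)
qed

lemma S_bialg_T: "S_bialg K T = B"
  unfolding S_bialg_def Nichols_def using E_ideal_subset Nichols_subset_E_ideal by simp

text \<open>
  Projecting the decomposition of \<open>x\<close> gives a decomposition of its class, and by hypothesis there is only
  one.
\<close>
lemma component_B:
  assumes "x \<in> carrier T"
  shows "component B (grading B) n (p x) = p (pr n x)"
proof (rule component_eq[OF graded_B linear_map_closed[OF p_linear assms]])
  let ?S = "{n. pr n x \<noteq> \<zero>\<^bsub>T\<^esub>}"
  have gd: "graded_decomp T G x (\<lambda>n. pr n x)" by (rule graded_decomp_component[OF graded_T assms])
  have S: "finite ?S" "x = (\<Oplus>\<^bsub>T\<^esub>n\<in>?S. pr n x)"
    using gd unfolding graded_decomp_def by auto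
  show "graded_decomp B (grading B) (p x) (\<lambda>n. p (pr n x))"
  proof (rule graded_decompI[OF module_B S(1)])
    show "p x = (\<Oplus>\<^bsub>B\<^esub>n\<in>?S. p (pr n x))"
      by (subst S(2), rule linear_map_finsum[OF module_T module_B p_linear S(1)])
        (use linear_map_closed[OF pr_linear assms] in auto)
    show "p (pr n x) = \<zero>\<^bsub>B\<^esub>" if "n \<notin> ?S" for n
      using that linear_map_zero[OF module_T module_B p_linear] by simp
  qed (use pr_in[OF assms] linear_map_closed[OF p_linear in_G] in \<open>auto simp: grading_B\<close>)
qed

text \<open>
  The maps \<open>\<Gamma>\<^sub>k pr\<^sub>k\<close> and \<open>pr\<^sub>1\<close> kill \<open>N\<close>, hence are defined on \<open>B\<close>. Applied
  to the two factors of \<open>\<Delta>\<^sub>B\<^sup>k\<^sup>,\<^sup>1(x) = 0\<close> they give \<open>\<Gamma>\<^sub>k\<^sub>+\<^sub>1(pr\<^sub>k\<^sub>+\<^sub>1(x)) = 0\<close>,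
  where \<open>x\<close> is read as an element of \<open>T\<close>. The component is taken because the chosen representative
  of a homogeneous class need not be homogeneous.
\<close>
lemma E_deg_B:
  assumes x: "x \<in> E_deg K B n" and n: "n \<ge> 2"
  shows "x = \<zero>\<^bsub>B\<^esub>"
proof -
  obtain k where k: "n = Suc k" "k \<ge> 1" using n by (cases n) auto
  let ?cB = "component B (grading B)"
  have xG: "x \<in> grading B n" and z: "comult_comp K B k 1 x = \<zero>\<^bsub>tensor K B B\<^esub>"
    using x k unfolding E_deg_def by auto
  have xB: "x \<in> carrier B" using xG graded_module_carrier[OF graded_B] by auto
  note xT = B_T[OF xB]
  note D = linear_map_closed[OF D_linear xT]
  note BBM = tensor_module[OF module_B module_B]
  note cl = component_linear[OF graded_B]
  have "comult_comp K B k 1 x = tmap K B B (?cB k) (?cB 1) (tmap K B B p p (comult T x))"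
    unfolding comult_comp_def B_simps(7) tmap_cong_carrier[OF B_simps(1,5,6), symmetric] ..
  also have "\<dots> = tmap K B B (\<lambda>x. ?cB k (p x)) (\<lambda>x. ?cB 1 (p x)) (comult T x)"
    by (rule tmap_comp[OF module_T module_T module_B module_B module_B module_B p_linear p_linear cl cl D])
  also have "\<dots> = tmap K B B (\<lambda>x. p (pr k x)) (\<lambda>x. p (pr 1 x)) (comult T x)"
    by (rule tmap_cong[OF module_T module_T module_B module_B linear_map_comp[OF p_linear cl]
          linear_map_comp[OF p_linear cl] component_B component_B D])
  finally have z': "tmap K B B (\<lambda>x. p (pr k x)) (\<lambda>x. p (pr 1 x)) (comult T x) = \<zero>\<^bsub>tensor K B B\<^esub>"
    using z by simp
  let ?g = "\<lambda>x. \<Gamma> k (pr k x)"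
  have g0: "?g z = \<zero>\<^bsub>T\<^esub>" if "z \<in> I" for z
    using I_component[OF that, of k] by (simp add: N_def)
  have h0: "pr 1 z = \<zero>\<^bsub>T\<^esub>" if "z \<in> I" for z using I_component[OF that, of 1] unfolding N_1 by simp
  note gT = linear_map_comp[OF pr_linear \<Gamma>_linear]
  note gq = linear_map_quot[OF module_T module_T gT I_submodule g0]
    and hq = linear_map_quot[OF module_T module_T pr_linear I_submodule h0]
  have gB: "linear_map K B T ?g" and hB: "linear_map K B T (pr 1)"
    unfolding B_linear by (rule gq(2), assumption, rule hq(2))
  have pp: "pr k (pr k x) = pr k x" if "x \<in> carrier T" for x k
    using pr_G[OF pr_in[OF that]] by simp
  note pl = linear_map_comp[OF pr_linear p_linear]
  have "\<zero>\<^bsub>TT\<^esub> = tmap K T T ?g (pr 1) (tmap K B B (\<lambda>x. p (pr k x)) (\<lambda>x. p (pr 1 x)) (comult T x))"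
    unfolding z'
    using linear_map_zero[OF BBM module_TT tmap_linear[OF module_B module_B module_T module_T gB hB]] by simp
  also have "\<dots> = tm (\<lambda>x. ?g (p (pr k x))) (\<lambda>x. pr 1 (p (pr 1 x))) (comult T x)"
    by (rule tmap_comp[OF module_T module_T module_B module_B module_T module_T pl pl gB hB D])
  also have "\<dots> = tm (\<lambda>x. \<Gamma> k (pr k x)) (\<lambda>x. id (pr 1 x)) (comult T x)"
    by (rule tmap_cong[OF module_T module_T module_T module_T linear_map_comp[OF pl gB] linear_map_comp[OF pl hB] _ _ D])
      (use linear_map_closed[OF pr_linear] in \<open>simp_all add: gq(1) hq(1) pp del: One_nat_def\<close>)
  also have "\<dots> = tm (\<Gamma> k) id (\<Delta> k 1 x)"
    unfolding comult_comp_def by (rule tm_comp[OF pr_linear pr_linear \<Gamma>_linear linear_map_id D, symmetric])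
  also have "\<Delta> k 1 x = \<Delta> k 1 (pr n x)"
    using \<Delta>_component[OF xT, of k 1] k by simp
  finally have "\<Gamma> n (pr n x) = \<zero>\<^bsub>T\<^esub>"
    unfolding k Gamma.simps id_def using linear_map_zero[OF module_TT module_T m_linear] by simp
  then have "pr n x \<in> I" using pr_in[OF xT] by (intro N_I[of _ n]) (simp add: N_def)
  then have "p (pr n x) = \<zero>\<^bsub>B\<^esub>" using p_zero_iff linear_map_closed[OF pr_linear xT] by simp
  moreover have "p (pr n x) = x"
    using component_B[OF xT, of n] p_B[OF xB] component_homogeneous[OF graded_B xG, of n] by simp
  ultimately show ?thesis by simp
qed

lemma E_ideal_B: "E_ideal K B = {\<zero>\<^bsub>B\<^esub>}"
proof -
  have "E_space K B \<subseteq> {\<zero>\<^bsub>B\<^esub>}"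
    unfolding E_space_def by (rule mspan_minimal[OF BM.zero_submodule]) (auto dest: E_deg_B)
  then have "E_ideal K B \<subseteq> {\<zero>\<^bsub>B\<^esub>}"
    unfolding E_ideal_def by (rule BR.genideal_minimal[OF BR.zeroideal])
  moreover have "ideal (E_ideal K B) B"
    unfolding E_ideal_def
    by (rule BR.genideal_ideal) (use \<open>E_space K B \<subseteq> {\<zero>\<^bsub>B\<^esub>}\<close> in auto)
  ultimately show ?thesis using additive_subgroup.zero_closed[OF ideal.axioms(1)] by blast
qed

lemma projection_bij: "bij_betw (coset_rep B (E_ideal K B)) (carrier B) (carrier (S_bialg K B))"
proof -
  have "inj_on (coset_rep B {\<zero>\<^bsub>B\<^esub>}) (carrier B)"
    by (rule inj_onI) (simp add: BM.coset_rep_eq_iff[OF BM.zero_submodule] BM.minus_eq_zero_iff)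
  then show ?thesis
    unfolding bij_betw_def S_bialg_def E_ideal_B by (simp add: quot_bialg_simps quot_simps)
qed

end

theorem theorem9p3:
  fixes K :: "('k,'r) ring_scheme"
    and V :: "('k,'v,'m) module_scheme"
    and c :: "('v \<times> 'v \<Rightarrow> 'k) \<Rightarrow> ('v \<times> 'v \<Rightarrow> 'k)"
    and T :: "('k, 'v list \<Rightarrow> 'k) braided_bialg"
  assumes "field K"
    and "braided_vector_space K V c"
    and "braided_tensor_algebra K V c T"
    and "quadratic_algebra K (Nichols K T) (grading (Nichols K T))"
  shows "sdeg K T \<le> 1"
proof -
  have "module K V" using assms(2) unfolding braided_vector_space_def by blast
  then interpret quadratic_nichols K V c T
    by (intro quadratic_nichols.intro braided_tensor_alg.intro quadratic_nichols_axioms.intro assms)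
  have "bij_betw (coset_rep (S_iter K T 1) (E_ideal K (S_iter K T 1)))
      (carrier (S_iter K T 1)) (carrier (S_iter K T (Suc 1)))"
    using projection_bij by (simp add: S_iter_def S_bialg_T)
  then show ?thesis
    unfolding sdeg_def one_enat_def by (intro Inf_lower) blast
qed

end
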